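(* Let $\Gamma$ be a discrete group containing a countable subset $A$ that is convergently embedded in a locally compact metrizable group $K$ and such that the subgroup $\langle A\rangle$ generated by $A$ has only finitely many elements of each finite order. Then $\Gamma$ contains a Riesz set $E$ such that $A_E(\Gamma)$ is not reflexive.
   Context: $A(\Gamma)$ and $B(\Gamma)$ are the Fourier and Fourier–Stieltjes algebras of $\Gamma$. For $E\subseteq\Gamma$, $A_E(\Gamma)=\{u\in A(\Gamma):u=0\text{ on }\Gamma\setminus E\}$. $E$ is a Riesz set if every function in $B(\Gamma)$ vanishing off $E$ belongs to $A(\Gamma)$. A countable set $A\subset\Gamma$ is convergently embedded in a locally compact group $K$ if there is an injective group homomorphism $\alpha:\langle A\rangle\to K$ with dense range such that $\alpha(A)$ is relatively compact and has exactly one limit point $p\in K$, and $p\notin\alpha(A)$. *)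

theory Defs
  imports "HOL-Analysis.Analysis" "HOL-Algebra.Algebra"
begin

text \<open>Complex functions on a discrete group \<open>G\<close> are represented by functions on the ambient
  type that vanish outside \<open>carrier G\<close>, so that equality of group functions is equality.\<close>

definition group_functions :: "('a, 'm) monoid_scheme \<Rightarrow> ('a \<Rightarrow> complex) set" where
  "group_functions G = {u. \<forall>x. x \<notin> carrier G \<longrightarrow> u x = 0}"

subsection \<open>The Fourier--Stieltjes algebra\<close>

definition hermitian_form :: "('a, 'm) monoid_scheme \<Rightarrow> ('a \<Rightarrow> complex) \<Rightarrow> 'a set \<Rightarrow> ('a \<Rightarrow> complex) \<Rightarrow> complex" where
  "hermitian_form G \<phi> S c =
     (\<Sum>x\<in>S. \<Sum>y\<in>S. c x * cnj (c y) * \<phi> (inv\<^bsub>G\<^esub> y \<otimes>\<^bsub>G\<^esub> x))"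

definition positive_definite :: "('a, 'm) monoid_scheme \<Rightarrow> ('a \<Rightarrow> complex) \<Rightarrow> bool" where
  "positive_definite G \<phi> \<longleftrightarrow> \<phi> \<in> group_functions G \<and>
     (\<forall>S c. finite S \<and> S \<subseteq> carrier G \<longrightarrow> hermitian_form G \<phi> S c \<in> \<real>\<^sub>\<ge>\<^sub>0)"

text \<open>Following Eymard, \<open>B(G)\<close> is the complex linear span of the (here automatically continuous)
  positive definite functions.\<close>

definition fourier_stieltjes_algebra :: "('a, 'm) monoid_scheme \<Rightarrow> ('a \<Rightarrow> complex) set" where
  "fourier_stieltjes_algebra G =
     {u. \<exists>n c \<phi>. (\<forall>i<n. positive_definite G (\<phi> i)) \<and>
                  u = (\<lambda>x. \<Sum>i<(n::nat). c i * \<phi> i x)}"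

definition finitely_supported :: "('a, 'm) monoid_scheme \<Rightarrow> ('a \<Rightarrow> complex) set" where
  "finitely_supported G = {f \<in> group_functions G. finite {x. f x \<noteq> 0}}"

text \<open>The norm of \<open>f\<close> in the full group C*-algebra, \<open>\<parallel>f\<parallel> = sup \<phi>(f\<^sup>* f)\<^sup>1\<^sup>/\<^sup>2\<close> over all states \<open>\<phi>\<close>.
  The states of \<open>C\<^sup>*(G)\<close> are the positive definite functions with \<open>\<phi>(1) = 1\<close>, and
  \<open>\<phi>(f\<^sup>* f) = \<Sum>\<^bsub>x,y\<^esub> f(x) f(y)\<^sup>* \<phi>(y\<^sup>-\<^sup>1 x)\<close>.\<close>

definition cstar_norm :: "('a, 'm) monoid_scheme \<Rightarrow> ('a \<Rightarrow> complex) \<Rightarrow> real" where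
  "cstar_norm G f =
     Sup {sqrt (Re (hermitian_form G \<phi> {x. f x \<noteq> 0} f)) | \<phi>.
            positive_definite G \<phi> \<and> \<phi> \<one>\<^bsub>G\<^esub> = 1}"

text \<open>\<open>B(G)\<close> carries the norm of the dual of \<open>C\<^sup>*(G)\<close>, in which the finitely supported functions
  are dense.\<close>

definition fourier_stieltjes_norm :: "('a, 'm) monoid_scheme \<Rightarrow> ('a \<Rightarrow> complex) \<Rightarrow> real" where
  "fourier_stieltjes_norm G u =
     Sup {norm (\<Sum>x\<in>{x. f x \<noteq> 0}. f x * u x) | f.
            f \<in> finitely_supported G \<and> cstar_norm G f \<le> 1}"

subsection \<open>The Fourier algebra\<close>

text \<open>Following Eymard, \<open>A(G)\<close> is the norm closure in \<open>B(G)\<close> of its compactly supported elements;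
  it carries the norm of \<open>B(G)\<close>.\<close>

definition fourier_algebra :: "('a, 'm) monoid_scheme \<Rightarrow> ('a \<Rightarrow> complex) set" where
  "fourier_algebra G =
     {u \<in> fourier_stieltjes_algebra G. \<forall>\<epsilon>>0.
        \<exists>v \<in> fourier_stieltjes_algebra G \<inter> finitely_supported G.
          fourier_stieltjes_norm G (\<lambda>x. u x - v x) < \<epsilon>}"

definition fourier_supported :: "('a, 'm) monoid_scheme \<Rightarrow> 'a set \<Rightarrow> ('a \<Rightarrow> complex) set" where
  "fourier_supported G E = {u \<in> fourier_algebra G. \<forall>x \<in> carrier G - E. u x = 0}"

definition riesz_set :: "('a, 'm) monoid_scheme \<Rightarrow> 'a set \<Rightarrow> bool" where
  "riesz_set G E \<longleftrightarrow> E \<subseteq> carrier G \<and>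
     (\<forall>u \<in> fourier_stieltjes_algebra G.
        (\<forall>x \<in> carrier G - E. u x = 0) \<longrightarrow> u \<in> fourier_algebra G)"

subsection \<open>Reflexivity\<close>

text \<open>A normed space is given by a set \<open>V\<close> of complex-valued functions, closed under the pointwise
  linear operations, and a norm \<open>N\<close> on it. Functionals are normalised to be \<open>0\<close> outside \<open>V\<close>.
  The dual is then again a space of complex-valued functions (with domain type \<open>'x \<Rightarrow> complex\<close>),
  so the bidual is obtained by iterating the construction.\<close>

definition dual_space ::
    "('x \<Rightarrow> complex) set \<Rightarrow> (('x \<Rightarrow> complex) \<Rightarrow> real) \<Rightarrow> (('x \<Rightarrow> complex) \<Rightarrow> complex) set" where
  "dual_space V N =
     {\<phi>. (\<forall>u\<in>V. \<forall>v\<in>V. \<phi> (\<lambda>x. u x + v x) = \<phi> u + \<phi> v) \<and>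
          (\<forall>c. \<forall>u\<in>V. \<phi> (\<lambda>x. c * u x) = c * \<phi> u) \<and>
          (\<exists>C. \<forall>u\<in>V. norm (\<phi> u) \<le> C * N u) \<and>
          (\<forall>u. u \<notin> V \<longrightarrow> \<phi> u = 0)}"

definition dual_norm ::
    "('x \<Rightarrow> complex) set \<Rightarrow> (('x \<Rightarrow> complex) \<Rightarrow> real) \<Rightarrow> (('x \<Rightarrow> complex) \<Rightarrow> complex) \<Rightarrow> real" where
  "dual_norm V N \<phi> = Sup {norm (\<phi> u) | u. u \<in> V \<and> N u \<le> 1}"

text \<open>Reflexivity means that the canonical embedding into the bidual is onto.\<close>

definition reflexive_space :: "('x \<Rightarrow> complex) set \<Rightarrow> (('x \<Rightarrow> complex) \<Rightarrow> real) \<Rightarrow> bool" where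
  "reflexive_space V N \<longleftrightarrow>
     (\<forall>\<Phi> \<in> dual_space (dual_space V N) (dual_norm V N).
        \<exists>u\<in>V. \<forall>\<phi>\<in>dual_space V N. \<Phi> \<phi> = \<phi> u)"

subsection \<open>Convergently embedded sets\<close>

definition topological_group :: "('b, 'n) monoid_scheme \<Rightarrow> 'b topology \<Rightarrow> bool" where
  "topological_group K T \<longleftrightarrow> group K \<and> topspace T = carrier K \<and>
     continuous_map (prod_topology T T) T (\<lambda>(x, y). x \<otimes>\<^bsub>K\<^esub> y) \<and>
     continuous_map T T (\<lambda>x. inv\<^bsub>K\<^esub> x)"

definition locally_compact_group :: "('b, 'n) monoid_scheme \<Rightarrow> 'b topology \<Rightarrow> bool" where
  "locally_compact_group K T \<longleftrightarrow>
     topological_group K T \<and> Hausdorff_space T \<and> locally_compact_space T"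

text \<open>For \<open>A \<subseteq> carrier G\<close> the subgroup \<open>\<langle>A\<rangle>\<close> is \<open>subgroup_generated G A\<close>, with carrier
  \<open>generate G A\<close>.\<close>

definition convergently_embedded ::
    "('a, 'm) monoid_scheme \<Rightarrow> 'a set \<Rightarrow> ('b, 'n) monoid_scheme \<Rightarrow> 'b topology \<Rightarrow> bool" where
  "convergently_embedded G A K T \<longleftrightarrow>
     A \<subseteq> carrier G \<and> countable A \<and> locally_compact_group K T \<and>
     (\<exists>\<alpha> \<in> hom (subgroup_generated G A) K.
        inj_on \<alpha> (generate G A) \<and>
        T closure_of (\<alpha> ` generate G A) = topspace T \<and>
        compactin T (T closure_of (\<alpha> ` A)) \<and>
        (\<exists>p. T derived_set_of (\<alpha> ` A) = {p} \<and> p \<notin> \<alpha> ` A))"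

end

(* The Riesz property comes from a quantitative form of the fact that A(G) is an L-summand of B(G):
   if u has distance d from the finitely supported functions, then u - v (v finitely supported) is
   almost normed by contractions c of the group algebra that are small in l^2; replacing a
   contraction f by P c + (1 - P) f (1 - Q), with P = c c* and Q = c* c, changes its coefficients
   little, and so two near-best finitely supported approximations of u are close to each other.
   Let g be the coefficient <v_{alpha x}, v_p> of a unit vector v of the regular representation
   of K, where p is the limit point. Multiplication by g is a contraction of B(G), and g < 1 except
   where alpha x = p. If 1 - g is summable over E and u vanishes off E, then (1 - g) u is absolutely
   summable, so v near-best implies (1 - g) u + g v near-best; the near-best approximations converge
   to some v with (1 - g) (u - v) = 0, and hence u belongs to A(G).

   For non-reflexivity, E is a union of sets {a d^(i-j) : i, j < n}, with a and d taken from the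
   convergent sequence such that 1 - g is tiny on them; this uses that only finitely many elements
   have a given order. They carry Fejer functions w_k of norm at most 1 which tend to 0 pointwise.
   Combining the means of the points a d^i as above gives contractions T_k, and a generalised limit
   of the functionals T_k has real part at least 1/2 at every w_k. *)

theory Submission
  imports Defs
begin

section \<open>The Hahn--Banach theorem and generalised limits\<close>

text \<open>The combination of two contractions is modelled on partial isometries. If c is one, then
  P and Q are its final and initial projections, P c = c, and c + (1 - P) f (1 - Q) is a contraction
  because its two parts have orthogonal initial and orthogonal final spaces. A general contraction
  lacks this geometry; with c c* c in place of c the bound 1 still holds exactly, and a functional
  nearly normed by c is nearly normed by c c* c too.

  The two demands on E pull against each other: summability of 1 - g wants E to cluster fast at p,
  non-reflexivity wants progressions of unbounded length. They are compatible because the length is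
  fixed before d, so that finitely many quotients d^(i-j) have to be brought close to 1 in K.

  Non-reflexivity is a failure of two limits to commute: the value of T_k at w_j keeps real part at
  least 1/2 for all k from j on, whereas the value of w_j at any fixed point is eventually
  0.\<close>

definition sublinear_on :: "('x \<Rightarrow> 'c::real_vector) set \<Rightarrow> (('x \<Rightarrow> 'c) \<Rightarrow> real) \<Rightarrow> bool" where
  "sublinear_on V p \<longleftrightarrow>
     (\<forall>u\<in>V. \<forall>v\<in>V. p (\<lambda>x. u x + v x) \<le> p u + p v) \<and>
     (\<forall>c>0. \<forall>u\<in>V. p (\<lambda>x. c *\<^sub>R u x) = c * p u)"

lemma sublinear_on_add:
  "sublinear_on V p \<Longrightarrow> u \<in> V \<Longrightarrow> v \<in> V \<Longrightarrow> p (\<lambda>x. u x + v x) \<le> p u + p v"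
  unfolding sublinear_on_def by simp

lemma sublinear_on_scale:
  "sublinear_on V p \<Longrightarrow> c > 0 \<Longrightarrow> u \<in> V \<Longrightarrow> p (\<lambda>x. c *\<^sub>R u x) = c * p u"
  unfolding sublinear_on_def by simp

text \<open>Linear structure on a set of functions, with real scalars only: one Hahn-Banach theorem
  then serves the bounded real sequences and the finitely supported complex functions.\<close>

locale function_space =
  fixes V :: "('x \<Rightarrow> 'c::real_vector) set"
  assumes zero: "(\<lambda>x. 0) \<in> V"
    and add: "u \<in> V \<Longrightarrow> v \<in> V \<Longrightarrow> (\<lambda>x. u x + v x) \<in> V"
    and scale: "u \<in> V \<Longrightarrow> (\<lambda>x. c *\<^sub>R u x) \<in> V"
begin

lemma sublinear_zero:
  assumes "sublinear_on V p" shows "p (\<lambda>x. 0) = 0"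
proof -
  from sublinear_on_scale[OF assms, of 2, OF _ zero] show ?thesis by simp
qed

lemma sublinear_neg:
  assumes p: "sublinear_on V p" and u: "u \<in> V"
  shows "- p (\<lambda>x. - u x) \<le> p u"
proof -
  have n: "(\<lambda>x. - u x) \<in> V" using scale[OF u, of "-1"] by simp
  have "p (\<lambda>x. u x + - u x) \<le> p u + p (\<lambda>x. - u x)"
    by (rule sublinear_on_add[OF p u n])
  then show ?thesis using sublinear_zero[OF p] by simp
qed

text \<open>Zorn's lemma downwards: along a chain the pointwise infimum is again sublinear, and
  minus the value of p at -u bounds every member from below at u.\<close>

lemma minimal_sublinear:
  assumes p: "sublinear_on V p"
  obtains q where "sublinear_on V q" "\<And>u. u \<in> V \<Longrightarrow> q u \<le> p u"
    "\<And>r. sublinear_on V r \<Longrightarrow> (\<And>u. u \<in> V \<Longrightarrow> r u \<le> q u) \<Longrightarrow> (\<And>u. u \<in> V \<Longrightarrow> r u = q u)"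
proof -
  \<comment> \<open>Values off V are fixed at 0, as nothing else would bound a chain from below
    there. \<open>P a b\<close> reads b <= a, so a maximal element is a minimal functional.\<close>
  define Q where "Q = {q. sublinear_on V q \<and> (\<forall>u\<in>V. q u \<le> p u) \<and> (\<forall>u. u \<notin> V \<longrightarrow> q u = 0)}"
  define P where "P = (\<lambda>(a::('x \<Rightarrow> 'c) \<Rightarrow> real) b. \<forall>u. b u \<le> a u)"
  have p0: "(\<lambda>u. if u \<in> V then p u else 0) \<in> Q"
    using p add scale unfolding Q_def sublinear_on_def by auto
  have po: "partial_order_on Q (relation_of P Q)"
    unfolding partial_order_on_def preorder_on_def refl_on_def trans_def antisym_def
      relation_of_def P_def by (auto simp: fun_eq_iff eq_iff) (meson order_trans)+
  have "\<exists>m\<in>Q. \<forall>a\<in>Q. P m a \<longrightarrow> a = m"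
  proof (rule predicate_Zorn[OF po])
    fix C assume C: "C \<in> Chains (relation_of P Q)"
    show "\<exists>u\<in>Q. \<forall>a\<in>C. P a u"
    proof (cases "C = {}")
      case True then show ?thesis using p0 by auto
    next
      case False
      have CQ: "C \<subseteq> Q" using C unfolding Chains_def relation_of_def by auto
      have tot: "P a b \<or> P b a" if "a \<in> C" "b \<in> C" for a b
        using C that unfolding Chains_def relation_of_def by auto
      define q where "q = (\<lambda>u. INF a\<in>C. a u)"
      have lb: "- p (\<lambda>x. - u x) \<le> a u" if "a \<in> C" "u \<in> V" for a u
      proof -
        have aQ: "a \<in> Q" using CQ that by auto
        have "(\<lambda>x. - u x) \<in> V" using scale[OF that(2), of "-1"] by simp
        then have "a (\<lambda>x. - u x) \<le> p (\<lambda>x. - u x)" using aQ unfolding Q_def by auto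
        moreover have "- a (\<lambda>x. - u x) \<le> a u"
          using aQ that(2) by (intro sublinear_neg) (auto simp: Q_def)
        ultimately show ?thesis by linarith
      qed
      have off: "a u = 0" if "a \<in> C" "u \<notin> V" for a u using CQ that unfolding Q_def by auto
      have bdd: "bdd_below ((\<lambda>a. a u) ` C)" for u
      proof (cases "u \<in> V")
        case True then show ?thesis using lb[OF _ True] by (meson bdd_belowI2)
      next
        case False
        show ?thesis
        proof (rule bdd_belowI2[of _ 0])
          fix a assume "a \<in> C"
          from off[OF this False] show "0 \<le> a u" by simp
        qed
      qed
      have le: "q u \<le> a u" if "a \<in> C" for a u
        unfolding q_def by (rule cINF_lower[OF bdd that])
      have ge: "c \<le> q u" if "\<And>a. a \<in> C \<Longrightarrow> c \<le> a u" for c u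
        unfolding q_def using that False by (intro cINF_greatest) auto
      have qQ: "q \<in> Q"
      proof -
        have "q (\<lambda>x. u x + v x) \<le> q u + q v" if u: "u \<in> V" and v: "v \<in> V" for u v
        proof -
          have *: "q (\<lambda>x. u x + v x) \<le> a u + b v" if ab: "a \<in> C" "b \<in> C" for a b
          proof -
            have "\<exists>c. c \<in> C \<and> c u \<le> a u \<and> c v \<le> b v"
            proof (cases "P a b")
              case True then show ?thesis using ab unfolding P_def by (intro exI[of _ b]) simp
            next
              case False
              then have "P b a" using tot[OF ab] by simp
              then show ?thesis using ab unfolding P_def by (intro exI[of _ a]) simp
            qed
            then obtain c where c: "c \<in> C" "c u \<le> a u" "c v \<le> b v" by blast
            have "q (\<lambda>x. u x + v x) \<le> c (\<lambda>x. u x + v x)" by (rule le[OF c(1)])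
            also have "\<dots> \<le> c u + c v"
              by (rule sublinear_on_add[OF _ u v]) (use CQ c(1) in \<open>auto simp: Q_def\<close>)
            finally show ?thesis using c by linarith
          qed
          have **: "q (\<lambda>x. u x + v x) - b v \<le> q u" if "b \<in> C" for b
            
          proof (rule ge)
            fix a assume "a \<in> C"
            from *[OF this that] show "q (\<lambda>x. u x + v x) - b v \<le> a u" by simp
          qed
          have "q (\<lambda>x. u x + v x) - q u \<le> b v" if "b \<in> C" for b
            using **[OF that] by linarith
          then have "q (\<lambda>x. u x + v x) - q u \<le> q v" by (rule ge)
          then show ?thesis by linarith
        qed
        moreover have "q (\<lambda>x. c *\<^sub>R u x) = c * q u" if c: "c > 0" and u: "u \<in> V" for c u
        proof (rule antisym)
          have h: "a (\<lambda>x. c *\<^sub>R u x) = c * a u" if "a \<in> C" for a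
            by (rule sublinear_on_scale[OF _ c u]) (use CQ that in \<open>auto simp: Q_def\<close>)
          have "q (\<lambda>x. c *\<^sub>R u x) / c \<le> q u"
          proof (rule ge)
            fix a assume "a \<in> C"
            then show "q (\<lambda>x. c *\<^sub>R u x) / c \<le> a u"
              using le[of a "\<lambda>x. c *\<^sub>R u x"] h c by (simp add: field_simps)
          qed
          then show "q (\<lambda>x. c *\<^sub>R u x) \<le> c * q u" using c by (simp add: field_simps)
          show "c * q u \<le> q (\<lambda>x. c *\<^sub>R u x)"
          proof (rule ge)
            fix a assume a: "a \<in> C"
            from le[OF a, of u] h[OF a] c show "c * q u \<le> a (\<lambda>x. c *\<^sub>R u x)" by simp
          qed
        qed
        moreover have "q u \<le> p u" if "u \<in> V" for u
        proof -
          obtain a where "a \<in> C" using False by auto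
          moreover have "a u \<le> p u" using \<open>a \<in> C\<close> CQ that unfolding Q_def by auto
          ultimately show ?thesis using le[of a u] by linarith
        qed
        moreover have "q u = 0" if "u \<notin> V" for u
        proof -
          obtain a where a: "a \<in> C" using False by auto
          have "q u \<le> 0" using le[OF a, of u] off[OF a that] by simp
          moreover have "0 \<le> q u"
          proof (rule ge)
            fix b assume "b \<in> C"
            from off[OF this that] show "0 \<le> b u" by simp
          qed
          ultimately show ?thesis by simp
        qed
        ultimately show ?thesis unfolding Q_def sublinear_on_def by simp
      qed
      then show ?thesis using le unfolding P_def by auto
    qed
  qed
  then obtain q where q: "q \<in> Q" and min: "\<And>a. a \<in> Q \<Longrightarrow> P q a \<Longrightarrow> a = q" by auto
  show thesis
  proof (rule that)
    show "sublinear_on V q" "\<And>u. u \<in> V \<Longrightarrow> q u \<le> p u" using q unfolding Q_def by auto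
    fix r u assume r: "sublinear_on V r" "\<And>u. u \<in> V \<Longrightarrow> r u \<le> q u" and u: "u \<in> V"
    have qp: "q u \<le> p u" if "u \<in> V" for u using q that unfolding Q_def by auto
    have "sublinear_on V (\<lambda>u. if u \<in> V then r u else 0)"
      using r(1) add scale unfolding sublinear_on_def by auto
    moreover have "r u \<le> p u" if "u \<in> V" for u using r(2)[OF that] qp[OF that] by linarith
    ultimately have "(\<lambda>u. if u \<in> V then r u else 0) \<in> Q" unfolding Q_def by simp
    moreover have "P q (\<lambda>u. if u \<in> V then r u else 0)"
      using r(2) q unfolding P_def Q_def by auto
    ultimately have "(\<lambda>u. if u \<in> V then r u else 0) = q" by (rule min)
    from fun_cong[OF this, of u] show "r u = q u" using u by simp
  qed
qed

text \<open>The infimum r(u) of q(u + t y) - t q(y) over t >= 0 is sublinear and below q, so it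
  equals q by minimality. Taking t = 1 gives superadditivity.\<close>

lemma minimal_sublinear_additive:
  assumes q: "sublinear_on V q"
    and min: "\<And>r u. sublinear_on V r \<Longrightarrow> (\<And>u. u \<in> V \<Longrightarrow> r u \<le> q u) \<Longrightarrow> u \<in> V \<Longrightarrow> r u = q u"
    and u: "u \<in> V" and y: "y \<in> V"
  shows "q (\<lambda>x. u x + y x) = q u + q y"
proof -
  have qa: "q (\<lambda>x. u x + v x) \<le> q u + q v" if "u \<in> V" "v \<in> V" for u v
    by (rule sublinear_on_add[OF q that])
  have qh: "q (\<lambda>x. c *\<^sub>R u x) = c * q u" if "c \<ge> 0" "u \<in> V" for c u
    using sublinear_on_scale[OF q, of c u] that sublinear_zero[OF q] by (cases "c = 0") auto
  define F where "F = (\<lambda>u t. q (\<lambda>x. u x + t *\<^sub>R y x) - t * q y)"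
  define r where "r = (\<lambda>u. INF t\<in>{0..}. F u t)"
  have lb: "- q (\<lambda>x. - u x) \<le> F u t" if "u \<in> V" "t \<ge> 0" for u t
  proof -
    have n: "(\<lambda>x. - u x) \<in> V" using scale[OF that(1), of "-1"] by simp
    have "q (\<lambda>x. (u x + t *\<^sub>R y x) + - u x) \<le> q (\<lambda>x. u x + t *\<^sub>R y x) + q (\<lambda>x. - u x)"
      by (rule qa) (use n that add scale y in auto)
    moreover have "(\<lambda>x. (u x + t *\<^sub>R y x) + - u x) = (\<lambda>x. t *\<^sub>R y x)" by auto
    ultimately show ?thesis using qh[OF that(2) y] unfolding F_def by simp
  qed
  have bdd: "bdd_below (F u ` {0..})" if "u \<in> V" for u
    using lb[OF that] by (intro bdd_belowI2[of _ "- q (\<lambda>x. - u x)"]) auto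
  have le: "r u \<le> F u t" if "u \<in> V" "t \<ge> 0" for u t
    unfolding r_def by (rule cINF_lower[OF bdd]) (use that in auto)
  have ge: "c \<le> r u" if "\<And>t. t \<ge> 0 \<Longrightarrow> c \<le> F u t" for c u
    unfolding r_def using that by (intro cINF_greatest) auto
  have radd: "r (\<lambda>x. u x + v x) \<le> r u + r v" if u: "u \<in> V" and v: "v \<in> V" for u v
  proof -
    have *: "r (\<lambda>x. u x + v x) \<le> F u s + F v t" if "s \<ge> 0" "t \<ge> 0" for s t
    proof -
      have "r (\<lambda>x. u x + v x) \<le> F (\<lambda>x. u x + v x) (s + t)"
        by (rule le) (use that add u v in auto)
      also have "q (\<lambda>x. (u x + s *\<^sub>R y x) + (v x + t *\<^sub>R y x))
          \<le> q (\<lambda>x. u x + s *\<^sub>R y x) + q (\<lambda>x. v x + t *\<^sub>R y x)"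
        by (rule qa) (use u v y add scale in auto)
      then have "F (\<lambda>x. u x + v x) (s + t) \<le> F u s + F v t"
        unfolding F_def by (simp add: algebra_simps)
      finally show ?thesis .
    qed
    have **: "r (\<lambda>x. u x + v x) - F v t \<le> r u" if "t \<ge> 0" for t
      
    proof (rule ge)
      fix s :: real assume "s \<ge> 0"
      from *[OF this that] show "r (\<lambda>x. u x + v x) - F v t \<le> F u s" by simp
    qed
    have "r (\<lambda>x. u x + v x) - r u \<le> F v t" if "t \<ge> 0" for t
      using **[OF that] by linarith
    then have "r (\<lambda>x. u x + v x) - r u \<le> r v" by (rule ge)
    then show ?thesis by linarith
  qed
  have rh: "r (\<lambda>x. c *\<^sub>R u x) = c * r u" if c: "c > 0" and u: "u \<in> V" for c u
  proof (rule antisym)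
    have h: "F (\<lambda>x. c *\<^sub>R u x) (c * t) = c * F u t" if "t \<ge> 0" for t
    proof -
      have "q (\<lambda>x. c *\<^sub>R (u x + t *\<^sub>R y x)) = c * q (\<lambda>x. u x + t *\<^sub>R y x)"
        by (rule qh) (use c u y add scale in auto)
      then show ?thesis unfolding F_def by (simp add: algebra_simps)
    qed
    have "r (\<lambda>x. c *\<^sub>R u x) / c \<le> r u"
    proof (rule ge)
      fix t :: real assume t: "t \<ge> 0"
      have "r (\<lambda>x. c *\<^sub>R u x) \<le> F (\<lambda>x. c *\<^sub>R u x) (c * t)"
        by (rule le) (use scale u c t in auto)
      then show "r (\<lambda>x. c *\<^sub>R u x) / c \<le> F u t" using h[OF t] c by (simp add: field_simps)
    qed
    then show "r (\<lambda>x. c *\<^sub>R u x) \<le> c * r u" using c by (simp add: field_simps)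
    show "c * r u \<le> r (\<lambda>x. c *\<^sub>R u x)"
    proof (rule ge)
      fix t :: real assume t: "t \<ge> 0"
      then show "c * r u \<le> F (\<lambda>x. c *\<^sub>R u x) t"
        using h[of "t / c"] le[OF u, of "t / c"] c by simp
    qed
  qed
  have "r u = q u"
  proof (rule min)
    show "sublinear_on V r" using radd rh unfolding sublinear_on_def by simp
    show "r v \<le> q v" if "v \<in> V" for v using le[OF that, of 0] unfolding F_def by simp
  qed (rule u)
  then have "q u \<le> q (\<lambda>x. u x + y x) - q y" using le[OF u, of 1] unfolding F_def by simp
  then show ?thesis using qa[OF u y] by linarith
qed

text \<open>A minimal sublinear functional below p is already linear: additivity is the preceding
  lemma, and it extends positive homogeneity to all real factors.\<close>

theorem hahn_banach:
  assumes p: "sublinear_on V p"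
  obtains L where "\<And>u v. u \<in> V \<Longrightarrow> v \<in> V \<Longrightarrow> L (\<lambda>x. u x + v x) = L u + L v"
    "\<And>c u. u \<in> V \<Longrightarrow> L (\<lambda>x. c *\<^sub>R u x) = c * L u"
    "\<And>u. u \<in> V \<Longrightarrow> L u \<le> p u"
proof -
  obtain q where q: "sublinear_on V q" "\<And>u. u \<in> V \<Longrightarrow> q u \<le> p u"
    and min: "\<And>r u. sublinear_on V r \<Longrightarrow> (\<And>u. u \<in> V \<Longrightarrow> r u \<le> q u) \<Longrightarrow> u \<in> V \<Longrightarrow> r u = q u"
    by (fact minimal_sublinear[OF p])
  have add: "q (\<lambda>x. u x + v x) = q u + q v" if "u \<in> V" "v \<in> V" for u v
  proof (rule minimal_sublinear_additive[OF q(1) _ that])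
    fix r w assume r: "sublinear_on V r" "\<And>u. u \<in> V \<Longrightarrow> r u \<le> q u" and w: "w \<in> V"
    show "r w = q w" by (rule min[OF r(1) _ w]) (rule r(2))
  qed
  have pos: "q (\<lambda>x. c *\<^sub>R u x) = c * q u" if "c > 0" "u \<in> V" for c u
    by (rule sublinear_on_scale[OF q(1) that])
  have neg: "q (\<lambda>x. - u x) = - q u" if "u \<in> V" for u
    using add[OF that scale[OF that, of "-1"]] sublinear_zero[OF q(1)] by simp
  have "q (\<lambda>x. c *\<^sub>R u x) = c * q u" if "u \<in> V" for c u
  proof -
    consider "c > 0" | "c = 0" | "c < 0" by linarith
    then show ?thesis
    proof cases
      case 3
      then show ?thesis using pos[of "-c" u] neg[OF scale[OF that], of "-c"] that by simp
    qed (use pos sublinear_zero[OF q(1)] that in auto)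
  qed
  from that[OF add this q(2)] show thesis .
qed

end

lemma Bseq_plus:
  fixes s t :: "nat \<Rightarrow> 'a::real_normed_vector"
  assumes "Bseq s" "Bseq t" shows "Bseq (\<lambda>n. s n + t n)"
proof -
  obtain M where M: "\<And>n. norm (s n) \<le> M" using assms(1) unfolding Bseq_def by blast
  obtain N where N: "\<And>n. norm (t n) \<le> N" using assms(2) unfolding Bseq_def by blast
  show ?thesis by (rule BseqI'[of _ "M + N"]) (intro norm_triangle_le add_mono M N)
qed

text \<open>A Banach limit without shift invariance. It replaces ultrafilters and weak compactness,
  both for the Haar functional and in the bidual.\<close>

definition limit_functional :: "((nat \<Rightarrow> real) \<Rightarrow> real) \<Rightarrow> bool" where
  "limit_functional L \<longleftrightarrow>
     (\<forall>s t. Bseq s \<longrightarrow> Bseq t \<longrightarrow> L (\<lambda>n. s n + t n) = L s + L t) \<and>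
     (\<forall>c s. Bseq s \<longrightarrow> L (\<lambda>n. c * s n) = c * L s) \<and>
     (\<forall>s c. Bseq s \<longrightarrow> (\<forall>\<^sub>F n in sequentially. s n \<le> c) \<longrightarrow> L s \<le> c) \<and>
     (\<forall>s c. Bseq s \<longrightarrow> (\<forall>\<^sub>F n in sequentially. c \<le> s n) \<longrightarrow> c \<le> L s)"

lemma limit_functional_exists:
  obtains L where "limit_functional L"
proof -
  define V where "V = {s :: nat \<Rightarrow> real. Bseq s}"
  interpret function_space V
  proof
    fix u v :: "nat \<Rightarrow> real" and c :: real assume "u \<in> V"
    then have u: "Bseq u" unfolding V_def by simp
    show "(\<lambda>n. c *\<^sub>R u n) \<in> V"
      using Bseq_mult[OF Bfun_const u] unfolding V_def by simp
    assume "v \<in> V"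
    then show "(\<lambda>n. u n + v n) \<in> V" using Bseq_plus[OF u] unfolding V_def by simp
  qed (simp add: V_def Bfun_const)
  \<comment> \<open>\<open>Inf (S s)\<close> is the upper limit of s, which is sublinear. A linear
    functional below it also lies above the lower limit, as one sees at -s.\<close>
  define S where "S = (\<lambda>s :: nat \<Rightarrow> real. {c. \<forall>\<^sub>F n in sequentially. s n \<le> c})"
  define p where "p = (\<lambda>s. Inf (S s))"
  have ne: "S s \<noteq> {}" and bdd: "bdd_below (S s)" if sV: "s \<in> V" for s
  proof -
    obtain K where K: "\<And>n. \<bar>s n\<bar> \<le> K" using sV unfolding V_def Bseq_def real_norm_def by blast
    have "s n \<le> K" for n using K[of n] by linarith
    then have "K \<in> S s" unfolding S_def by simp
    then show "S s \<noteq> {}" by auto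
    have "-K \<le> c" if c: "c \<in> S s" for c
    proof -
      obtain n where "s n \<le> c" using c unfolding S_def
        by (auto simp: eventually_sequentially)
      then show ?thesis using K[of n] by linarith
    qed
    then show "bdd_below (S s)" by (meson bdd_belowI)
  qed
  have le: "p s \<le> c" if "s \<in> V" "\<forall>\<^sub>F n in sequentially. s n \<le> c" for s c
    unfolding p_def by (rule cInf_lower) (use that bdd in \<open>auto simp: S_def\<close>)
  have ge: "c \<le> p s" if "s \<in> V" "\<And>b. \<forall>\<^sub>F n in sequentially. s n \<le> b \<Longrightarrow> c \<le> b" for s c
    unfolding p_def by (rule cInf_greatest) (use that ne in \<open>auto simp: S_def\<close>)
  have sub: "sublinear_on V p"
  proof -
    have "p (\<lambda>x. u x + v x) \<le> p u + p v" if u: "u \<in> V" and v: "v \<in> V" for u v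
    proof -
      have *: "p (\<lambda>x. u x + v x) \<le> a + b" if "\<forall>\<^sub>F n in sequentially. u n \<le> a"
        "\<forall>\<^sub>F n in sequentially. v n \<le> b" for a b
        by (rule le[OF add[OF u v]]) (use that in eventually_elim, linarith)
      have **: "p (\<lambda>x. u x + v x) - b \<le> p u" if "\<forall>\<^sub>F n in sequentially. v n \<le> b" for b
      proof (rule ge[OF u])
        fix a assume "\<forall>\<^sub>F n in sequentially. u n \<le> a"
        from *[OF this that] show "p (\<lambda>x. u x + v x) - b \<le> a" by simp
      qed
      have "p (\<lambda>x. u x + v x) - p u \<le> b" if "\<forall>\<^sub>F n in sequentially. v n \<le> b" for b
        using **[OF that] by linarith
      then have "p (\<lambda>x. u x + v x) - p u \<le> p v" by (rule ge[OF v])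
      then show ?thesis by linarith
    qed
    moreover have "p (\<lambda>x. c *\<^sub>R u x) = c * p u" if c: "c > 0" and u: "u \<in> V" for c u
    proof (rule antisym)
      have "p (\<lambda>x. c *\<^sub>R u x) / c \<le> p u"
      proof (rule ge[OF u])
        fix b assume "\<forall>\<^sub>F n in sequentially. u n \<le> b"
        then have "\<forall>\<^sub>F n in sequentially. c *\<^sub>R u n \<le> c * b"
          by eventually_elim (use c in auto)
        from le[OF scale[OF u] this] show "p (\<lambda>x. c *\<^sub>R u x) / c \<le> b"
          using c by (simp add: field_simps)
      qed
      then show "p (\<lambda>x. c *\<^sub>R u x) \<le> c * p u" using c by (simp add: field_simps)
      show "c * p u \<le> p (\<lambda>x. c *\<^sub>R u x)"
      proof (rule ge[OF scale[OF u]])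
        fix b assume "\<forall>\<^sub>F n in sequentially. c *\<^sub>R u n \<le> b"
        then have "\<forall>\<^sub>F n in sequentially. u n \<le> b / c"
          by eventually_elim (use c in \<open>auto simp: field_simps\<close>)
        from le[OF u this] show "c * p u \<le> b" using c by (simp add: field_simps)
      qed
    qed
    ultimately show ?thesis unfolding sublinear_on_def by simp
  qed
  obtain L where
    L: "\<And>u v. u \<in> V \<Longrightarrow> v \<in> V \<Longrightarrow> L (\<lambda>x. u x + v x) = L u + L v"
    "\<And>c u. u \<in> V \<Longrightarrow> L (\<lambda>x. c *\<^sub>R u x) = c * L u"
    "\<And>u. u \<in> V \<Longrightarrow> L u \<le> p u"
    by (fact hahn_banach[OF sub])
  have up: "L s \<le> c" if "Bseq s" "\<forall>\<^sub>F n in sequentially. s n \<le> c" for s c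
    using L(3)[of s] le[of s c] that unfolding V_def by simp
  have lo: "c \<le> L s" if s: "Bseq s" and g: "\<forall>\<^sub>F n in sequentially. c \<le> s n" for s c
  proof -
    have "L (\<lambda>n. -1 * s n) \<le> -c"
    proof (rule up)
      show "Bseq (\<lambda>n. -1 * s n)" using scale[of s "-1"] s by (simp add: V_def)
      show "\<forall>\<^sub>F n in sequentially. -1 * s n \<le> -c" using g by eventually_elim auto
    qed
    then show ?thesis using L(2)[of s "-1"] s unfolding V_def by simp
  qed
  have "L (\<lambda>n. c * s n) = c * L s" if "Bseq s" for c s
    using L(2)[of s c] that unfolding V_def by simp
  moreover have "L (\<lambda>n. s n + t n) = L s + L t" if "Bseq s" "Bseq t" for s t
    using L(1)[of s t] that unfolding V_def by simp
  ultimately have "limit_functional L" unfolding limit_functional_def using up lo by simp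
  then show thesis by (rule that)
qed

section \<open>The complex group algebra\<close>

text \<open>Elements of the group algebra are represented by lists of pairs \<open>(c, x)\<close>, standing for
  \<open>\<Sum> c \<delta>\<^sub>x\<close>. Then concatenation is addition, and products and adjoints are list operations.\<close>

type_synonym 'a gelem = "(complex \<times> 'a) list"

definition pairing :: "('a \<Rightarrow> complex) \<Rightarrow> 'a gelem \<Rightarrow> complex" where
  "pairing u f = (\<Sum>(c, x)\<leftarrow>f. c * u x)"

definition gcoeff :: "'a gelem \<Rightarrow> 'a \<Rightarrow> complex" where
  "gcoeff f x = pairing (\<lambda>y. if y = x then 1 else 0) f"

text \<open>The GNS form, that is the sum of f(x) cnj(g(y)) \<phi>(y^-1 x). As
  \<open>pairing\<close> is linear in the list, the two conjugations make the form antilinear in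
  g.\<close>

definition gform :: "('a, 'm) monoid_scheme \<Rightarrow> ('a \<Rightarrow> complex) \<Rightarrow> 'a gelem \<Rightarrow> 'a gelem \<Rightarrow> complex" where
  "gform G \<phi> f g = pairing (\<lambda>x. cnj (pairing (\<lambda>y. cnj (\<phi> (inv\<^bsub>G\<^esub> y \<otimes>\<^bsub>G\<^esub> x))) g)) f"

definition gmult :: "('a, 'm) monoid_scheme \<Rightarrow> 'a gelem \<Rightarrow> 'a gelem \<Rightarrow> 'a gelem" where
  "gmult G f g = concat (map (\<lambda>(c, x). map (\<lambda>(d, y). (c * d, x \<otimes>\<^bsub>G\<^esub> y)) g) f)"

definition gadj :: "('a, 'm) monoid_scheme \<Rightarrow> 'a gelem \<Rightarrow> 'a gelem" where
  "gadj G f = map (\<lambda>(c, x). (cnj c, inv\<^bsub>G\<^esub> x)) f"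

definition gscale :: "complex \<Rightarrow> 'a gelem \<Rightarrow> 'a gelem" where
  "gscale a f = map (\<lambda>(c, x). (a * c, x)) f"

definition galgebra :: "('a, 'm) monoid_scheme \<Rightarrow> 'a gelem set" where
  "galgebra G = {f. snd ` set f \<subseteq> carrier G}"

lemma pairing_Nil [simp]: "pairing u [] = 0"
  and pairing_Cons [simp]: "pairing u ((c, x) # f) = c * u x + pairing u f"
  and pairing_append [simp]: "pairing u (f @ g) = pairing u f + pairing u g"
  by (simp_all add: pairing_def)

lemma pairing_gscale [simp]: "pairing u (gscale a f) = a * pairing u f"
  by (induction f) (auto simp: gscale_def algebra_simps)

lemma pairing_add: "pairing (\<lambda>x. u x + v x) f = pairing u f + pairing v f"
  by (induction f) (auto simp: algebra_simps)

lemma pairing_diff: "pairing (\<lambda>x. u x - v x) f = pairing u f - pairing v f"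
  by (induction f) (auto simp: algebra_simps)

lemma pairing_cmult: "pairing (\<lambda>x. a * u x) f = a * pairing u f"
  by (induction f) (auto simp: algebra_simps)

lemma pairing_sum: "pairing (\<lambda>x. \<Sum>i\<in>I. u i x) f = (\<Sum>i\<in>I. pairing (u i) f)"
  by (induction f) (auto simp: sum_distrib_left sum.distrib)

lemma pairing_zero [simp]: "pairing (\<lambda>x. 0) f = 0"
  by (induction f) auto

lemma pairing_cong: "(\<And>x. x \<in> snd ` set f \<Longrightarrow> u x = v x) \<Longrightarrow> pairing u f = pairing v f"
  by (induction f) auto

lemma gcoeff_Nil [simp]: "gcoeff [] x = 0"
  and gcoeff_Cons [simp]: "gcoeff ((c, y) # f) x = (if y = x then c else 0) + gcoeff f x"
  and gcoeff_append [simp]: "gcoeff (f @ g) x = gcoeff f x + gcoeff g x"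
  and gcoeff_gscale [simp]: "gcoeff (gscale a f) x = a * gcoeff f x"
  by (simp_all add: gcoeff_def)

lemma gcoeff_outside: "x \<notin> snd ` set f \<Longrightarrow> gcoeff f x = 0"
  by (induction f) auto

lemma pairing_eq_sum_gcoeff:
  assumes "finite S" "snd ` set f \<subseteq> S"
  shows "pairing u f = (\<Sum>x\<in>S. gcoeff f x * u x)"
  using assms(2)
proof (induction f)
  case (Cons p f)
  obtain c y where p: "p = (c, y)" by fastforce
  have y: "y \<in> S" using Cons.prems p by auto
  have "(\<Sum>x\<in>S. (if y = x then c else 0) * u x) = (\<Sum>x\<in>S. if y = x then c * u x else 0)"
    by (intro sum.cong) auto
  also have "\<dots> = c * u y" using y assms(1) by simp
  finally show ?case using Cons p by (simp add: distrib_right sum.distrib)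
qed simp

text \<open>Many lists stand for one element; as only the total coefficient at each point matters,
  lists never have to be reduced or sorted.\<close>

lemma pairing_gcoeff_cong:
  assumes "\<And>x. gcoeff f x = gcoeff g x"
  shows "pairing u f = pairing u g"
  using pairing_eq_sum_gcoeff[of "snd ` set f \<union> snd ` set g"] assms by auto

lemma pairing_map: "pairing u (map (\<lambda>(c, x). (a x * c, h x)) f) = pairing (\<lambda>x. a x * u (h x)) f"
  by (induction f) auto

lemma galgebra_Nil [simp]: "[] \<in> galgebra G"
  and galgebra_Cons [simp]: "(c, x) # f \<in> galgebra G \<longleftrightarrow> x \<in> carrier G \<and> f \<in> galgebra G"
  and galgebra_append [simp]: "f @ g \<in> galgebra G \<longleftrightarrow> f \<in> galgebra G \<and> g \<in> galgebra G"
  and galgebra_gscale [simp]: "gscale a f \<in> galgebra G \<longleftrightarrow> f \<in> galgebra G"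
  by (auto simp: galgebra_def gscale_def image_image case_prod_beta)

lemma gform_Nil_left [simp]: "gform G \<phi> [] g = 0"
  and gform_Nil_right [simp]: "gform G \<phi> f [] = 0"
  and gform_append_left [simp]: "gform G \<phi> (f @ f') g = gform G \<phi> f g + gform G \<phi> f' g"
  and gform_gscale_left [simp]: "gform G \<phi> (gscale a f) g = a * gform G \<phi> f g"
  by (simp_all add: gform_def)

lemma gform_append_right [simp]: "gform G \<phi> f (g @ g') = gform G \<phi> f g + gform G \<phi> f g'"
  by (simp add: gform_def pairing_add)

lemma gform_gscale_right [simp]: "gform G \<phi> f (gscale a g) = cnj a * gform G \<phi> f g"
  by (simp add: gform_def pairing_cmult)

lemma gform_single [simp]: "gform G \<phi> [(c, x)] [(d, y)] = c * cnj d * \<phi> (inv\<^bsub>G\<^esub> y \<otimes>\<^bsub>G\<^esub> x)"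
  by (simp add: gform_def)

lemma gform_gcoeff_cong:
  assumes "\<And>x. gcoeff f x = gcoeff f' x" "\<And>x. gcoeff g x = gcoeff g' x"
  shows "gform G \<phi> f g = gform G \<phi> f' g'"
  unfolding gform_def pairing_gcoeff_cong[of f f', OF assms(1)] pairing_gcoeff_cong[of g g', OF assms(2)] ..

lemma gmult_Nil [simp]: "gmult G [] g = []"
  and gmult_append [simp]: "gmult G (f @ f') g = gmult G f g @ gmult G f' g"
  and gmult_Cons: "gmult G ((c, x) # f) g = map (\<lambda>(d, y). (c * d, x \<otimes>\<^bsub>G\<^esub> y)) g @ gmult G f g"
  by (simp_all add: gmult_def)

lemma gmult_Nil_right [simp]: "gmult G f [] = []"
  by (induction f) (auto simp: gmult_def)

lemma gmult_gscale_left [simp]: "gmult G (gscale a f) g = gscale a (gmult G f g)"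
  by (induction f) (auto simp: gmult_def gscale_def algebra_simps)

lemma gmult_gscale_right [simp]: "gmult G f (gscale a g) = gscale a (gmult G f g)"
  by (induction f) (auto simp: gmult_def gscale_def algebra_simps)

lemma gadj_Nil [simp]: "gadj G [] = []"
  and gadj_Cons: "gadj G ((c, x) # f) = (cnj c, inv\<^bsub>G\<^esub> x) # gadj G f"
  and gadj_append [simp]: "gadj G (f @ g) = gadj G f @ gadj G g"
  by (simp_all add: gadj_def)

context group begin

lemma galgebra_gmult [simp]: "f \<in> galgebra G \<Longrightarrow> g \<in> galgebra G \<Longrightarrow> gmult G f g \<in> galgebra G"
  by (fastforce simp: galgebra_def gmult_def)

lemma galgebra_gadj [simp]: "f \<in> galgebra G \<Longrightarrow> gadj G f \<in> galgebra G"
  by (fastforce simp: galgebra_def gadj_def)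

lemma gadj_gadj [simp]: "f \<in> galgebra G \<Longrightarrow> gadj G (gadj G f) = f"
  by (induction f) (auto simp: gadj_def)

lemma gmult_one [simp]: "f \<in> galgebra G \<Longrightarrow> gmult G f [(1, \<one>)] = f"
  by (induction f) (auto simp: gmult_def)

lemma gmult_assoc:
  assumes "f \<in> galgebra G" "g \<in> galgebra G" "h \<in> galgebra G"
  shows "gmult G (gmult G f g) h = gmult G f (gmult G g h)"
  using assms(1)
proof (induction f)
  case (Cons p f)
  obtain c x where p: "p = (c, x)" by fastforce
  have x: "x \<in> carrier G" using Cons.prems p by simp
  have "gmult G (map (\<lambda>(d, y). (c * d, x \<otimes> y)) g) h = map (\<lambda>(d, y). (c * d, x \<otimes> y)) (gmult G g h)"
    using assms(2)
  proof (induction g)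
    case (Cons q g)
    obtain d y where q: "q = (d, y)" by fastforce
    have y: "y \<in> carrier G" using Cons.prems q by simp
    have "map (\<lambda>(e, z). (c * d * e, x \<otimes> y \<otimes> z)) h
        = map (\<lambda>(d, y). (c * d, x \<otimes> y)) (map (\<lambda>(e, z). (d * e, y \<otimes> z)) h)"
      using assms(3) x y by (induction h) (auto simp: m_assoc)
    then show ?case using Cons q by (simp add: gmult_Cons)
  qed simp
  then show ?case using Cons p by (simp add: gmult_Cons)
qed simp

lemma gform_adjoint_single:
  assumes "x \<in> carrier G" "f \<in> galgebra G" "g \<in> galgebra G"
  shows "gform G \<phi> (map (\<lambda>(d, y). (c * d, x \<otimes> y)) f) g
    = gform G \<phi> f (map (\<lambda>(d, y). (cnj c * d, inv x \<otimes> y)) g)"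
  using assms(2)
proof (induction f)
  case (Cons p f)
  obtain d y where p: "p = (d, y)" by fastforce
  have y: "y \<in> carrier G" using Cons.prems p by simp
  have "gform G \<phi> [(c * d, x \<otimes> y)] g = gform G \<phi> [(d, y)] (map (\<lambda>(d, y). (cnj c * d, inv x \<otimes> y)) g)"
    using assms(3)
  proof (induction g)
    case (Cons q g)
    obtain e z where q: "q = (e, z)" by fastforce
    have z: "z \<in> carrier G" using Cons.prems q by simp
    have "inv (inv x \<otimes> z) \<otimes> y = inv z \<otimes> (x \<otimes> y)"
      using assms(1) y z by (simp add: inv_mult_group m_assoc)
    then show ?case using Cons q
      by (simp add: gform_def algebra_simps)
  qed simp
  then show ?case using Cons p
    by (simp add: gform_def)
qed simp

text \<open>The form sees x and y only through y^-1 x, so left translations preserve it; by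
  linearity \<open>gadj\<close> is the adjoint of left multiplication.\<close>

lemma gform_adjoint:
  assumes "h \<in> galgebra G" "f \<in> galgebra G" "g \<in> galgebra G"
  shows "gform G \<phi> (gmult G h f) g = gform G \<phi> f (gmult G (gadj G h) g)"
  using assms(1)
proof (induction h)
  case (Cons p h)
  obtain c x where p: "p = (c, x)" by fastforce
  show ?case using Cons p gform_adjoint_single[OF _ assms(2,3), of x \<phi> c]
    by (simp add: gmult_Cons gadj_Cons)
qed simp

lemma gform_eq_hermitian_form:
  assumes "finite S" "snd ` set f \<subseteq> S"
  shows "gform G \<phi> f f = hermitian_form G \<phi> S (gcoeff f)"
  unfolding gform_def hermitian_form_def pairing_eq_sum_gcoeff[OF assms]
  by (simp add: sum_distrib_left mult.assoc)

lemma positive_definite_gform: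
  assumes "positive_definite G \<phi>" "f \<in> galgebra G"
  shows "gform G \<phi> f f \<in> \<real>\<^sub>\<ge>\<^sub>0"
proof -
  have "gform G \<phi> f f = hermitian_form G \<phi> (snd ` set f) (gcoeff f)"
    by (rule gform_eq_hermitian_form) auto
  then show ?thesis using assms unfolding positive_definite_def galgebra_def by auto
qed

text \<open>The way back from a function on a finite set to a list; the enumeration is arbitrary
  because nothing depends on the order.\<close>

definition gsum :: "('a \<Rightarrow> complex) \<Rightarrow> 'a set \<Rightarrow> 'a gelem" where
  "gsum c S = map (\<lambda>x. (c x, x)) (SOME xs. set xs = S \<and> distinct xs)"

lemma gsum:
  assumes "finite S"
  shows "snd ` set (gsum c S) = S" "gcoeff (gsum c S) = (\<lambda>x. if x \<in> S then c x else 0)"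
    "pairing u (gsum c S) = (\<Sum>x\<in>S. c x * u x)"
proof -
  define xs where "xs = (SOME xs. set xs = S \<and> distinct xs)"
  have xs: "set xs = S" "distinct xs"
    using someI_ex[OF finite_distinct_list[OF assms]] unfolding xs_def by auto
  have p: "pairing u (map (\<lambda>x. (c x, x)) xs) = (\<Sum>x\<leftarrow>xs. c x * u x)" for u
    by (simp add: pairing_def o_def)
  show p': "pairing u (gsum c S) = (\<Sum>x\<in>S. c x * u x)" for u
    using p xs unfolding gsum_def xs_def[symmetric] by (simp add: sum_list_distinct_conv_sum_set)
  show "snd ` set (gsum c S) = S" using xs unfolding gsum_def xs_def[symmetric] by force
  show "gcoeff (gsum c S) = (\<lambda>x. if x \<in> S then c x else 0)"
    unfolding gcoeff_def p' using assms by (auto simp: if_distrib[of "\<lambda>z. _ * z"] cong: if_cong)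
qed

lemma positive_definiteI:
  assumes "\<phi> \<in> group_functions G" "\<And>f. f \<in> galgebra G \<Longrightarrow> gform G \<phi> f f \<in> \<real>\<^sub>\<ge>\<^sub>0"
  shows "positive_definite G \<phi>"
  unfolding positive_definite_def
proof (intro conjI allI impI)
  fix S c assume S: "finite S \<and> S \<subseteq> carrier G"
  have "gform G \<phi> (gsum c S) (gsum c S) = hermitian_form G \<phi> S (gcoeff (gsum c S))"
    using S by (intro gform_eq_hermitian_form) (auto simp: gsum)
  also have "\<dots> = hermitian_form G \<phi> S c"
    unfolding hermitian_form_def using S by (intro sum.cong) (auto simp: gsum)
  finally show "hermitian_form G \<phi> S c \<in> \<real>\<^sub>\<ge>\<^sub>0"
    using assms(2)[of "gsum c S"] S by (simp add: galgebra_def gsum)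
qed (rule assms(1))

end

section \<open>Positive definite functions and contractions\<close>

definition gdelta :: "('a, 'm) monoid_scheme \<Rightarrow> 'a \<Rightarrow> complex" where
  "gdelta G x = (if x = \<one>\<^bsub>G\<^esub> then 1 else 0)"

definition gnorm2 :: "('a, 'm) monoid_scheme \<Rightarrow> ('a \<Rightarrow> complex) \<Rightarrow> 'a gelem \<Rightarrow> real" where
  "gnorm2 G \<phi> f = Re (gform G \<phi> f f)"

text \<open>\<open>opbound G r f\<close> says that \<open>f\<close> has norm at most \<open>r\<close> in the full group C*-algebra.\<close>

definition opbound :: "('a, 'm) monoid_scheme \<Rightarrow> real \<Rightarrow> 'a gelem \<Rightarrow> bool" where
  "opbound G r f \<longleftrightarrow> f \<in> galgebra G \<and> 0 \<le> r \<and>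
     (\<forall>\<phi> h. positive_definite G \<phi> \<longrightarrow> h \<in> galgebra G \<longrightarrow>
        gnorm2 G \<phi> (gmult G f h) \<le> r\<^sup>2 * gnorm2 G \<phi> h)"

abbreviation contraction :: "('a, 'm) monoid_scheme \<Rightarrow> 'a gelem \<Rightarrow> bool" where
  "contraction G \<equiv> opbound G 1"

text \<open>The diagonal coefficient of the GNS representation of \<phi> at the vector h, cut off to
  the carrier so that it is a group function.\<close>

definition vector_state :: "('a, 'm) monoid_scheme \<Rightarrow> ('a \<Rightarrow> complex) \<Rightarrow> 'a gelem \<Rightarrow> 'a \<Rightarrow> complex" where
  "vector_state G \<phi> h x = (if x \<in> carrier G then gform G \<phi> (gmult G [(1, x)] h) h else 0)"

context group begin

context
  fixes \<phi>
  assumes pd: "positive_definite G \<phi>"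
begin

lemma gnorm2_nonneg: "f \<in> galgebra G \<Longrightarrow> 0 \<le> gnorm2 G \<phi> f"
  using positive_definite_gform[OF pd, of f] by (auto simp: gnorm2_def elim!: nonneg_Reals_cases)

lemma gform_self: "f \<in> galgebra G \<Longrightarrow> gform G \<phi> f f = of_real (gnorm2 G \<phi> f)"
  using positive_definite_gform[OF pd, of f] by (auto simp: gnorm2_def elim!: nonneg_Reals_cases)

lemma gform_commute:
  assumes "f \<in> galgebra G" "g \<in> galgebra G"
  shows "gform G \<phi> g f = cnj (gform G \<phi> f g)"
proof -
  \<comment> \<open>Polarisation: positivity makes the values at f, g, f + g and f + \<i> g real; a
    = 1 compares the imaginary parts of the two mixed terms, and a = \<i> their real parts.\<close>
  have r: "Im (gform G \<phi> (f @ gscale a g) (f @ gscale a g)) = 0" for a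
    using gform_self[of "f @ gscale a g"] assms by simp
  have "Im (gform G \<phi> f f) = 0" "Im (gform G \<phi> g g) = 0" using gform_self assms by simp_all
  then show ?thesis using r[of 1] r[of \<i>] by (auto simp: complex_eq_iff)
qed

lemma gnorm2_append:
  assumes "f \<in> galgebra G" "g \<in> galgebra G"
  shows "gnorm2 G \<phi> (f @ g) = gnorm2 G \<phi> f + 2 * Re (gform G \<phi> f g) + gnorm2 G \<phi> g"
  using gform_commute[OF assms] by (simp add: gnorm2_def)

lemma gnorm2_gscale: "f \<in> galgebra G \<Longrightarrow> gnorm2 G \<phi> (gscale a f) = (norm a)\<^sup>2 * gnorm2 G \<phi> f"
proof -
  assume f: "f \<in> galgebra G"
  have "gform G \<phi> (gscale a f) (gscale a f) = (a * cnj a) * gform G \<phi> f f"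
    by (simp add: mult.assoc)
  also have "\<dots> = of_real ((norm a)\<^sup>2 * gnorm2 G \<phi> f)"
    by (simp only: complex_norm_square[symmetric] gform_self[OF f] of_real_mult)
  finally show ?thesis unfolding gnorm2_def[of G \<phi> "gscale a f"] by (simp only: Re_complex_of_real)
qed

lemma gform_Cauchy_Schwarz_square:
  assumes "f \<in> galgebra G" "g \<in> galgebra G"
  shows "(norm (gform G \<phi> f g))\<^sup>2 \<le> gnorm2 G \<phi> f * gnorm2 G \<phi> g"
proof -
  define z where "z = gform G \<phi> f g"
  have *: "0 \<le> gnorm2 G \<phi> f - 2 * t * (norm z)\<^sup>2 + t\<^sup>2 * (norm z)\<^sup>2 * gnorm2 G \<phi> g" for t :: real
  proof -
    have "0 \<le> gnorm2 G \<phi> (f @ gscale (- of_real t * z) g)"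
      using assms by (intro gnorm2_nonneg) simp
    also have "\<dots> = gnorm2 G \<phi> f + 2 * Re (- of_real t * (cnj z * z)) + t\<^sup>2 * (norm z)\<^sup>2 * gnorm2 G \<phi> g"
      using assms by (simp add: gnorm2_append gnorm2_gscale z_def norm_mult power_mult_distrib algebra_simps)
    also have "cnj z * z = of_real ((norm z)\<^sup>2)" by (metis complex_norm_square mult.commute)
    finally show ?thesis by simp
  qed
  have nn: "0 \<le> gnorm2 G \<phi> f" "0 \<le> gnorm2 G \<phi> g" using gnorm2_nonneg assms by auto
  show ?thesis
  proof (cases "gnorm2 G \<phi> g = 0")
    \<comment> \<open>The form may be degenerate. For a null vector g the expression is affine in t,
      and the t below would make it -1.\<close>
    case True
    have "z = 0"
    proof (rule ccontr)
      assume "z \<noteq> 0"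
      then have p: "(norm z)\<^sup>2 > 0" by simp
      have "2 * ((gnorm2 G \<phi> f + 1) / (2 * (norm z)\<^sup>2)) * (norm z)\<^sup>2 = gnorm2 G \<phi> f + 1"
        using p by (simp add: field_simps)
      then show False using *[of "(gnorm2 G \<phi> f + 1) / (2 * (norm z)\<^sup>2)"] True by simp
    qed
    then show ?thesis using nn by (simp add: z_def)
  next
    case False
    define s where "s = gnorm2 G \<phi> g"
    have s: "s > 0" using False nn by (simp add: s_def)
    have "0 \<le> s * (gnorm2 G \<phi> f - 2 * (1/s) * (norm z)\<^sup>2 + (1/s)\<^sup>2 * (norm z)\<^sup>2 * s)"
      using *[of "1/s"] s by (simp add: s_def)
    also have "\<dots> = gnorm2 G \<phi> f * s - (norm z)\<^sup>2" using s by (simp add: field_simps power2_eq_square)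
    finally show ?thesis by (simp add: z_def s_def)
  qed
qed

lemma gform_Cauchy_Schwarz:
  assumes "f \<in> galgebra G" "g \<in> galgebra G"
  shows "norm (gform G \<phi> f g) \<le> sqrt (gnorm2 G \<phi> f) * sqrt (gnorm2 G \<phi> g)"
  using real_sqrt_le_mono[OF gform_Cauchy_Schwarz_square[OF assms]] by (simp add: real_sqrt_mult)

lemma gnorm2_triangle:
  assumes "f \<in> galgebra G" "g \<in> galgebra G"
  shows "sqrt (gnorm2 G \<phi> (f @ g)) \<le> sqrt (gnorm2 G \<phi> f) + sqrt (gnorm2 G \<phi> g)"
proof (rule real_le_lsqrt)
  have "Re (gform G \<phi> f g) \<le> sqrt (gnorm2 G \<phi> f) * sqrt (gnorm2 G \<phi> g)"
    using gform_Cauchy_Schwarz[OF assms] complex_Re_le_cmod order_trans by blast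
  then show "gnorm2 G \<phi> (f @ g) \<le> (sqrt (gnorm2 G \<phi> f) + sqrt (gnorm2 G \<phi> g))\<^sup>2"
    using gnorm2_nonneg assms by (simp add: gnorm2_append power2_sum)
qed (use gnorm2_nonneg assms in auto)

lemma gnorm2_gmult_single:
  assumes "x \<in> carrier G" "f \<in> galgebra G"
  shows "gnorm2 G \<phi> (gmult G [(c, x)] f) = (norm c)\<^sup>2 * gnorm2 G \<phi> f"
proof -
  have "gmult G [(1, x)] (gmult G [(c, inv x)] f) = gscale c f" for c
    using assms by (induction f) (auto simp: gmult_Cons gscale_def m_assoc[symmetric])
  then have "gmult G [(cnj c, inv x)] (gmult G [(c, x)] f) = gscale (cnj c * c) f"
    using assms by (induction f) (auto simp: gmult_Cons gscale_def m_assoc[symmetric])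
  then have "gform G \<phi> (gmult G [(c, x)] f) (gmult G [(c, x)] f) = gform G \<phi> f (gscale (cnj c * c) f)"
    using assms by (simp add: gform_adjoint gadj_Cons)
  also have "\<dots> = of_real ((norm c)\<^sup>2) * gform G \<phi> f f"
    by (simp add: complex_norm_square[symmetric] mult.commute del: of_real_power)
  finally show ?thesis by (simp add: gnorm2_def)
qed

text \<open>A vector state absorbs the right factor h. Hence a bound at all pairs (\<phi>, h)
  follows from a bound at the vector 1 for all states, as in
  \<open>contraction_iff_state\<close>.\<close>

lemma gform_vector_state:
  assumes f: "f \<in> galgebra G" and g: "g \<in> galgebra G" and h: "h \<in> galgebra G"
  shows "gform G (vector_state G \<phi> h) f g = gform G \<phi> (gmult G f h) (gmult G g h)"
  using f
proof (induction f)
  case (Cons p f)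
  obtain c x where p: "p = (c, x)" by fastforce
  have x: "x \<in> carrier G" using Cons.prems p by simp
  have "gform G (vector_state G \<phi> h) [(c, x)] g = gform G \<phi> (gmult G [(c, x)] h) (gmult G g h)"
    using g
  proof (induction g)
    case (Cons q g)
    obtain d y where q: "q = (d, y)" by fastforce
    have y: "y \<in> carrier G" using Cons.prems q by simp
    have "gmult G [(cnj d, inv y)] (gmult G [(c, x)] h) = gmult G (gmult G [(cnj d, inv y)] [(c, x)]) h"
      using x y h by (simp add: gmult_assoc)
    also have "\<dots> = gscale (c * cnj d) (gmult G [(1, inv y \<otimes> x)] h)"
      by (simp add: gmult_def gscale_def case_prod_beta mult_ac)
    finally have e: "gmult G [(cnj d, inv y)] (gmult G [(c, x)] h) = \<dots>" .
    have "gform G \<phi> (gmult G [(c, x)] h) (gmult G [(d, y)] h)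
        = gform G \<phi> (gmult G [(c, x)] h) (gmult G (gadj G [(cnj d, inv y)]) h)"
      using y by (simp add: gadj_Cons)
    also have "\<dots> = gform G \<phi> (gmult G [(cnj d, inv y)] (gmult G [(c, x)] h)) h"
      by (rule gform_adjoint[symmetric]) (use x y h in auto)
    also have "\<dots> = gform G (vector_state G \<phi> h) [(c, x)] [(d, y)]"
      unfolding e using x y by (simp add: vector_state_def)
    finally have s: "gform G \<phi> (gmult G [(c, x)] h) (gmult G [(d, y)] h)
      = gform G (vector_state G \<phi> h) [(c, x)] [(d, y)]" .
    have "gform G (vector_state G \<phi> h) [(c, x)] (q # g)
        = gform G (vector_state G \<phi> h) [(c, x)] ([(d, y)] @ g)" using q by simp
    also have "\<dots> = gform G \<phi> (gmult G [(c, x)] h) (gmult G [(d, y)] h)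
        + gform G \<phi> (gmult G [(c, x)] h) (gmult G g h)"
      unfolding gform_append_right s using Cons q by simp
    also have "\<dots> = gform G \<phi> (gmult G [(c, x)] h) (gmult G ([(d, y)] @ g) h)"
      unfolding gmult_append gform_append_right ..
    finally show ?case using q by simp
  qed simp
  moreover have "gform G (vector_state G \<phi> h) ([(c, x)] @ f) g
      = gform G (vector_state G \<phi> h) [(c, x)] g + gform G (vector_state G \<phi> h) f g"
    by (rule gform_append_left)
  moreover have "gmult G ([(c, x)] @ f) h = gmult G [(c, x)] h @ gmult G f h"
    by (rule gmult_append)
  ultimately show ?case using Cons p by (simp del: gmult_append)
qed simp

lemma positive_definite_vector_state:
  "h \<in> galgebra G \<Longrightarrow> positive_definite G (vector_state G \<phi> h)"
  by (intro positive_definiteI)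
    (auto simp: group_functions_def vector_state_def gform_vector_state
      intro!: positive_definite_gform[OF pd])

end

lemma gmult_single_one: "f \<in> galgebra G \<Longrightarrow> gmult G [(1, \<one>)] f = f"
  by (induction f) (auto simp: gmult_Cons)

lemma vector_state_one: "h \<in> galgebra G \<Longrightarrow> vector_state G \<phi> h \<one> = gform G \<phi> h h"
  by (simp add: vector_state_def gmult_single_one)

lemma opbound_galgebra: "opbound G r f \<Longrightarrow> f \<in> galgebra G"
  by (simp add: opbound_def)

lemma opbound_gnorm2:
  "opbound G r f \<Longrightarrow> positive_definite G \<phi> \<Longrightarrow> h \<in> galgebra G
    \<Longrightarrow> gnorm2 G \<phi> (gmult G f h) \<le> r\<^sup>2 * gnorm2 G \<phi> h"
  by (simp add: opbound_def)

lemma opbound_sqrt: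
  assumes "opbound G r f" "positive_definite G \<phi>" "h \<in> galgebra G"
  shows "sqrt (gnorm2 G \<phi> (gmult G f h)) \<le> r * sqrt (gnorm2 G \<phi> h)"
  using real_sqrt_le_mono[OF opbound_gnorm2[OF assms]] assms(1)
  by (simp add: real_sqrt_mult opbound_def)

lemma opboundI:
  assumes "f \<in> galgebra G" "0 \<le> r"
    "\<And>\<phi> h. positive_definite G \<phi> \<Longrightarrow> h \<in> galgebra G
      \<Longrightarrow> sqrt (gnorm2 G \<phi> (gmult G f h)) \<le> r * sqrt (gnorm2 G \<phi> h)"
  shows "opbound G r f"
  unfolding opbound_def
proof (intro conjI allI impI assms(1,2))
  fix \<phi> h assume h: "positive_definite G \<phi>" "h \<in> galgebra G"
  have nn: "0 \<le> gnorm2 G \<phi> (gmult G f h)" "0 \<le> gnorm2 G \<phi> h"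
    using h assms(1) gnorm2_nonneg by auto
  have "(sqrt (gnorm2 G \<phi> (gmult G f h)))\<^sup>2 \<le> (r * sqrt (gnorm2 G \<phi> h))\<^sup>2"
    using assms(3)[OF h] nn by (intro power_mono) auto
  then show "gnorm2 G \<phi> (gmult G f h) \<le> r\<^sup>2 * gnorm2 G \<phi> h"
    using nn by (simp add: power_mult_distrib)
qed

lemma opbound_append:
  assumes "opbound G r f" "opbound G s g"
  shows "opbound G (r + s) (f @ g)"
proof (rule opboundI)
  show "f @ g \<in> galgebra G" "0 \<le> r + s" using assms by (auto simp: opbound_def)
  fix \<phi> h assume h: "positive_definite G \<phi>" "h \<in> galgebra G"
  show "sqrt (gnorm2 G \<phi> (gmult G (f @ g) h)) \<le> (r + s) * sqrt (gnorm2 G \<phi> h)"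
    using gnorm2_triangle[OF h(1), of "gmult G f h" "gmult G g h"] opbound_sqrt[OF assms(1) h]
      opbound_sqrt[OF assms(2) h] h assms[THEN opbound_galgebra] by (simp add: algebra_simps)
qed

lemma opbound_gscale:
  assumes "opbound G r f"
  shows "opbound G (norm a * r) (gscale a f)"
proof (rule opboundI)
  show "gscale a f \<in> galgebra G" "0 \<le> norm a * r" using assms by (auto simp: opbound_def)
  fix \<phi> h assume h: "positive_definite G \<phi>" "h \<in> galgebra G"
  show "sqrt (gnorm2 G \<phi> (gmult G (gscale a f) h)) \<le> norm a * r * sqrt (gnorm2 G \<phi> h)"
    using mult_left_mono[OF opbound_sqrt[OF assms h] norm_ge_zero[of a]] h opbound_galgebra[OF assms]
    by (simp add: gnorm2_gscale real_sqrt_mult mult.assoc)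
qed

lemma opbound_single: "x \<in> carrier G \<Longrightarrow> opbound G (norm c) [(c, x)]"
  unfolding opbound_def by (simp add: gnorm2_gmult_single)

lemma opbound_mono: "opbound G r f \<Longrightarrow> r \<le> s \<Longrightarrow> opbound G s f"
proof -
  assume r: "opbound G r f" "r \<le> s"
  show "opbound G s f"
  proof (rule opboundI)
    show "f \<in> galgebra G" "0 \<le> s" using r by (auto simp: opbound_def)
    fix \<phi> h assume h: "positive_definite G \<phi>" "h \<in> galgebra G"
    show "sqrt (gnorm2 G \<phi> (gmult G f h)) \<le> s * sqrt (gnorm2 G \<phi> h)"
      using opbound_sqrt[OF r(1) h] mult_right_mono[OF r(2), of "sqrt (gnorm2 G \<phi> h)"]
        gnorm2_nonneg[OF h] by simp
  qed
qed

lemma opbound_Nil: "opbound G 0 []"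
  by (simp add: opbound_def gnorm2_def)

lemma opbound_exists:
  assumes "f \<in> galgebra G"
  obtains r where "opbound G r f"
proof -
  have "\<exists>r. opbound G r f" using assms
  proof (induction f)
    case (Cons p f)
    obtain c x where p: "p = (c, x)" by fastforce
    obtain r where "opbound G r f" using Cons p by auto
    then have "opbound G (norm c + r) ([(c, x)] @ f)"
      by (intro opbound_append opbound_single) (use Cons.prems p in auto)
    then show ?case using p by auto
  qed (use opbound_Nil in auto)
  then show thesis using that by auto
qed

text \<open>Expanding the square norm of h - c c* h gives |h|^2 - 2 |c* h|^2 + |c c* h|^2 >= 0,
  where the last term is at most |c* h|^2.\<close>

lemma contraction_gadj:
  assumes "contraction G c"
  shows "contraction G (gadj G c)"
proof (rule opboundI)
  have c: "c \<in> galgebra G" by (rule opbound_galgebra[OF assms])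
  then show "gadj G c \<in> galgebra G" by simp
  fix \<phi> h assume h: "positive_definite G \<phi>" "h \<in> galgebra G"
  let ?k = "gmult G (gadj G c) h"
  have k: "?k \<in> galgebra G" using c h by simp
  have "0 \<le> gnorm2 G \<phi> (h @ gscale (-1) (gmult G c ?k))"
    using c h k by (intro gnorm2_nonneg) auto
  also have "\<dots> = gnorm2 G \<phi> h - 2 * Re (gform G \<phi> h (gmult G c ?k)) + gnorm2 G \<phi> (gmult G c ?k)"
    using c h k by (simp add: gnorm2_append gnorm2_gscale)
  also have "gform G \<phi> h (gmult G c ?k) = cnj (gform G \<phi> (gmult G c ?k) h)"
    using gform_commute[OF h(1), of "gmult G c ?k" h] c h k by simp
  also have "gform G \<phi> (gmult G c ?k) h = gform G \<phi> ?k ?k" using c h k by (simp add: gform_adjoint)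
  finally have "0 \<le> gnorm2 G \<phi> h - 2 * gnorm2 G \<phi> ?k + gnorm2 G \<phi> (gmult G c ?k)"
    by (simp add: gnorm2_def)
  then show "sqrt (gnorm2 G \<phi> ?k) \<le> 1 * sqrt (gnorm2 G \<phi> h)"
    using opbound_gnorm2[OF assms h(1) k] by simp
qed simp

text \<open>The GNS representation of the point mass at 1 is the regular one, so every operator
  bound also holds in l^2.\<close>

lemma gform_gdelta:
  assumes "finite S" "snd ` set f \<subseteq> S" "S \<subseteq> carrier G"
  shows "gform G (gdelta G) f f = of_real (\<Sum>x\<in>S. (norm (gcoeff f x))\<^sup>2)"
proof -
  have "gform G (gdelta G) f f = (\<Sum>x\<in>S. \<Sum>y\<in>S. if x = y then gcoeff f x * cnj (gcoeff f x) else 0)"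
    unfolding gform_eq_hermitian_form[OF assms(1,2)] hermitian_form_def
  proof (intro sum.cong refl)
    fix x y assume "x \<in> S" "y \<in> S"
    then have c: "x \<in> carrier G" "y \<in> carrier G" using assms by auto
    have "inv y \<otimes> x = \<one> \<longleftrightarrow> x = y"
      using c by (metis inv_equality inv_inv inv_closed l_inv)
    then show "gcoeff f x * cnj (gcoeff f y) * gdelta G (inv y \<otimes> x)
        = (if x = y then gcoeff f x * cnj (gcoeff f x) else 0)"
      by (auto simp: gdelta_def)
  qed
  also have "\<dots> = (\<Sum>x\<in>S. gcoeff f x * cnj (gcoeff f x))" using assms(1) by simp
  finally show ?thesis by (simp add: complex_norm_square del: of_real_power)
qed

lemma positive_definite_gdelta: "positive_definite G (gdelta G)"
proof (rule positive_definiteI)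
  show "gdelta G \<in> group_functions G" by (auto simp: group_functions_def gdelta_def)
  fix f assume f: "f \<in> galgebra G"
  have "gform G (gdelta G) f f = of_real (\<Sum>x\<in>snd ` set f. (norm (gcoeff f x))\<^sup>2)"
    by (rule gform_gdelta) (use f in \<open>auto simp: galgebra_def\<close>)
  then show "gform G (gdelta G) f f \<in> \<real>\<^sub>\<ge>\<^sub>0"
    by (simp add: sum_nonneg del: of_real_sum of_real_power)
qed

end

section \<open>The Fourier--Stieltjes norm\<close>

context group begin

lemma gform_cscale: "gform G (\<lambda>x. a * \<phi> x) f g = a * gform G \<phi> f g"
  by (simp add: gform_def pairing_cmult)

lemma positive_definite_scale:
  assumes "positive_definite G \<phi>" "0 \<le> r"
  shows "positive_definite G (\<lambda>x. of_real r * \<phi> x)"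
proof (rule positive_definiteI)
  show "(\<lambda>x. of_real r * \<phi> x) \<in> group_functions G"
    using assms by (auto simp: positive_definite_def group_functions_def)
  fix f assume f: "f \<in> galgebra G"
  show "gform G (\<lambda>x. of_real r * \<phi> x) f f \<in> \<real>\<^sub>\<ge>\<^sub>0"
    unfolding gform_cscale gform_self[OF assms(1) f] using assms gnorm2_nonneg[OF assms(1) f]
    by (simp flip: of_real_mult)
qed

lemma positive_definite_one:
  assumes "positive_definite G \<phi>" shows "\<phi> \<one> = of_real (Re (\<phi> \<one>))" "0 \<le> Re (\<phi> \<one>)"
  using gform_self[OF assms, of "[(1, \<one>)]"] gnorm2_nonneg[OF assms, of "[(1, \<one>)]"]
  by (auto simp: gnorm2_def)

lemma gnorm2_one: "gnorm2 G \<phi> [(1, \<one>)] = Re (\<phi> \<one>)"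
  by (simp add: gnorm2_def)

text \<open>Normalised vector states reduce the operator bound to the vector 1, the form in which
  \<open>cstar_norm\<close> is defined.\<close>

lemma contraction_iff_state:
  assumes f: "f \<in> galgebra G"
  shows "contraction G f \<longleftrightarrow> (\<forall>\<phi>. positive_definite G \<phi> \<and> \<phi> \<one> = 1 \<longrightarrow> gnorm2 G \<phi> f \<le> 1)"
proof (intro iffI allI impI)
  fix \<phi> assume "contraction G f" "positive_definite G \<phi> \<and> \<phi> \<one> = 1"
  then show "gnorm2 G \<phi> f \<le> 1"
    using opbound_gnorm2[of 1 f \<phi> "[(1, \<one>)]"] f by (simp add: gnorm2_one)
next
  assume *: "\<forall>\<phi>. positive_definite G \<phi> \<and> \<phi> \<one> = 1 \<longrightarrow> gnorm2 G \<phi> f \<le> 1"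
  show "contraction G f"
    unfolding opbound_def
  proof (intro conjI allI impI f)
    fix \<phi> h assume h: "positive_definite G \<phi>" "h \<in> galgebra G"
    define \<psi> where "\<psi> = vector_state G \<phi> h"
    define s where "s = gnorm2 G \<phi> h"
    have pd: "positive_definite G \<psi>" unfolding \<psi>_def by (rule positive_definite_vector_state[OF h])
    have one: "\<psi> \<one> = of_real s"
      unfolding \<psi>_def s_def vector_state_one[OF h(2)] by (rule gform_self[OF h])
    have s0: "0 \<le> s" unfolding s_def by (rule gnorm2_nonneg[OF h])
    show "gnorm2 G \<phi> (gmult G f h) \<le> 1\<^sup>2 * gnorm2 G \<phi> h"
    proof (cases "s = 0")
      \<comment> \<open>A null vector cannot be normalised, but any finite operator bound shows that
        its image is null as well.\<close>
      case True
      obtain r where "opbound G r f" by (rule opbound_exists[OF f])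
      from opbound_gnorm2[OF this h] True show ?thesis by (simp add: s_def)
    next
      case False
      have "gnorm2 G (\<lambda>x. of_real (1 / s) * \<psi> x) f \<le> 1"
        using * positive_definite_scale[OF pd, of "1 / s"] one False s0 by simp
      moreover have "gnorm2 G (\<lambda>x. of_real (1 / s) * \<psi> x) f = gnorm2 G \<phi> (gmult G f h) / s"
        unfolding gnorm2_def[of G "\<lambda>x. _ x * _ x"] gform_cscale
        unfolding \<psi>_def gform_vector_state[OF h(1) f f h(2)]
          gform_self[OF h(1) galgebra_gmult[OF f h(2)]] by simp
      ultimately show ?thesis using False s0 by (simp add: s_def divide_le_eq)
    qed
  qed simp
qed

lemma cstar_norm_le_one_iff:
  assumes f: "f \<in> galgebra G" and u: "\<And>x. u x = gcoeff f x"
  shows "cstar_norm G u \<le> 1 \<longleftrightarrow> contraction G f"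
proof -
  have u': "u = gcoeff f" using u by blast
  have supp: "{x. u x \<noteq> 0} \<subseteq> snd ` set f" using gcoeff_outside[of _ f] u' by blast
  have h: "hermitian_form G \<phi> {x. u x \<noteq> 0} u = gform G \<phi> f f" for \<phi>
  proof -
    have "gform G \<phi> f f = hermitian_form G \<phi> (snd ` set f) u"
      using gform_eq_hermitian_form[of "snd ` set f" f \<phi>] u' by simp
    also have "\<dots> = hermitian_form G \<phi> {x. u x \<noteq> 0} u"
      unfolding hermitian_form_def
      by (intro sum.mono_neutral_cong_right) (use supp in \<open>auto intro!: sum.mono_neutral_right\<close>)
    finally show ?thesis by simp
  qed
  define S where "S = {sqrt (gnorm2 G \<phi> f) | \<phi>. positive_definite G \<phi> \<and> \<phi> \<one> = 1}"
  have S: "cstar_norm G u = Sup S"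
    unfolding cstar_norm_def h S_def gnorm2_def ..
  obtain r where r: "opbound G r f" by (rule opbound_exists[OF f])
  have bdd: "bdd_above S"
  proof (rule bdd_aboveI)
    fix t assume "t \<in> S"
    then obtain \<phi> where "positive_definite G \<phi>" "\<phi> \<one> = 1" "t = sqrt (gnorm2 G \<phi> f)"
      unfolding S_def by blast
    then show "t \<le> r" using opbound_sqrt[OF r, of \<phi> "[(1, \<one>)]"] f by (simp add: gnorm2_one)
  qed
  have ne: "S \<noteq> {}"
    using positive_definite_gdelta by (auto simp: S_def gdelta_def)
  have "cstar_norm G u \<le> 1 \<longleftrightarrow> (\<forall>t\<in>S. t \<le> 1)"
    unfolding S by (rule cSup_le_iff[OF ne bdd])
  also have "\<dots> \<longleftrightarrow> contraction G f"
    unfolding contraction_iff_state[OF f] S_def by auto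
  finally show ?thesis .
qed

lemma gsum_galgebra: "finite S \<Longrightarrow> S \<subseteq> carrier G \<Longrightarrow> gsum c S \<in> galgebra G"
  by (simp add: galgebra_def gsum)

text \<open>Turns the norm defined through functions and states into a supremum over contractions
  given as lists, the form used in all later estimates.\<close>

lemma fourier_stieltjes_norm_eq:
  "fourier_stieltjes_norm G u = Sup {norm (pairing u f) | f. contraction G f}"
proof -
  have "{norm (\<Sum>x\<in>{x. f x \<noteq> 0}. f x * u x) | f. f \<in> finitely_supported G \<and> cstar_norm G f \<le> 1}
      = {norm (pairing u f) | f. contraction G f}" (is "?L = ?R")
  proof (intro equalityI subsetI)
    fix t assume "t \<in> ?L"
    then obtain f where f: "f \<in> finitely_supported G" "cstar_norm G f \<le> 1"
      "t = norm (\<Sum>x\<in>{x. f x \<noteq> 0}. f x * u x)" by blast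
    have S: "finite {x. f x \<noteq> 0}" "{x. f x \<noteq> 0} \<subseteq> carrier G"
      using f(1) by (auto simp: finitely_supported_def group_functions_def)
    let ?g = "gsum f {x. f x \<noteq> 0}"
    have "contraction G ?g"
      using cstar_norm_le_one_iff[OF gsum_galgebra[OF S], of f f] f(2) S by (auto simp: gsum)
    moreover have "t = norm (pairing u ?g)" using f(3) S by (simp add: gsum)
    ultimately show "t \<in> ?R" by blast
  next
    fix t assume "t \<in> ?R"
    then obtain f where f: "contraction G f" "t = norm (pairing u f)" by blast
    have fa: "f \<in> galgebra G" by (rule opbound_galgebra[OF f(1)])
    have supp: "{x. gcoeff f x \<noteq> 0} \<subseteq> snd ` set f" using gcoeff_outside[of _ f] by blast
    have "gcoeff f \<in> finitely_supported G"
      using supp fa finite_subset[OF supp] gcoeff_outside[of _ f]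
      by (auto simp: finitely_supported_def group_functions_def galgebra_def)
    moreover have "cstar_norm G (gcoeff f) \<le> 1"
      using cstar_norm_le_one_iff[OF fa, of "gcoeff f"] f(1) by simp
    moreover have "pairing u f = (\<Sum>x\<in>{x. gcoeff f x \<noteq> 0}. gcoeff f x * u x)"
      unfolding pairing_eq_sum_gcoeff[of "snd ` set f" f u, OF finite_imageI[OF finite_set] order_refl]
      by (rule sum.mono_neutral_right) (use supp in auto)
    ultimately show "t \<in> ?L" using f(2) by (intro CollectI exI[of _ "gcoeff f"]) simp
  qed
  then show ?thesis unfolding fourier_stieltjes_norm_def by simp
qed

text \<open>Cauchy-Schwarz in the GNS space: the pairing is the inner product of f with the vector
  1.\<close>

lemma norm_pairing_positive_definite:
  assumes "positive_definite G \<phi>" "contraction G f"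
  shows "norm (pairing \<phi> f) \<le> Re (\<phi> \<one>)"
proof -
  have f: "f \<in> galgebra G" by (rule opbound_galgebra[OF assms(2)])
  have "pairing \<phi> f = gform G \<phi> f [(1, \<one>)]"
    using f by (induction f) (auto simp: gform_def)
  also have "norm \<dots> \<le> sqrt (gnorm2 G \<phi> f) * sqrt (gnorm2 G \<phi> [(1, \<one>)])"
    by (rule gform_Cauchy_Schwarz[OF assms(1) f]) simp
  also have "\<dots> \<le> sqrt (gnorm2 G \<phi> [(1, \<one>)]) * sqrt (gnorm2 G \<phi> [(1, \<one>)])"
    using opbound_sqrt[OF assms(2,1), of "[(1, \<one>)]"] f gnorm2_nonneg[OF assms(1), of "[(1, \<one>)]"]
    by (intro mult_right_mono) auto
  also have "\<dots> = Re (\<phi> \<one>)"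
    using positive_definite_one(2)[OF assms(1)] by (simp add: gnorm2_one)
  finally show ?thesis .
qed

text \<open>Makes the norm a supremum of a bounded set; for an unbounded set of reals
  \<open>Sup\<close> carries no information.\<close>

lemma pairing_bounded:
  assumes "u \<in> fourier_stieltjes_algebra G"
  obtains C where "\<And>f. contraction G f \<Longrightarrow> norm (pairing u f) \<le> C"
proof -
  obtain n c \<phi> where u: "\<forall>i<(n::nat). positive_definite G (\<phi> i)" "u = (\<lambda>x. \<Sum>i<n. c i * \<phi> i x)"
    using assms unfolding fourier_stieltjes_algebra_def by blast
  show thesis
  proof (rule that)
    fix f assume f: "contraction G f"
    have "pairing u f = (\<Sum>i<n. c i * pairing (\<phi> i) f)"
      unfolding u(2) pairing_sum pairing_cmult ..
    also have "norm \<dots> \<le> (\<Sum>i<n. norm (c i) * Re (\<phi> i \<one>))"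
      using u(1) norm_pairing_positive_definite[OF _ f]
      by (intro sum_norm_le) (auto simp: norm_mult intro!: mult_left_mono)
    finally show "norm (pairing u f) \<le> (\<Sum>i<n. norm (c i) * Re (\<phi> i \<one>))" .
  qed
qed

lemma contraction_Nil: "contraction G []"
  by (rule opbound_mono[OF opbound_Nil]) simp

lemma fourier_stieltjes_norm_upper:
  assumes "u \<in> fourier_stieltjes_algebra G" "contraction G f"
  shows "norm (pairing u f) \<le> fourier_stieltjes_norm G u"
proof -
  obtain C where C: "\<And>f. contraction G f \<Longrightarrow> norm (pairing u f) \<le> C"
    by (fact pairing_bounded[OF assms(1)])
  show ?thesis unfolding fourier_stieltjes_norm_eq
    by (rule cSup_upper) (use C assms(2) in \<open>auto intro!: bdd_aboveI[of _ C]\<close>)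
qed

lemma fourier_stieltjes_norm_least:
  assumes "\<And>f. contraction G f \<Longrightarrow> norm (pairing u f) \<le> C"
  shows "fourier_stieltjes_norm G u \<le> C"
  unfolding fourier_stieltjes_norm_eq
  by (rule cSup_least) (use contraction_Nil assms in auto)

lemma fourier_stieltjes_norm_nonneg:
  "u \<in> fourier_stieltjes_algebra G \<Longrightarrow> 0 \<le> fourier_stieltjes_norm G u"
  using fourier_stieltjes_norm_upper[OF _ contraction_Nil, of u] by simp

lemma fourier_stieltjes_norm_opbound:
  assumes "u \<in> fourier_stieltjes_algebra G" "opbound G r f"
  shows "norm (pairing u f) \<le> r * fourier_stieltjes_norm G u"
proof (cases "r = 0")
  case False
  then have r: "r > 0" using assms(2) by (simp add: opbound_def)
  have "contraction G (gscale (of_real (1 / r)) f)"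
    using opbound_gscale[OF assms(2), of "of_real (1 / r)"] r by (simp add: norm_divide)
  from fourier_stieltjes_norm_upper[OF assms(1) this] show ?thesis
    using r by (simp add: norm_mult norm_divide field_simps)
next
  \<comment> \<open>Every multiple of f is now a contraction, which forces the pairing to
    vanish.\<close>
  case True
  have c: "contraction G (gscale (of_real n) f)" for n :: real
    by (rule opbound_mono[OF opbound_gscale[OF assms(2)]]) (simp add: True)
  have "pairing u f = 0"
  proof (rule ccontr)
    assume "pairing u f \<noteq> 0"
    then have p: "norm (pairing u f) > 0" by simp
    define n where "n = (fourier_stieltjes_norm G u + 1) / norm (pairing u f)"
    have "n \<ge> 0" using p fourier_stieltjes_norm_nonneg[OF assms(1)] by (simp add: n_def)
    then have "n * norm (pairing u f) \<le> fourier_stieltjes_norm G u"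
      using fourier_stieltjes_norm_upper[OF assms(1) c[of n]] by (simp add: norm_mult)
    then show False using p by (simp add: n_def)
  qed
  then show ?thesis using True by simp
qed

lemma norm_le_fourier_stieltjes_norm:
  assumes "u \<in> fourier_stieltjes_algebra G" "x \<in> carrier G"
  shows "norm (u x) \<le> fourier_stieltjes_norm G u"
  using fourier_stieltjes_norm_upper[OF assms(1), of "[(1, x)]"] opbound_single[OF assms(2), of 1] by simp

lemma fourier_stieltjes_norm_add:
  assumes "u \<in> fourier_stieltjes_algebra G" "v \<in> fourier_stieltjes_algebra G"
  shows "fourier_stieltjes_norm G (\<lambda>x. u x + v x) \<le> fourier_stieltjes_norm G u + fourier_stieltjes_norm G v"
  by (rule fourier_stieltjes_norm_least)
    (auto simp: pairing_add intro!: norm_triangle_le add_mono fourier_stieltjes_norm_upper assms)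

lemma fourier_stieltjes_norm_cmult:
  assumes "u \<in> fourier_stieltjes_algebra G"
  shows "fourier_stieltjes_norm G (\<lambda>x. a * u x) \<le> norm a * fourier_stieltjes_norm G u"
  by (rule fourier_stieltjes_norm_least)
    (auto simp: pairing_cmult norm_mult intro!: mult_left_mono fourier_stieltjes_norm_upper assms)

subsection \<open>The Fourier--Stieltjes algebra as a vector space\<close>

lemma fourier_stieltjes_zero: "(\<lambda>x. 0) \<in> fourier_stieltjes_algebra G"
  unfolding fourier_stieltjes_algebra_def by (auto intro!: exI[of _ "0::nat"])

lemma fourier_stieltjes_add_positive_definite:
  assumes "u \<in> fourier_stieltjes_algebra G" "positive_definite G \<psi>"
  shows "(\<lambda>x. u x + a * \<psi> x) \<in> fourier_stieltjes_algebra G"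
proof -
  obtain n c \<phi> where u: "\<forall>i<(n::nat). positive_definite G (\<phi> i)" "u = (\<lambda>x. \<Sum>i<n. c i * \<phi> i x)"
    using assms unfolding fourier_stieltjes_algebra_def by blast
  have "\<forall>i<Suc n. positive_definite G ((\<phi>(n := \<psi>)) i)"
    using u(1) assms(2) by (simp add: less_Suc_eq)
  moreover have "(\<lambda>x. u x + a * \<psi> x) = (\<lambda>x. \<Sum>i<Suc n. (c(n := a)) i * (\<phi>(n := \<psi>)) i x)"
    unfolding u(2) by auto
  ultimately show ?thesis unfolding fourier_stieltjes_algebra_def by blast
qed

lemma fourier_stieltjes_add:
  assumes "u \<in> fourier_stieltjes_algebra G" "v \<in> fourier_stieltjes_algebra G"
  shows "(\<lambda>x. u x + v x) \<in> fourier_stieltjes_algebra G"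
proof -
  obtain n c \<phi> where v: "\<forall>i<(n::nat). positive_definite G (\<phi> i)" "v = (\<lambda>x. \<Sum>i<n. c i * \<phi> i x)"
    using assms unfolding fourier_stieltjes_algebra_def by blast
  have "(\<lambda>x. u x + (\<Sum>i<m. c i * \<phi> i x)) \<in> fourier_stieltjes_algebra G" if "m \<le> n" for m
    using that
  proof (induction m)
    case (Suc m)
    then have "(\<lambda>x. (u x + (\<Sum>i<m. c i * \<phi> i x)) + c m * \<phi> m x) \<in> fourier_stieltjes_algebra G"
      using v(1) by (intro fourier_stieltjes_add_positive_definite) auto
    then show ?case by (simp add: add.assoc)
  qed (use assms in simp)
  from this[of n] show ?thesis unfolding v(2) by simp
qed

lemma fourier_stieltjes_cmult:
  assumes "u \<in> fourier_stieltjes_algebra G"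
  shows "(\<lambda>x. a * u x) \<in> fourier_stieltjes_algebra G"
proof -
  obtain n c \<phi> where u: "\<forall>i<(n::nat). positive_definite G (\<phi> i)" "u = (\<lambda>x. \<Sum>i<n. c i * \<phi> i x)"
    using assms unfolding fourier_stieltjes_algebra_def by blast
  have "(\<lambda>x. a * u x) = (\<lambda>x. \<Sum>i<n. (a * c i) * \<phi> i x)"
    unfolding u(2) by (simp add: sum_distrib_left mult.assoc)
  then show ?thesis using u(1) unfolding fourier_stieltjes_algebra_def
    by (intro CollectI exI[of _ n] exI[of _ "\<lambda>i. a * c i"] exI[of _ \<phi>]) simp
qed

lemma fourier_stieltjes_diff:
  assumes "u \<in> fourier_stieltjes_algebra G" "v \<in> fourier_stieltjes_algebra G"
  shows "(\<lambda>x. u x - v x) \<in> fourier_stieltjes_algebra G"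
  using fourier_stieltjes_add[OF assms(1) fourier_stieltjes_cmult[OF assms(2), of "-1"]] by simp

lemma fourier_stieltjes_group_function:
  assumes "u \<in> fourier_stieltjes_algebra G" "x \<notin> carrier G" shows "u x = 0"
  using assms unfolding fourier_stieltjes_algebra_def positive_definite_def group_functions_def
  by (auto intro!: sum.neutral)

lemma positive_definite_fourier_stieltjes:
  "positive_definite G \<phi> \<Longrightarrow> \<phi> \<in> fourier_stieltjes_algebra G"
  using fourier_stieltjes_add_positive_definite[OF fourier_stieltjes_zero, of \<phi> 1] by simp

text \<open>Polarisation in the regular representation: for the vectors 1 + a x with a a fourth root
  of unity, weighting the vector states by a / 4 keeps only the mixed term with factor cnj a, which
  is the point mass at x.\<close>

lemma fourier_stieltjes_point:
  assumes x: "x \<in> carrier G"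
  shows "(\<lambda>y. if y = x then 1 else 0) \<in> fourier_stieltjes_algebra G"
proof -
  define h where "h = (\<lambda>a. [(1, \<one>), (a, x)] :: 'a gelem)"
  define w where "w = (\<lambda>a. vector_state G (gdelta G) (h a))"
  have ha: "h a \<in> galgebra G" for a using x by (simp add: h_def)
  have w: "w a \<in> fourier_stieltjes_algebra G" for a
    unfolding w_def by (intro positive_definite_fourier_stieltjes
        positive_definite_vector_state[OF positive_definite_gdelta] ha)
  have "(if y = x then 1 else 0) = (1/4) * (w 1 y + \<i> * w \<i> y + (-1) * w (-1) y + (-\<i>) * w (-\<i>) y)" for y
  proof (cases "y \<in> carrier G")
    case True
    have "inv x \<otimes> y = \<one> \<longleftrightarrow> y = x"
      using x True by (metis inv_equality inv_inv inv_closed l_inv)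
    then have d: "gdelta G (inv x \<otimes> y) = (if y = x then 1 else 0)" by (simp add: gdelta_def)
    have "w a y = gdelta G y + cnj a * gdelta G (inv x \<otimes> y) + a * gdelta G (y \<otimes> x)
        + a * cnj a * gdelta G (inv x \<otimes> (y \<otimes> x))" for a
      using True x by (simp add: w_def h_def vector_state_def gmult_def gform_def algebra_simps)
    then show ?thesis unfolding d by (simp add: algebra_simps)
  qed (use x in \<open>auto simp: w_def vector_state_def\<close>)
  then have "(\<lambda>y. if y = x then 1 else 0)
      = (\<lambda>y. (1/4) * (w 1 y + \<i> * w \<i> y + (-1) * w (-1) y + (-\<i>) * w (-\<i>) y))" by blast
  moreover have "\<dots> \<in> fourier_stieltjes_algebra G"
    by (intro fourier_stieltjes_cmult fourier_stieltjes_add w)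
  ultimately show ?thesis by simp
qed

lemma finitely_supported_fourier_stieltjes:
  assumes "u \<in> finitely_supported G"
  shows "u \<in> fourier_stieltjes_algebra G"
proof -
  define S where "S = {x. u x \<noteq> 0}"
  have S: "finite S" "S \<subseteq> carrier G"
    using assms by (auto simp: S_def finitely_supported_def group_functions_def)
  have "(\<lambda>y. \<Sum>x\<in>T. u x * (if y = x then 1 else 0)) \<in> fourier_stieltjes_algebra G" if "T \<subseteq> S" for T
    using finite_subset[OF that S(1)] that
  proof (induction T rule: finite_induct)
    case (insert x T)
    have "(\<lambda>y. u x * (if y = x then 1 else 0) + (\<Sum>x\<in>T. u x * (if y = x then 1 else 0)))
        \<in> fourier_stieltjes_algebra G"
      using insert S by (intro fourier_stieltjes_add fourier_stieltjes_cmult fourier_stieltjes_point) auto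
    then show ?case using insert by simp
  qed (simp add: fourier_stieltjes_zero)
  moreover have "(\<Sum>x\<in>S. u x * (if y = x then 1 else 0)) = u y" for y
    using S(1) by (auto simp: S_def if_distrib[of "\<lambda>z. _ * z"] cong: if_cong)
  ultimately show ?thesis by (metis (no_types, lifting) ext order_refl)
qed

end

section \<open>Combining two contractions\<close>

text \<open>With \<open>P = c c\<^sup>*\<close> and \<open>Q = c\<^sup>* c\<close> this is \<open>P c + (1 - P) f (1 - Q)\<close>. It is again a contraction,
  it agrees with \<open>f\<close> up to the \<open>\<ell>\<^sup>2\<close>-norm of \<open>c\<close>, and a functional that almost attains its norm
  at \<open>c\<close> almost attains it at the combination.\<close>

definition gcombine :: "('a, 'm) monoid_scheme \<Rightarrow> 'a gelem \<Rightarrow> 'a gelem \<Rightarrow> 'a gelem" where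
  "gcombine G c f =
     (let s = gadj G c in
      gmult G c (gmult G s c) @ f @ gscale (-1) (gmult G c (gmult G s f)) @
      gscale (-1) (gmult G f (gmult G s c)) @ gmult G c (gmult G s (gmult G f (gmult G s c))))"

lemma unit_multiple:
  fixes z :: complex
  obtains a where "norm a = 1" "a * z = of_real (norm z)"
proof (cases "z = 0")
  case False
  show thesis
  proof (rule that)
    show "norm (cnj z / of_real (norm z)) = 1" using False by (simp add: norm_divide)
    show "cnj z / of_real (norm z) * z = of_real (norm z)"
      using False complex_norm_square[of z] by (simp add: field_simps power2_eq_square)
  qed
qed (use that[of 1] in simp)

context group begin

text \<open>Lists that arise from regrouping sums and products are not equal as lists. They are
  compared as vectors of the GNS space instead, by their inner products with all k.\<close>

lemma gnorm2_cong:
  assumes "positive_definite G \<phi>" "f \<in> galgebra G" "g \<in> galgebra G"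
    "\<And>k. k \<in> galgebra G \<Longrightarrow> gform G \<phi> f k = gform G \<phi> g k"
  shows "gnorm2 G \<phi> f = gnorm2 G \<phi> g"
proof -
  have "gform G \<phi> f f = gform G \<phi> g f" using assms by simp
  also have "\<dots> = cnj (gform G \<phi> f g)" by (rule gform_commute) (use assms in auto)
  also have "\<dots> = cnj (gform G \<phi> g g)" using assms by simp
  finally show ?thesis by (simp add: gnorm2_def)
qed

lemma galgebra_gcombine [simp]:
  "c \<in> galgebra G \<Longrightarrow> f \<in> galgebra G \<Longrightarrow> gcombine G c f \<in> galgebra G"
  by (simp add: gcombine_def Let_def)

text \<open>With \<alpha> = c h, q = c* \<alpha> and \<beta> = f (h - q), the combination sends h to
  \<beta> + c c* (\<alpha> - \<beta>). Its square norm is at most |\<beta>|^2 + |q|^2, which is at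
  most |h|^2 - 2 |\<alpha>|^2 + 2 |q|^2; and |q| <= |\<alpha>|.\<close>

lemma contraction_gcombine:
  assumes c: "contraction G c" and f: "contraction G f"
  shows "contraction G (gcombine G c f)"
  unfolding opbound_def
proof (intro conjI allI impI)
  have ca [simp]: "c \<in> galgebra G" and fa [simp]: "f \<in> galgebra G"
    using c f by (auto simp: opbound_def)
  define s where "s = gadj G c"
  have sa [simp]: "s \<in> galgebra G" and ss [simp]: "gadj G s = c" "gadj G c = s"
    by (simp_all add: s_def)
  have s: "contraction G s" unfolding s_def by (rule contraction_gadj[OF c])
  show "gcombine G c f \<in> galgebra G" by simp
  fix \<phi> h assume pd: "positive_definite G \<phi>" and h [simp]: "h \<in> galgebra G"
  define \<alpha> where "\<alpha> = gmult G c h"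
  define q where "q = gmult G s \<alpha>"
  define \<beta> where "\<beta> = gmult G f h @ gscale (-1) (gmult G f q)"
  define \<delta> where "\<delta> = \<alpha> @ gscale (-1) \<beta>"
  have al [simp]: "\<alpha> \<in> galgebra G" "q \<in> galgebra G" "\<beta> \<in> galgebra G" "\<delta> \<in> galgebra G"
    by (simp_all add: \<alpha>_def q_def \<beta>_def \<delta>_def)
  have b: "gnorm2 G \<phi> (gmult G c k) \<le> gnorm2 G \<phi> k" "gnorm2 G \<phi> (gmult G f k) \<le> gnorm2 G \<phi> k"
    if "k \<in> galgebra G" for k
    using opbound_gnorm2[OF c pd that] opbound_gnorm2[OF f pd that] by simp_all
  have "gnorm2 G \<phi> (gmult G (gcombine G c f) h) = gnorm2 G \<phi> (\<beta> @ gmult G c (gmult G s \<delta>))"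
    by (rule gnorm2_cong[OF pd])
      (simp_all add: gcombine_def Let_def \<delta>_def \<beta>_def q_def \<alpha>_def gmult_assoc gform_adjoint)
  also have "\<dots> = gnorm2 G \<phi> \<beta> + 2 * Re (gform G \<phi> (gmult G s \<beta>) (gmult G s \<delta>))
      + gnorm2 G \<phi> (gmult G c (gmult G s \<delta>))"
    by (subst gnorm2_append[OF pd]) (simp_all add: gform_adjoint)
  \<comment> \<open>The contraction c is applied to s \<delta>, and the square is completed; the
    completed vector is s (\<beta> + \<delta>) = s \<alpha> = q.\<close>
  also have "\<dots> \<le> gnorm2 G \<phi> \<beta> + gnorm2 G \<phi> (gmult G s \<beta> @ gmult G s \<delta>) - gnorm2 G \<phi> (gmult G s \<beta>)"
    using b(1)[of "gmult G s \<delta>"] by (simp add: gnorm2_append[OF pd])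
  also have "gnorm2 G \<phi> (gmult G s \<beta> @ gmult G s \<delta>) = gnorm2 G \<phi> q"
    by (rule gnorm2_cong[OF pd]) (simp_all add: \<delta>_def q_def gform_adjoint)
  finally have 1: "gnorm2 G \<phi> (gmult G (gcombine G c f) h) \<le> gnorm2 G \<phi> \<beta> + gnorm2 G \<phi> q"
    using gnorm2_nonneg[OF pd, of "gmult G s \<beta>"] by simp
  have "gnorm2 G \<phi> \<beta> = gnorm2 G \<phi> (gmult G f (h @ gscale (-1) q))"
    by (rule gnorm2_cong[OF pd]) (simp_all add: \<beta>_def gform_adjoint)
  also have "\<dots> \<le> gnorm2 G \<phi> (h @ gscale (-1) q)" by (rule b(2)) simp
  also have "\<dots> = gnorm2 G \<phi> h - 2 * Re (gform G \<phi> h q) + gnorm2 G \<phi> q"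
    by (simp add: gnorm2_append[OF pd] gnorm2_gscale[OF pd])
  also have "gform G \<phi> h q = gform G \<phi> \<alpha> \<alpha>"
    unfolding q_def \<alpha>_def by (subst gform_adjoint) simp_all
  finally have 2: "gnorm2 G \<phi> \<beta> \<le> gnorm2 G \<phi> h - 2 * gnorm2 G \<phi> \<alpha> + gnorm2 G \<phi> q"
    by (simp add: gnorm2_def)
  have "gnorm2 G \<phi> q \<le> gnorm2 G \<phi> \<alpha>" unfolding q_def using opbound_gnorm2[OF s pd, of \<alpha>] by simp
  then show "gnorm2 G \<phi> (gmult G (gcombine G c f) h) \<le> 1\<^sup>2 * gnorm2 G \<phi> h" using 1 2 by simp
qed simp

text \<open>On \<open>[0, 1]\<close> the function \<open>3 t - t\<^sup>3\<close> is bounded by \<open>2\<close>; with \<open>q = t\<^sup>2\<close> this reads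
  \<open>4 - q (3 - q)\<^sup>2 = 3 (1 - q)\<^sup>2 + (1 - q)\<^sup>3\<close>.\<close>

lemma opbound_cubic:
  assumes c: "contraction G c"
  shows "opbound G 2 (gscale 3 c @ gscale (-1) (gmult G c (gmult G (gadj G c) c)))"
  unfolding opbound_def
proof (intro conjI allI impI)
  have ca [simp]: "c \<in> galgebra G" using c by (auto simp: opbound_def)
  define s where "s = gadj G c"
  have sa [simp]: "s \<in> galgebra G" and ss [simp]: "gadj G s = c" "gadj G c = s"
    by (simp_all add: s_def)
  show "gscale 3 c @ gscale (-1) (gmult G c (gmult G (gadj G c) c)) \<in> galgebra G" by simp
  fix \<phi> h assume pd: "positive_definite G \<phi>" and h [simp]: "h \<in> galgebra G"
  define \<alpha> where "\<alpha> = gmult G c h"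
  define q where "q = gmult G s \<alpha>"
  define r where "r = gmult G c q"
  have al [simp]: "\<alpha> \<in> galgebra G" "q \<in> galgebra G" "r \<in> galgebra G"
    by (simp_all add: \<alpha>_def q_def r_def)
  have "gform G \<phi> \<alpha> r = gform G \<phi> q q"
    unfolding q_def r_def by (simp add: gform_adjoint)
  then have ar: "Re (gform G \<phi> \<alpha> r) = gnorm2 G \<phi> q" by (simp add: gnorm2_def)
  have "gform G \<phi> h q = gform G \<phi> \<alpha> \<alpha>"
    unfolding q_def \<alpha>_def by (subst gform_adjoint) simp_all
  then have hq: "Re (gform G \<phi> h q) = gnorm2 G \<phi> \<alpha>" by (simp add: gnorm2_def)
  let ?m0 = "gnorm2 G \<phi> h" and ?m1 = "gnorm2 G \<phi> \<alpha>" and ?m2 = "gnorm2 G \<phi> q" and ?m3 = "gnorm2 G \<phi> r"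
  have e: "gnorm2 G \<phi> (h @ gscale (-1) q) = ?m0 - 2 * ?m1 + ?m2"
    using hq by (simp add: gnorm2_append[OF pd] gnorm2_gscale[OF pd])
  have "gnorm2 G \<phi> (gmult G c (h @ gscale (-1) q)) = gnorm2 G \<phi> (\<alpha> @ gscale (-1) r)"
    by (rule gnorm2_cong[OF pd]) (simp_all add: \<alpha>_def r_def gform_adjoint)
  also have "\<dots> = ?m1 - 2 * ?m2 + ?m3"
    using ar by (simp add: gnorm2_append[OF pd] gnorm2_gscale[OF pd])
  \<comment> \<open>At the vector h this is positivity of (1 - Q)^3 for Q = c* c, and fact
    \<open>0\<close> is that of (1 - Q)^2. The claim is the former plus three times the
    latter.\<close>
  finally have 1: "?m1 - 2 * ?m2 + ?m3 \<le> ?m0 - 2 * ?m1 + ?m2"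
    using opbound_gnorm2[OF c pd, of "h @ gscale (-1) q"] e by simp
  have 0: "0 \<le> ?m0 - 2 * ?m1 + ?m2" unfolding e[symmetric] by (rule gnorm2_nonneg[OF pd]) simp
  have "gnorm2 G \<phi> (gmult G (gscale 3 c @ gscale (-1) (gmult G c (gmult G (gadj G c) c))) h)
      = gnorm2 G \<phi> (gscale 3 \<alpha> @ gscale (-1) r)"
    by (simp add: gmult_assoc \<alpha>_def q_def r_def)
  also have "\<dots> = 9 * ?m1 - 6 * ?m2 + ?m3"
    using ar by (simp add: gnorm2_append[OF pd] gnorm2_gscale[OF pd])
  finally show "gnorm2 G \<phi> (gmult G (gscale 3 c @ gscale (-1) (gmult G c (gmult G (gadj G c) c))) h)
      \<le> 2\<^sup>2 * gnorm2 G \<phi> h" using 0 1 by simp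
qed simp

text \<open>The value C at c c* c satisfies Re C >= 3 (d - e) - 2 (d + e) = d - 5 e by the cubic
  bound. The remaining part R is linear in f; rotating f until R f is nonnegative gives Re C + |R f|
  <= d + e, so |R f| <= 6 e. The loss is 5 e + 6 e.\<close>

lemma pairing_gcombine:
  assumes w: "w \<in> fourier_stieltjes_algebra G" and c: "contraction G c" and f: "contraction G f"
    and N: "fourier_stieltjes_norm G w \<le> d + e" and Re: "d - e \<le> Re (pairing w c)"
  shows "d - 11 * e \<le> Re (pairing w (gcombine G c f))"
proof -
  define s where "s = gadj G c"
  define C where "C = pairing w (gmult G c (gmult G s c))"
  define R where "R = (\<lambda>f. pairing w f - pairing w (gmult G c (gmult G s f))
      - pairing w (gmult G f (gmult G s c)) + pairing w (gmult G c (gmult G s (gmult G f (gmult G s c)))))"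
  have dec: "pairing w (gcombine G c f) = C + R f" for f
    by (simp add: gcombine_def Let_def C_def R_def s_def)
  have "norm (pairing w (gscale 3 c @ gscale (-1) (gmult G c (gmult G (gadj G c) c)))) \<le> 2 * (d + e)"
    by (rule order_trans[OF fourier_stieltjes_norm_opbound[OF w opbound_cubic[OF c]]]) (use N in simp)
  moreover have "pairing w (gscale 3 c @ gscale (-1) (gmult G c (gmult G (gadj G c) c))) = 3 * pairing w c - C"
    by (simp add: C_def s_def)
  ultimately have "norm (3 * pairing w c - C) \<le> 2 * (d + e)" by (simp only:)
  then have "Re (3 * pairing w c - C) \<le> 2 * (d + e)"
    using complex_Re_le_cmod[of "3 * pairing w c - C"] by linarith
  then have C: "d - 5 * e \<le> Re C" using Re by simp
  obtain a where a: "norm a = 1" "a * R f = of_real (norm (R f))" by (rule unit_multiple)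
  have Rs: "R (gscale b f) = b * R f" for b by (simp add: R_def algebra_simps)
  have "contraction G (gscale a f)" using opbound_gscale[OF f, of a] a by simp
  then have "Re (pairing w (gcombine G c (gscale a f))) \<le> d + e"
    using order_trans[OF complex_Re_le_cmod order_trans[OF
          fourier_stieltjes_norm_upper[OF w contraction_gcombine[OF c]] N]] by blast
  then have "Re C + norm (R f) \<le> d + e" using a(2) by (simp add: dec Rs)
  then show ?thesis using C abs_Re_le_cmod[of "R f"] by (simp add: dec)
qed

lemma gcoeff_eq_gform:
  assumes "f \<in> galgebra G" "x \<in> carrier G"
  shows "gcoeff f x = gform G (gdelta G) f [(1, x)]"
  using assms(1)
proof (induction f)
  case (Cons p f)
  obtain c y where p: "p = (c, y)" by fastforce
  have y: "y \<in> carrier G" using Cons.prems p by simp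
  have "inv x \<otimes> y = \<one> \<longleftrightarrow> y = x"
    using assms(2) y by (metis inv_equality inv_inv inv_closed l_inv)
  then have "gdelta G (inv x \<otimes> y) = (if y = x then 1 else 0)" by (simp add: gdelta_def)
  moreover have "gform G (gdelta G) (p # f) [(1, x)] = c * gdelta G (inv x \<otimes> y) + gform G (gdelta G) f [(1, x)]"
    unfolding p by (simp add: gform_def)
  ultimately show ?case using Cons p by simp
qed simp

text \<open>The trace property of the regular representation. In particular c* applied to a point
  mass has the same l^2 norm as c.\<close>

lemma gform_gdelta_gadj:
  assumes f: "f \<in> galgebra G" and g: "g \<in> galgebra G" and x: "x \<in> carrier G"
  shows "gform G (gdelta G) (gmult G (gadj G f) [(1, x)]) (gmult G (gadj G g) [(1, x)])
    = gform G (gdelta G) g f"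
  using f
proof (induction f)
  case (Cons p f)
  obtain c y where p: "p = (c, y)" by fastforce
  have y: "y \<in> carrier G" using Cons.prems p by simp
  have "gform G (gdelta G) [(cnj c, inv y \<otimes> x)] (gmult G (gadj G g) [(1, x)]) = gform G (gdelta G) g [(c, y)]"
    using g
  proof (induction g)
    case (Cons q g)
    obtain d z where q: "q = (d, z)" by fastforce
    have z: "z \<in> carrier G" using Cons.prems q by simp
    have "inv (inv z \<otimes> x) \<otimes> (inv y \<otimes> x) = inv x \<otimes> (z \<otimes> inv y) \<otimes> x"
      using x y z by (simp add: inv_mult_group m_assoc)
    moreover have "inv x \<otimes> (z \<otimes> inv y) \<otimes> x = \<one> \<longleftrightarrow> z = y"
    proof
      assume *: "inv x \<otimes> (z \<otimes> inv y) \<otimes> x = \<one>"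
      have "z = x \<otimes> (inv x \<otimes> (z \<otimes> inv y) \<otimes> x) \<otimes> inv x \<otimes> y"
        using x y z inv_closed[OF x] by (simp add: m_assoc m_assoc[symmetric, of x "inv x"])
      then show "z = y" unfolding * using x y by simp
    qed (use x y in \<open>simp add: m_assoc\<close>)
    moreover have "inv y \<otimes> z = \<one> \<longleftrightarrow> z = y"
      using y z by (metis inv_equality inv_inv inv_closed l_inv)
    ultimately have "gdelta G (inv (inv z \<otimes> x) \<otimes> (inv y \<otimes> x)) = gdelta G (inv y \<otimes> z)"
      by (simp add: gdelta_def)
    then show ?case using Cons q
      by (simp add: gadj_Cons gmult_Cons gform_def algebra_simps)
  qed simp
  moreover have "gform G (gdelta G) ([(cnj c, inv y \<otimes> x)] @ gmult G (gadj G f) [(1, x)]) (gmult G (gadj G g) [(1, x)])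
      = gform G (gdelta G) [(cnj c, inv y \<otimes> x)] (gmult G (gadj G g) [(1, x)])
        + gform G (gdelta G) (gmult G (gadj G f) [(1, x)]) (gmult G (gadj G g) [(1, x)])"
    by (rule gform_append_left)
  moreover have "gform G (gdelta G) g ([(c, y)] @ f) = gform G (gdelta G) g [(c, y)] + gform G (gdelta G) g f"
    by (rule gform_append_right)
  ultimately show ?case using Cons p by (simp add: gadj_Cons gmult_Cons)
qed simp

text \<open>Each of the four terms besides f contains a factor c whose l^2 norm is split off by
  Cauchy-Schwarz, the other factors being contractions. Where c stands last this is direct; for c c*
  f the trace property is used. The constant counts the terms.\<close>

lemma gcoeff_gcombine:
  assumes c: "contraction G c" and f: "contraction G f" and x: "x \<in> carrier G"
  shows "norm (gcoeff (gcombine G c f) x - gcoeff f x) \<le> 4 * sqrt (gnorm2 G (gdelta G) c)"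
proof -
  let ?D = "gdelta G" and ?X = "[(1, x)] :: 'a gelem"
  note pd = positive_definite_gdelta
  have ca [simp]: "c \<in> galgebra G" and fa [simp]: "f \<in> galgebra G" and xa [simp]: "?X \<in> galgebra G"
    using c f x by (auto simp: opbound_def)
  define s where "s = gadj G c"
  define t where "t = gadj G f"
  have sa [simp]: "s \<in> galgebra G" "t \<in> galgebra G" and ss [simp]: "gadj G s = c" "gadj G c = s"
      "gadj G f = t" by (simp_all add: s_def t_def)
  have s: "contraction G s" and t: "contraction G t"
    using contraction_gadj[OF c] contraction_gadj[OF f] by simp_all
  define \<sigma> where "\<sigma> = sqrt (gnorm2 G ?D c)"
  have s0: "0 \<le> \<sigma>" unfolding \<sigma>_def using gnorm2_nonneg[OF pd] by simp
  have X1: "gnorm2 G ?D ?X = 1" using x by (simp add: gnorm2_def gdelta_def)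
  have le1: "sqrt (gnorm2 G ?D (gmult G k v)) \<le> 1"
    if "contraction G k" "v \<in> galgebra G" "sqrt (gnorm2 G ?D v) \<le> 1" for k v
    using opbound_sqrt[OF that(1) pd that(2)] that(3) by simp
  have cs: "norm (gform G ?D c v) \<le> \<sigma>" if "v \<in> galgebra G" "sqrt (gnorm2 G ?D v) \<le> 1" for v
  proof -
    have "norm (gform G ?D c v) \<le> \<sigma> * sqrt (gnorm2 G ?D v)"
      unfolding \<sigma>_def by (rule gform_Cauchy_Schwarz[OF pd]) (use that in auto)
    also have "\<dots> \<le> \<sigma> * 1" by (intro mult_left_mono that s0)
    finally show ?thesis by simp
  qed
  have T1: "norm (gcoeff (gmult G c (gmult G s c)) x) \<le> \<sigma>"
    by (simp add: gcoeff_eq_gform x gform_adjoint) (intro cs le1 c s; simp add: X1 x)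
  have T3: "norm (gcoeff (gmult G f (gmult G s c)) x) \<le> \<sigma>"
    by (simp add: gcoeff_eq_gform x gform_adjoint) (intro cs le1 c s t; simp add: X1 x)
  have T4: "norm (gcoeff (gmult G c (gmult G s (gmult G f (gmult G s c)))) x) \<le> \<sigma>"
    by (simp add: gcoeff_eq_gform x gform_adjoint) (intro cs le1 c s t; simp add: X1 x)
  have "gcoeff (gmult G c (gmult G s f)) x = gform G ?D (gmult G s f) (gmult G s ?X)"
    by (simp add: gcoeff_eq_gform x gform_adjoint)
  also have "norm \<dots> \<le> sqrt (gnorm2 G ?D (gmult G s f)) * sqrt (gnorm2 G ?D (gmult G s ?X))"
    by (rule gform_Cauchy_Schwarz[OF pd]) (simp_all add: x)
  also have "gnorm2 G ?D (gmult G s ?X) = gnorm2 G ?D c"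
    using gform_gdelta_gadj[OF ca ca x] by (simp add: gnorm2_def)
  also have "sqrt (gnorm2 G ?D (gmult G s f)) * sqrt (gnorm2 G ?D c) \<le> 1 * sqrt (gnorm2 G ?D c)"
  proof (intro mult_right_mono le1 s fa)
    have "sqrt (gnorm2 G ?D (gmult G f [(1, \<one>)])) \<le> 1"
      by (rule le1[OF f]) (simp_all add: gnorm2_def gdelta_def)
    then show "sqrt (gnorm2 G ?D f) \<le> 1" by simp
  qed (use gnorm2_nonneg[OF pd] in simp)
  finally have T2: "norm (gcoeff (gmult G c (gmult G s f)) x) \<le> \<sigma>" by (simp add: \<sigma>_def)
  have "gcoeff (gcombine G c f) x - gcoeff f x = gcoeff (gmult G c (gmult G s c)) x
      - gcoeff (gmult G c (gmult G s f)) x - gcoeff (gmult G f (gmult G s c)) x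
      + gcoeff (gmult G c (gmult G s (gmult G f (gmult G s c)))) x"
    by (simp add: gcombine_def Let_def)
  also have "norm \<dots> \<le> \<sigma> + \<sigma> + \<sigma> + \<sigma>"
    by (intro norm_triangle_le norm_triangle_le_diff add_mono T1 T2 T3 T4)
  finally show ?thesis by (simp add: \<sigma>_def)
qed

end

section \<open>Distance from the finitely supported functions\<close>

context group begin

abbreviation l2norm :: "'a gelem \<Rightarrow> real" where "l2norm f \<equiv> sqrt (gnorm2 G (gdelta G) f)"

lemma l2norm_sum:
  assumes "finite S" "snd ` set f \<subseteq> S" "S \<subseteq> carrier G"
  shows "l2norm f = L2_set (\<lambda>x. norm (gcoeff f x)) S"
  unfolding gnorm2_def L2_set_def gform_gdelta[OF assms] by simp

lemma l2norm_cong: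
  assumes "\<And>x. gcoeff f x = gcoeff g x" shows "l2norm f = l2norm g"
  unfolding gnorm2_def gform_gcoeff_cong[of f g f g, OF assms assms] ..

lemma l2norm_gscale: "f \<in> galgebra G \<Longrightarrow> l2norm (gscale a f) = norm a * l2norm f"
  by (simp add: gnorm2_gscale[OF positive_definite_gdelta] real_sqrt_mult)

lemma l2norm_nonneg: "f \<in> galgebra G \<Longrightarrow> 0 \<le> l2norm f"
  by (simp add: gnorm2_nonneg[OF positive_definite_gdelta])

lemma contraction_l2norm: "contraction G f \<Longrightarrow> l2norm f \<le> 1"
  using opbound_sqrt[OF _ positive_definite_gdelta, of 1 f "[(1, \<one>)]"]
  by (auto simp: gnorm2_one gdelta_def dest: opbound_galgebra)

lemma finitely_supported_iff:
  "u \<in> finitely_supported G \<longleftrightarrow> finite {x. u x \<noteq> 0} \<and> {x. u x \<noteq> 0} \<subseteq> carrier G"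
  by (auto simp: finitely_supported_def group_functions_def)

lemma finitely_supportedI:
  assumes "finite S" "S \<subseteq> carrier G" "\<And>x. x \<notin> S \<Longrightarrow> u x = 0"
  shows "u \<in> finitely_supported G"
proof -
  have "{x. u x \<noteq> 0} \<subseteq> S" using assms(3) by blast
  then show ?thesis using assms(1,2) finite_subset unfolding finitely_supported_iff by blast
qed

lemma finitely_supported_add:
  assumes "u \<in> finitely_supported G" "v \<in> finitely_supported G"
  shows "(\<lambda>x. u x + v x) \<in> finitely_supported G"
  by (rule finitely_supportedI[of "{x. u x \<noteq> 0} \<union> {x. v x \<noteq> 0}"])
    (use assms in \<open>auto simp: finitely_supported_iff\<close>)

lemma finitely_supported_mult:
  assumes "u \<in> finitely_supported G"
  shows "(\<lambda>x. v x * u x) \<in> finitely_supported G"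
  by (rule finitely_supportedI[of "{x. u x \<noteq> 0}"]) (use assms in \<open>auto simp: finitely_supported_iff\<close>)

lemma finitely_supported_diff:
  assumes "u \<in> finitely_supported G" "v \<in> finitely_supported G"
  shows "(\<lambda>x. u x - v x) \<in> finitely_supported G"
  using finitely_supported_add[OF assms(1) finitely_supported_mult[OF assms(2), of "\<lambda>_. -1"]] by simp

lemma finitely_supported_gcoeff: "f \<in> galgebra G \<Longrightarrow> gcoeff f \<in> finitely_supported G"
  by (rule finitely_supportedI[of "snd ` set f"]) (auto simp: gcoeff_outside galgebra_def)

lemma finitely_supported_gsum:
  assumes "u \<in> finitely_supported G"
  shows "gsum u {x. u x \<noteq> 0} \<in> galgebra G" "gcoeff (gsum u {x. u x \<noteq> 0}) = u"
  using assms by (auto simp: finitely_supported_iff gsum gsum_galgebra)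

interpretation fin: function_space "finitely_supported G"
proof
  show "(\<lambda>x. 0) \<in> finitely_supported G" by (rule finitely_supportedI[of "{}"]) auto
next
  fix u v assume "u \<in> finitely_supported G" "v \<in> finitely_supported G"
  then show "(\<lambda>x. u x + v x) \<in> finitely_supported G" by (rule finitely_supported_add)
next
  fix u c assume "u \<in> finitely_supported G"
  from finitely_supported_mult[OF this, of "\<lambda>_. of_real c"]
  show "(\<lambda>x. c *\<^sub>R u x) \<in> finitely_supported G" by (simp add: scaleR_conv_of_real)
qed

text \<open>The sublinear functional is the infimal convolution of a multiple of the \<open>\<ell>\<^sup>2\<close>-norm with
  \<open>d \<parallel>\<cdot>\<parallel> + Re w\<close>, so a linear functional below it is a function in \<open>\<ell>\<^sup>2\<close> close to \<open>w\<close>.\<close>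

lemma square_summable_approximation:
  assumes d: "0 \<le> d" and C: "0 \<le> C"
    and bound: "\<And>r g. opbound G r g \<Longrightarrow> Re (pairing w g) \<le> d * r + C * l2norm g"
  obtains \<rho> where
    "\<And>h. h \<in> galgebra G \<Longrightarrow> Re (pairing \<rho> h) \<le> C * l2norm h"
    "\<And>g. contraction G g \<Longrightarrow> norm (pairing w g - pairing \<rho> g) \<le> d"
proof -
  let ?F = "finitely_supported G"
  define T where "T = (\<lambda>\<phi>. {C * l2norm h + d * r + Re (pairing w g) | h g r.
    h \<in> galgebra G \<and> opbound G r g \<and> (\<forall>x. gcoeff h x + gcoeff g x = \<phi> x)})"
  define p where "p = (\<lambda>\<phi>. Inf (T \<phi>))"
  have TI: "C * l2norm h + d * r + Re (pairing w g) \<in> T \<phi>"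
    if "h \<in> galgebra G" "opbound G r g" "\<And>x. gcoeff h x + gcoeff g x = \<phi> x" for h g r \<phi>
    unfolding T_def using that by blast
  have ne: "T \<phi> \<noteq> {}" if "\<phi> \<in> ?F" for \<phi>
    using TI[of "gsum \<phi> {x. \<phi> x \<noteq> 0}" 0 "[]" \<phi>] finitely_supported_gsum[OF that] opbound_Nil by force
  have bdd: "bdd_below (T \<phi>)" if "\<phi> \<in> ?F" for \<phi>
  proof (rule bdd_belowI)
    fix t assume "t \<in> T \<phi>"
    then obtain h g r where t: "t = C * l2norm h + d * r + Re (pairing w g)" and h: "h \<in> galgebra G"
      and g: "opbound G r g" and eq: "\<And>x. gcoeff h x + gcoeff g x = \<phi> x"
      unfolding T_def by blast
    have ga: "g \<in> galgebra G" by (rule opbound_galgebra[OF g])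
    \<comment> \<open>The hypothesis at -g bounds Re (w g) from below, and g = \<phi> - h bounds the
      l^2 norm of g by those of \<phi> and h.\<close>
    have "opbound G r (gscale (-1) g)" using opbound_gscale[OF g, of "-1"] by simp
    from bound[OF this] have 1: "- Re (pairing w g) \<le> d * r + C * l2norm g"
      using l2norm_gscale[OF ga, of "-1"] by simp
    have "l2norm g = l2norm ((h @ g) @ gscale (-1) h)" by (rule l2norm_cong) simp
    also have "\<dots> \<le> l2norm (h @ g) + l2norm (gscale (-1) h)"
      by (rule gnorm2_triangle[OF positive_definite_gdelta]) (use h ga in auto)
    also have "l2norm (gscale (-1) h) = l2norm h" using l2norm_gscale[OF h, of "-1"] by simp
    also have "l2norm (h @ g) = l2norm (gsum \<phi> {x. \<phi> x \<noteq> 0})"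
      by (rule l2norm_cong) (use eq finitely_supported_gsum[OF that] in auto)
    finally have "C * l2norm g \<le> C * (l2norm (gsum \<phi> {x. \<phi> x \<noteq> 0}) + l2norm h)"
      by (intro mult_left_mono C)
    then show "- (C * l2norm (gsum \<phi> {x. \<phi> x \<noteq> 0})) \<le> t"
      using 1 unfolding t by (simp add: algebra_simps)
  qed
  have le: "p \<phi> \<le> C * l2norm h + d * r + Re (pairing w g)"
    if "\<phi> \<in> ?F" "h \<in> galgebra G" "opbound G r g" "\<And>x. gcoeff h x + gcoeff g x = \<phi> x" for \<phi> h g r
    unfolding p_def by (rule cInf_lower[OF TI bdd]) (use that in auto)
  have ge: "a \<le> p \<phi>" if "\<phi> \<in> ?F" "\<And>t. t \<in> T \<phi> \<Longrightarrow> a \<le> t" for a \<phi>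
    unfolding p_def by (rule cInf_greatest[OF ne]) (use that in auto)
  have sub: "sublinear_on ?F p"
  proof -
    have "p (\<lambda>x. u x + v x) \<le> p u + p v" if u: "u \<in> ?F" and v: "v \<in> ?F" for u v
    proof -
      have *: "p (\<lambda>x. u x + v x) \<le> s + t" if s: "s \<in> T u" and t: "t \<in> T v" for s t
      proof -
        obtain h g r where 1: "s = C * l2norm h + d * r + Re (pairing w g)" "h \<in> galgebra G"
          "opbound G r g" "\<And>x. gcoeff h x + gcoeff g x = u x" using s unfolding T_def by blast
        obtain h' g' r' where 2: "t = C * l2norm h' + d * r' + Re (pairing w g')" "h' \<in> galgebra G"
          "opbound G r' g'" "\<And>x. gcoeff h' x + gcoeff g' x = v x" using t unfolding T_def by blast
        have "p (\<lambda>x. u x + v x) \<le> C * l2norm (h @ h') + d * (r + r') + Re (pairing w (g @ g'))"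
        proof (rule le)
          show "gcoeff (h @ h') x + gcoeff (g @ g') x = u x + v x" for x
            unfolding 1(4)[symmetric] 2(4)[symmetric] by simp
        qed (use 1 2 u v in \<open>auto intro: opbound_append fin.add\<close>)
        moreover have "C * l2norm (h @ h') \<le> C * (l2norm h + l2norm h')"
          by (intro mult_left_mono C gnorm2_triangle positive_definite_gdelta 1 2)
        ultimately show ?thesis unfolding 1(1) 2(1) by (simp add: algebra_simps)
      qed
      have **: "p (\<lambda>x. u x + v x) - t \<le> p u" if "t \<in> T v" for t
      proof (rule ge[OF u])
        fix s assume "s \<in> T u"
        from *[OF this that] show "p (\<lambda>x. u x + v x) - t \<le> s" by simp
      qed
      have "p (\<lambda>x. u x + v x) - p u \<le> p v"
      proof (rule ge[OF v])
        fix t assume "t \<in> T v"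
        from **[OF this] show "p (\<lambda>x. u x + v x) - p u \<le> t" by simp
      qed
      then show ?thesis by simp
    qed
    moreover have "p (\<lambda>x. c *\<^sub>R u x) = c * p u" if "0 < c" "u \<in> ?F" for c u
    proof -
      have half: "p (\<lambda>x. c *\<^sub>R u x) \<le> c * p u" if c: "0 < c" and u: "u \<in> ?F" for c u
      proof -
        have "p (\<lambda>x. c *\<^sub>R u x) / c \<le> p u"
        proof (rule ge[OF u])
          fix t assume "t \<in> T u"
          then obtain h g r where 1: "t = C * l2norm h + d * r + Re (pairing w g)" "h \<in> galgebra G"
            "opbound G r g" "\<And>x. gcoeff h x + gcoeff g x = u x" unfolding T_def by blast
          have "p (\<lambda>x. c *\<^sub>R u x) \<le> C * l2norm (gscale c h) + d * (c * r) + Re (pairing w (gscale c g))"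
          proof (rule le)
            show "gcoeff (gscale (of_real c) h) x + gcoeff (gscale (of_real c) g) x = c *\<^sub>R u x" for x
              using 1(4)[of x] by (simp add: scaleR_conv_of_real flip: distrib_left)
          qed (use 1 u c opbound_gscale[OF 1(3), of "of_real c"] in \<open>auto intro: fin.scale\<close>)
          then have "p (\<lambda>x. c *\<^sub>R u x) \<le> c * t"
            using c 1(2) unfolding 1(1) by (simp add: l2norm_gscale algebra_simps)
          then show "p (\<lambda>x. c *\<^sub>R u x) / c \<le> t" using c by (simp add: field_simps)
        qed
        then show ?thesis using c by (simp add: field_simps)
      qed
      have "p (\<lambda>x. (1/c) *\<^sub>R (c *\<^sub>R u x)) \<le> (1/c) * p (\<lambda>x. c *\<^sub>R u x)"
        by (rule half) (use that in \<open>auto intro: fin.scale\<close>)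
      then have "c * p u \<le> p (\<lambda>x. c *\<^sub>R u x)" using that(1) by (simp add: field_simps)
      then show ?thesis using half[OF that] by simp
    qed
    ultimately show ?thesis unfolding sublinear_on_def by simp
  qed
  obtain L where L: "\<And>u v. u \<in> ?F \<Longrightarrow> v \<in> ?F \<Longrightarrow> L (\<lambda>x. u x + v x) = L u + L v"
    "\<And>c u. u \<in> ?F \<Longrightarrow> L (\<lambda>x. c *\<^sub>R u x) = c * L u" "\<And>u. u \<in> ?F \<Longrightarrow> L u \<le> p u"
    by (fact fin.hahn_banach[OF sub])
  \<comment> \<open>L is only real linear; \<rho> is read off so that Re (c * \<rho> x) is the value
    of L at c times the point mass at x.\<close>
  define \<rho> where "\<rho> = (\<lambda>x. Complex (L (\<lambda>y. if x = y then 1 else 0)) (- L (\<lambda>y. if x = y then \<i> else 0)))"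
  have pt: "(\<lambda>y. if x = y then c else 0) \<in> ?F" if "x \<in> carrier G" for x c
    by (rule finitely_supportedI[of "{x}"]) (use that in auto)
  have L0: "L (\<lambda>x. 0) = 0" using L(2)[OF fin.zero, of 0] by simp
  have L\<rho>: "L (gcoeff f) = Re (pairing \<rho> f)" if "f \<in> galgebra G" for f
    using that
  proof (induction f)
    case Nil
    have "gcoeff ([] :: 'a gelem) = (\<lambda>x. 0)" by auto
    then show ?case using L0 by simp
  next
    case (Cons q f)
    obtain c x where q: "q = (c, x)" by fastforce
    have x: "x \<in> carrier G" and f: "f \<in> galgebra G" using Cons.prems q by auto
    have e: "(\<lambda>y. if x = y then c else 0)
        = (\<lambda>y. Re c *\<^sub>R (if x = y then 1 else 0) + Im c *\<^sub>R (if x = y then \<i> else 0))"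
      by (auto simp: fun_eq_iff complex_eq_iff)
    have "gcoeff (q # f) = (\<lambda>y. (if x = y then c else 0) + gcoeff f y)"
      unfolding q by (auto simp: fun_eq_iff)
    then have "L (gcoeff (q # f)) = L (\<lambda>y. if x = y then c else 0) + L (gcoeff f)"
      using L(1)[OF pt[OF x] finitely_supported_gcoeff[OF f]] by simp
    also have "L (\<lambda>y. if x = y then c else 0) = Re (c * \<rho> x)"
      unfolding e using L(1)[OF fin.scale[OF pt[OF x]] fin.scale[OF pt[OF x]]]
        L(2)[OF pt[OF x]] by (simp add: \<rho>_def)
    finally show ?case using Cons q f by simp
  qed
  show thesis
  proof (rule that)
    fix h assume h: "h \<in> galgebra G"
    have "Re (pairing \<rho> h) \<le> p (gcoeff h)" using L(3)[OF finitely_supported_gcoeff[OF h]] L\<rho>[OF h] by simp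
    also have "\<dots> \<le> C * l2norm h + d * 0 + Re (pairing w [])"
      by (rule le[OF finitely_supported_gcoeff[OF h] h opbound_Nil]) simp
    finally show "Re (pairing \<rho> h) \<le> C * l2norm h" by simp
  next
    fix g assume g: "contraction G g"
    obtain a where a: "norm a = 1" "a * (pairing w g - pairing \<rho> g) = of_real (norm (pairing w g - pairing \<rho> g))"
      by (rule unit_multiple)
    \<comment> \<open>The sign is chosen so that L <= p becomes an upper bound for Re (a (w g -
      \<rho> g)), which is the absolute value.\<close>
    have k: "contraction G (gscale (-a) g)" using opbound_gscale[OF g, of "-a"] a(1) by simp
    have ka: "gscale (-a) g \<in> galgebra G" by (rule opbound_galgebra[OF k])
    have "Re (pairing \<rho> (gscale (-a) g)) \<le> p (gcoeff (gscale (-a) g))"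
      using L(3)[OF finitely_supported_gcoeff[OF ka]] L\<rho>[OF ka] by simp
    also have "\<dots> \<le> C * l2norm [] + d * 1 + Re (pairing w (gscale (-a) g))"
      by (rule le[OF finitely_supported_gcoeff[OF ka] _ k]) simp_all
    finally have "Re (a * (pairing w g - pairing \<rho> g)) \<le> d"
      by (simp add: gnorm2_def algebra_simps)
    then show "norm (pairing w g - pairing \<rho> g) \<le> d" unfolding a(2) by simp
  qed
qed

text \<open>Testing the bound on the conjugate of \<rho> over finite sets shows that \<rho> is
  square summable. A tail of l^2 norm at most e pairs to at most e with a contraction, whose
  coefficients have l^2 norm at most 1.\<close>

lemma square_summable_finite_approximation:
  assumes bound: "\<And>h. h \<in> galgebra G \<Longrightarrow> Re (pairing \<rho> h) \<le> C * l2norm h" and C: "0 \<le> C" and e: "0 < e"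
  obtains v where "v \<in> finitely_supported G"
    "\<And>g. contraction G g \<Longrightarrow> norm (pairing \<rho> g - pairing v g) \<le> e"
proof -
  define s where "s = (\<lambda>F. \<Sum>x\<in>F. (norm (\<rho> x))\<^sup>2)"
  have sC: "s F \<le> C\<^sup>2" if F: "finite F" "F \<subseteq> carrier G" for F
  proof -
    let ?h = "gsum (\<lambda>x. cnj (\<rho> x)) F"
    have "pairing \<rho> ?h = of_real (s F)"
      using F by (simp add: gsum s_def complex_norm_square mult.commute del: of_real_power)
    moreover have "l2norm ?h = sqrt (s F)"
      using F by (simp add: l2norm_sum[of F] gsum L2_set_def s_def)
    ultimately have *: "s F \<le> C * sqrt (s F)"
      using bound[OF gsum_galgebra[OF F, of "\<lambda>x. cnj (\<rho> x)"]] by simp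
    have s0: "0 \<le> s F" unfolding s_def by (intro sum_nonneg) simp
    have "sqrt (s F) \<le> C"
    proof (cases "s F = 0")
      case False
      then have "sqrt (s F) * sqrt (s F) \<le> C * sqrt (s F)" using * s0 by simp
      then show ?thesis by (rule mult_right_le_imp_le) (use False s0 in simp)
    qed (use C in simp)
    from power_mono[OF this, of 2] show ?thesis using s0 by simp
  qed
  define S where "S = s ` {F. finite F \<and> F \<subseteq> carrier G}"
  have ne: "S \<noteq> {}" and bdd: "bdd_above S" unfolding S_def using sC by (auto intro!: bdd_aboveI)
  have "Sup S - e\<^sup>2 < Sup S" using e by simp
  from less_cSupD[OF ne this] obtain F where F: "finite F" "F \<subseteq> carrier G" "Sup S - e\<^sup>2 < s F"
    unfolding S_def by blast
  have tail: "s F' \<le> e\<^sup>2" if F': "finite F'" "F' \<subseteq> carrier G" "F' \<inter> F = {}" for F'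
  proof -
    have "s (F \<union> F') \<le> Sup S" by (rule cSup_upper[OF _ bdd]) (use F F' in \<open>auto simp: S_def\<close>)
    moreover have "s (F \<union> F') = s F + s F'"
      unfolding s_def by (rule sum.union_disjoint) (use F F' in auto)
    ultimately show ?thesis using F(3) by simp
  qed
  define v where "v = (\<lambda>x. if x \<in> F then \<rho> x else 0)"
  show thesis
  proof (rule that)
    show "v \<in> finitely_supported G" by (rule finitely_supportedI[OF F(1,2)]) (simp add: v_def)
    fix g assume g: "contraction G g"
    have ga: "snd ` set g \<subseteq> carrier G" using opbound_galgebra[OF g] by (simp add: galgebra_def)
    define Z where "Z = snd ` set g"
    define Y where "Y = Z - F"
    have Z: "finite Z" "Y \<subseteq> Z" unfolding Z_def Y_def by auto
    have "pairing \<rho> g - pairing v g = (\<Sum>x\<in>Z. gcoeff g x * (\<rho> x - v x))"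
      unfolding pairing_diff[symmetric] by (rule pairing_eq_sum_gcoeff) (auto simp: Z_def)
    also have "\<dots> = (\<Sum>x\<in>Y. gcoeff g x * \<rho> x)"
      by (rule sum.mono_neutral_cong_right) (use Z in \<open>auto simp: Y_def v_def\<close>)
    also have "norm \<dots> \<le> (\<Sum>x\<in>Y. \<bar>norm (gcoeff g x)\<bar> * \<bar>norm (\<rho> x)\<bar>)"
      by (rule sum_norm_le) (simp add: norm_mult)
    also have "\<dots> \<le> L2_set (\<lambda>x. norm (gcoeff g x)) Y * L2_set (\<lambda>x. norm (\<rho> x)) Y"
      by (rule L2_set_mult_ineq)
    also have "\<dots> \<le> 1 * e"
    proof (rule mult_mono)
      have "L2_set (\<lambda>x. norm (gcoeff g x)) Y \<le> L2_set (\<lambda>x. norm (gcoeff g x)) Z"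
        unfolding L2_set_def by (intro real_sqrt_le_mono sum_mono2) (use Z in auto)
      also have "\<dots> = l2norm g" by (rule l2norm_sum[symmetric]) (use Z ga in \<open>auto simp: Z_def\<close>)
      also have "\<dots> \<le> 1" by (rule contraction_l2norm[OF g])
      finally show "L2_set (\<lambda>x. norm (gcoeff g x)) Y \<le> 1" .
      have "s Y \<le> e\<^sup>2" by (rule tail) (use Z ga in \<open>auto simp: Z_def Y_def\<close>)
      then have "sqrt (s Y) \<le> e" using e by (simp add: real_le_lsqrt)
      then show "L2_set (\<lambda>x. norm (\<rho> x)) Y \<le> e" by (simp add: L2_set_def s_def)
    qed simp_all
    finally show "norm (pairing \<rho> g - pairing v g) \<le> e" by simp
  qed
qed

text \<open>If w stayed below d - e on all contractions that are small in l^2, then by homogeneity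
  it would be within d - e of a square summable function, hence within d - e / 2 of a finitely
  supported one.\<close>

lemma small_norming_contraction:
  assumes w: "w \<in> fourier_stieltjes_algebra G"
    and dist: "\<And>v. v \<in> finitely_supported G \<Longrightarrow> d \<le> fourier_stieltjes_norm G (\<lambda>x. w x - v x)"
    and e: "0 < e" and \<eta>: "0 < \<eta>"
  obtains c where "contraction G c" "l2norm c \<le> \<eta>" "d - e \<le> Re (pairing w c)"
proof (rule ccontr)
  assume n: "\<not> thesis"
  note hyp = that
  define d' where "d' = d - e"
  have small: "Re (pairing w c) < d'" if "contraction G c" "l2norm c \<le> \<eta>" for c
  proof (rule ccontr)
    assume "\<not> ?thesis"
    then show False using n that(1)[THEN hyp, OF that(2)] unfolding d'_def by simp
  qed
  have d0: "0 < d'" using small[OF contraction_Nil] \<eta> by (simp add: gnorm2_def)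
  have claim: "Re (pairing w g) \<le> d' * r + (d' / \<eta>) * l2norm g" if g: "opbound G r g" for r g
  proof -
    have ga: "g \<in> galgebra G" and r: "0 \<le> r" using g by (auto simp: opbound_def)
    \<comment> \<open>Division by m makes g a contraction and its l^2 norm at most \<eta>, both at
      once.\<close>
    define m where "m = r + l2norm g / \<eta>"
    have l0: "0 \<le> l2norm g / \<eta>" using l2norm_nonneg[OF ga] \<eta> by simp
    show ?thesis
    proof (cases "m = 0")
      case True
      then have "r = 0" "l2norm g = 0" using l0 r \<eta> by (auto simp: m_def add_nonneg_eq_0_iff)
      then have "pairing w g = 0" using fourier_stieltjes_norm_opbound[OF w g] by simp
      then show ?thesis using \<open>r = 0\<close> \<open>l2norm g = 0\<close> by simp
    next
      case False
      then have m: "m > 0" using l0 r by (simp add: m_def)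
      have "contraction G (gscale (of_real (1 / m)) g)"
      proof (rule opbound_mono[OF opbound_gscale[OF g]])
        have "norm (of_real (1 / m) :: complex) = 1 / m" using m by (simp add: norm_divide)
        moreover have "r / m \<le> 1" using m l0 by (simp add: m_def)
        ultimately show "norm (of_real (1 / m) :: complex) * r \<le> 1" by simp
      qed
      moreover have "l2norm (gscale (of_real (1 / m)) g) \<le> \<eta>"
      proof -
        have "l2norm g \<le> \<eta> * m" using r \<eta> by (simp add: m_def distrib_left)
        then show ?thesis using m unfolding l2norm_gscale[OF ga] by (simp add: norm_divide field_simps)
      qed
      ultimately have "Re (pairing w (gscale (of_real (1 / m)) g)) < d'" by (rule small)
      then have "Re (pairing w g) \<le> d' * m" using m by (simp add: field_simps)
      then show ?thesis by (simp add: m_def algebra_simps)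
    qed
  qed
  obtain \<rho> where \<rho>: "\<And>h. h \<in> galgebra G \<Longrightarrow> Re (pairing \<rho> h) \<le> (d' / \<eta>) * l2norm h"
    "\<And>g. contraction G g \<Longrightarrow> norm (pairing w g - pairing \<rho> g) \<le> d'"
    by (rule square_summable_approximation[of d' "d' / \<eta>" w]) (use d0 \<eta> claim in auto)
  obtain v where v: "v \<in> finitely_supported G"
    "\<And>g. contraction G g \<Longrightarrow> norm (pairing \<rho> g - pairing v g) \<le> e / 2"
    by (rule square_summable_finite_approximation[of \<rho> "d' / \<eta>" "e / 2"]) (use \<rho>(1) d0 \<eta> e in auto)
  have "fourier_stieltjes_norm G (\<lambda>x. w x - v x) \<le> d' + e / 2"
  proof (rule fourier_stieltjes_norm_least)
    fix g assume g: "contraction G g"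
    have "norm ((pairing w g - pairing \<rho> g) + (pairing \<rho> g - pairing v g)) \<le> d' + e / 2"
      by (intro norm_triangle_le add_mono \<rho>(2) v(2) g)
    then show "norm (pairing (\<lambda>x. w x - v x) g) \<le> d' + e / 2" by (simp add: pairing_diff)
  qed
  then show False using dist[OF v(1)] e unfolding d'_def by simp
qed

end

section \<open>Near-best finitely supported approximations\<close>

context group begin

lemma pairing_finitely_supported:
  assumes "finite {x. u x \<noteq> 0}"
  shows "pairing u f = (\<Sum>x\<in>{x. u x \<noteq> 0}. gcoeff f x * u x)"
proof -
  have "pairing u f = (\<Sum>x\<in>snd ` set f \<union> {x. u x \<noteq> 0}. gcoeff f x * u x)"
    by (rule pairing_eq_sum_gcoeff) (use assms in auto)
  also have "\<dots> = (\<Sum>x\<in>{x. u x \<noteq> 0}. gcoeff f x * u x)"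
    by (rule sum.mono_neutral_right) (use assms in auto)
  finally show ?thesis .
qed

lemma pairing_gcombine_close:
  assumes u: "u \<in> finitely_supported G" and c: "contraction G c" and f: "contraction G f"
  shows "norm (pairing u (gcombine G c f) - pairing u f) \<le> 4 * l2norm c * (\<Sum>x\<in>{x. u x \<noteq> 0}. norm (u x))"
proof -
  have fin: "finite {x. u x \<noteq> 0}" "{x. u x \<noteq> 0} \<subseteq> carrier G"
    using u unfolding finitely_supported_iff by auto
  have "pairing u (gcombine G c f) - pairing u f
      = (\<Sum>x\<in>{x. u x \<noteq> 0}. (gcoeff (gcombine G c f) x - gcoeff f x) * u x)"
    unfolding pairing_finitely_supported[OF fin(1)] by (simp add: sum_subtractf left_diff_distrib)
  also have "norm \<dots> \<le> (\<Sum>x\<in>{x. u x \<noteq> 0}. 4 * l2norm c * norm (u x))"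
    unfolding norm_mult[symmetric]
    by (intro sum_norm_le)
      (use fin gcoeff_gcombine[OF c f] in \<open>auto simp: norm_mult intro!: mult_right_mono\<close>)
  finally show ?thesis by (simp add: sum_distrib_left)
qed

text \<open>Let c almost norm w - v1 and be tiny in l^2, and let k be a rotation of the test
  element. On the combination of c and k, w - v1 is at least d - 11 e, v1 - v2 loses at most e
  against its value at k, and w - v2 is at most d + e; 13 is 11 + 1 + 1.\<close>

lemma near_best_approximations_close:
  assumes w: "w \<in> fourier_stieltjes_algebra G"
    and dist: "\<And>v. v \<in> finitely_supported G \<Longrightarrow> d \<le> fourier_stieltjes_norm G (\<lambda>x. w x - v x)"
    and v1: "v1 \<in> finitely_supported G" "fourier_stieltjes_norm G (\<lambda>x. w x - v1 x) \<le> d + e"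
    and v2: "v2 \<in> finitely_supported G" "fourier_stieltjes_norm G (\<lambda>x. w x - v2 x) \<le> d + e"
    and e: "0 < e"
  shows "fourier_stieltjes_norm G (\<lambda>x. v1 x - v2 x) \<le> 13 * e"
proof (rule fourier_stieltjes_norm_least)
  fix f assume f: "contraction G f"
  define W where "W = (\<lambda>x. w x - v1 x)"
  define V where "V = (\<lambda>x. v1 x - v2 x)"
  define M where "M = (\<Sum>x\<in>{x. V x \<noteq> 0}. norm (V x))"
  have M: "0 \<le> M" unfolding M_def by (intro sum_nonneg) simp
  have V: "V \<in> finitely_supported G" unfolding V_def by (rule finitely_supported_diff[OF v1(1) v2(1)])
  have W: "W \<in> fourier_stieltjes_algebra G"
    unfolding W_def by (intro fourier_stieltjes_diff w finitely_supported_fourier_stieltjes v1)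
  have Wd: "d \<le> fourier_stieltjes_norm G (\<lambda>x. W x - v x)" if "v \<in> finitely_supported G" for v
    using dist[OF finitely_supported_add[OF v1(1) that]] by (simp add: W_def diff_diff_eq)
  obtain a where a: "norm a = 1" "a * pairing V f = of_real (norm (pairing V f))" by (rule unit_multiple)
  define k where "k = gscale a f"
  have k: "contraction G k" unfolding k_def using opbound_gscale[OF f, of a] a(1) by simp
  \<comment> \<open>Coefficients move by at most 4 times the l^2 norm of c, and M is the sum of |V|;
    the summand 1 keeps the bound positive when V = 0.\<close>
  have "0 < e / (4 * (M + 1))" using e M by simp
  from small_norming_contraction[OF W Wd e this] obtain c where
    c: "contraction G c" "l2norm c \<le> e / (4 * (M + 1))" "d - e \<le> Re (pairing W c)" by blast
  have 1: "d - 11 * e \<le> Re (pairing W (gcombine G c k))"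
    by (rule pairing_gcombine[OF W c(1) k _ c(3)]) (use v1(2) in \<open>simp add: W_def\<close>)
  have "4 * l2norm c * M \<le> 4 * (e / (4 * (M + 1))) * M"
    by (intro mult_right_mono mult_left_mono c M) simp
  also have "\<dots> \<le> e" using M e by (simp add: field_simps)
  finally have "norm (pairing V (gcombine G c k) - pairing V k) \<le> e"
    using pairing_gcombine_close[OF V c(1) k] unfolding M_def by linarith
  then have "\<bar>Re (pairing V (gcombine G c k) - pairing V k)\<bar> \<le> e"
    using abs_Re_le_cmod order_trans by blast
  then have 2: "Re (pairing V k) - e \<le> Re (pairing V (gcombine G c k))" by simp
  have "pairing (\<lambda>x. w x - v2 x) (gcombine G c k) = pairing W (gcombine G c k) + pairing V (gcombine G c k)"
    unfolding pairing_add[symmetric] by (simp add: W_def V_def)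
  moreover have "Re (pairing (\<lambda>x. w x - v2 x) (gcombine G c k)) \<le> d + e"
    by (rule order_trans[OF complex_Re_le_cmod order_trans[OF fourier_stieltjes_norm_upper v2(2)]])
      (intro fourier_stieltjes_diff w finitely_supported_fourier_stieltjes v2 contraction_gcombine c k)+
  ultimately have "Re (pairing V k) \<le> 13 * e" using 1 2 by simp
  then have "norm (pairing V f) \<le> 13 * e" using a(2) by (simp add: k_def)
  then show "norm (pairing (\<lambda>x. v1 x - v2 x) f) \<le> 13 * e" by (simp add: V_def)
qed

section \<open>A criterion for Riesz sets\<close>

lemma pairing_tendsto:
  assumes "\<And>x. x \<in> carrier G \<Longrightarrow> (\<lambda>n. u n x) \<longlonglongrightarrow> v x" "f \<in> galgebra G"
  shows "(\<lambda>n. pairing (u n) f) \<longlonglongrightarrow> pairing v f"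
  using assms(2)
proof (induction f)
  case (Cons p f)
  obtain c x where p: "p = (c, x)" by fastforce
  show ?case using Cons assms(1)[of x] unfolding p by (auto intro!: tendsto_intros)
qed simp

text \<open>A contraction has l^2 norm at most 1, so each of its coefficients has absolute value at
  most 1.\<close>

lemma norm_pairing_le_sum:
  assumes f: "contraction G f" and F: "finite F" "\<And>x. x \<notin> F \<Longrightarrow> u x = 0" "F \<subseteq> carrier G"
  shows "norm (pairing u f) \<le> (\<Sum>x\<in>F. norm (u x))"
proof -
  have fa: "f \<in> galgebra G" by (rule opbound_galgebra[OF f])
  define S where "S = snd ` set f \<union> F"
  have S: "finite S" "S \<subseteq> carrier G" using fa F by (auto simp: S_def galgebra_def)
  have g: "norm (gcoeff f x) \<le> 1" if "x \<in> S" for x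
  proof -
    have "L2_set (\<lambda>x. norm (gcoeff f x)) S \<le> 1"
      using contraction_l2norm[OF f] l2norm_sum[OF S(1) _ S(2), of f] by (simp add: S_def)
    then show ?thesis using member_le_L2_set[OF S(1) that, of "\<lambda>x. norm (gcoeff f x)"] by simp
  qed
  have "pairing u f = (\<Sum>x\<in>S. gcoeff f x * u x)"
    by (rule pairing_eq_sum_gcoeff[OF S(1)]) (simp add: S_def)
  also have "\<dots> = (\<Sum>x\<in>F. gcoeff f x * u x)"
    by (rule sum.mono_neutral_right) (use S F in \<open>auto simp: S_def\<close>)
  also have "norm \<dots> \<le> (\<Sum>x\<in>F. norm (u x))"
    by (intro sum_norm_le) (use g in \<open>auto simp: norm_mult S_def intro!: mult_left_le_one_le\<close>)
  finally show ?thesis .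
qed

text \<open>Replacing a near-best finitely supported approximation \<open>a\<close> of \<open>u\<close> by \<open>(1 - g) u + g a\<close>,
  with \<open>(1 - g) u\<close> cut off to a finite set, gives another one. So near-best approximations
  converge, and their limit \<open>a\<close> satisfies \<open>(1 - g) (a - u) = 0\<close>.\<close>

lemma riesz_criterion:
  fixes g :: "'a \<Rightarrow> real"
  assumes E: "E \<subseteq> carrier G"
    and mult: "\<And>f. contraction G f \<Longrightarrow> contraction G (map (\<lambda>(c, x). (of_real (g x) * c, x)) f)"
    and g01: "\<And>x. x \<in> carrier G \<Longrightarrow> 0 \<le> g x \<and> g x \<le> 1"
    and one: "finite {x \<in> carrier G. g x = 1}"
    and summ: "\<And>\<epsilon>. \<epsilon> > 0 \<Longrightarrow> \<exists>F. finite F \<and> F \<subseteq> E \<and>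
      (\<forall>F'. finite F' \<longrightarrow> F' \<subseteq> E - F \<longrightarrow> (\<Sum>x\<in>F'. 1 - g x) \<le> \<epsilon>)"
  shows "riesz_set G E"
  unfolding riesz_set_def
proof (intro conjI ballI impI E)
  fix u assume u: "u \<in> fourier_stieltjes_algebra G" and off: "\<forall>x \<in> carrier G - E. u x = 0"
  let ?N = "fourier_stieltjes_norm G"
  let ?Fin = "finitely_supported G"
  define S where "S = {?N (\<lambda>x. u x - v x) | v. v \<in> ?Fin}"
  define d where "d = Inf S"
  have BF: "v \<in> fourier_stieltjes_algebra G" if "v \<in> ?Fin" for v
    by (rule finitely_supported_fourier_stieltjes[OF that])
  have N0: "0 \<le> ?N (\<lambda>x. u x - v x)" if "v \<in> ?Fin" for v
    by (intro fourier_stieltjes_norm_nonneg fourier_stieltjes_diff u BF that)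
  have ne: "S \<noteq> {}" using finitely_supportedI[of "{}" "\<lambda>x. 0"] unfolding S_def by auto
  have bdd: "bdd_below S" using N0 unfolding S_def by (auto intro!: bdd_belowI[of _ 0])
  have dist: "d \<le> ?N (\<lambda>x. u x - v x)" if "v \<in> ?Fin" for v
    unfolding d_def by (rule cInf_lower[OF _ bdd]) (use that in \<open>auto simp: S_def\<close>)
  define e where "e = (\<lambda>n. 1 / (real n + 1))"
  have e: "0 < e n" for n by (simp add: e_def)
  have e_lim: "e \<longlonglongrightarrow> 0" unfolding e_def
    using LIMSEQ_inverse_real_of_nat by (simp add: inverse_eq_divide add.commute)
  define U where "U = ?N u + 1"
  have U: "0 < U" "norm (u x) \<le> U" if "x \<in> carrier G" for x
    using fourier_stieltjes_norm_nonneg[OF u] norm_le_fourier_stieltjes_norm[OF u that]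
    by (auto simp: U_def)
  have U0: "0 < U" using fourier_stieltjes_norm_nonneg[OF u] by (simp add: U_def)
  have "\<exists>a. a \<in> ?Fin \<and> ?N (\<lambda>x. u x - a x) \<le> d + e n" for n
  proof -
    have "Inf S < d + e n" using e by (simp add: d_def)
    from cInf_lessD[OF ne this] show ?thesis unfolding S_def by force
  qed
  then obtain a where a: "\<And>n. a n \<in> ?Fin" "\<And>n. ?N (\<lambda>x. u x - a n x) \<le> d + e n" by metis
  have "\<exists>F. finite F \<and> F \<subseteq> E \<and> (\<forall>F'. finite F' \<longrightarrow> F' \<subseteq> E - F \<longrightarrow> (\<Sum>x\<in>F'. 1 - g x) \<le> e n / U)" for n
    using summ[of "e n / U"] e[of n] U0 by simp
  then obtain F where F: "\<And>n. finite (F n)" "\<And>n. F n \<subseteq> E"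
    "\<And>n F'. finite F' \<Longrightarrow> F' \<subseteq> E - F n \<Longrightarrow> (\<Sum>x\<in>F'. 1 - g x) \<le> e n / U" by metis
  \<comment> \<open>The cut-off of (1 - g) u; as |u| <= U, what is left out has absolute sum at most
    e n.\<close>
  define h where "h = (\<lambda>n x. if x \<in> F n then of_real (1 - g x) * u x else 0)"
  define b where "b = (\<lambda>n x. h n x + of_real (g x) * a n x)"
  have h: "h n \<in> ?Fin" for n
    by (rule finitely_supportedI[OF F(1) order_trans[OF F(2) E], of n]) (simp add: h_def)
  have b: "b n \<in> ?Fin" for n
    unfolding b_def by (intro finitely_supported_add h finitely_supported_mult a)
  have tail: "norm (pairing (\<lambda>x. of_real (1 - g x) * u x - h n x) f) \<le> e n" if f: "contraction G f" for n f
  proof -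
    have fa: "snd ` set f \<subseteq> carrier G" using opbound_galgebra[OF f] by (simp add: galgebra_def)
    define R where "R = (\<lambda>x. of_real (1 - g x) * u x - h n x)"
    define T where "T = snd ` set f \<inter> (E - F n)"
    have T: "finite T" "T \<subseteq> carrier G" "T \<subseteq> E - F n" using fa by (auto simp: T_def)
    have "pairing R f = pairing (\<lambda>x. if x \<in> T then R x else 0) f"
      by (rule pairing_cong) (use fa off in \<open>auto simp: T_def R_def h_def\<close>)
    also have "norm \<dots> \<le> (\<Sum>x\<in>T. norm (if x \<in> T then R x else 0))"
      by (rule norm_pairing_le_sum[OF f T(1) _ T(2)]) simp
    also have "\<dots> \<le> (\<Sum>x\<in>T. (1 - g x) * U)"
    proof (rule sum_mono)
      fix x assume x: "x \<in> T"
      then have xc: "x \<in> carrier G" using T by auto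
      have "x \<notin> F n" using x by (simp add: T_def)
      then have "R x = of_real (1 - g x) * u x" by (simp add: R_def h_def)
      then have "norm (R x) = (1 - g x) * norm (u x)"
        unfolding norm_mult norm_of_real using g01[OF xc] by (simp only: norm_mult norm_of_real abs_of_nonneg diff_ge_0_iff_ge)
      also have "\<dots> \<le> (1 - g x) * U" using g01[OF xc] U[OF xc] by (intro mult_left_mono) auto
      finally show "norm (if x \<in> T then R x else 0) \<le> (1 - g x) * U" using x by simp
    qed
    also have "\<dots> = (\<Sum>x\<in>T. 1 - g x) * U" by (simp add: sum_distrib_right)
    also have "\<dots> \<le> e n / U * U" by (intro mult_right_mono F(3) T) (use U0 in simp)
    finally show ?thesis using U0 by (simp add: R_def)
  qed
  \<comment> \<open>u - b is g (u - a) plus the omitted part of (1 - g) u. Multiplication by g can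
    be moved onto the contraction f, so the first part costs at most d + e n.\<close>
  have Nb: "?N (\<lambda>x. u x - b n x) \<le> d + 2 * e n" for n
  proof (rule fourier_stieltjes_norm_least)
    fix f assume f: "contraction G f"
    let ?gf = "map (\<lambda>(c, x). (of_real (g x) * c, x)) f"
    have "pairing (\<lambda>x. u x - b n x) f = pairing (\<lambda>x. of_real (g x) * (u x - a n x)) f
        + pairing (\<lambda>x. of_real (1 - g x) * u x - h n x) f"
      unfolding pairing_add[symmetric] by (rule pairing_cong) (simp add: b_def algebra_simps)
    also have "pairing (\<lambda>x. of_real (g x) * (u x - a n x)) f = pairing (\<lambda>x. u x - a n x) ?gf"
      by (rule pairing_map[symmetric])
    also have "norm (pairing (\<lambda>x. u x - a n x) ?gf + pairing (\<lambda>x. of_real (1 - g x) * u x - h n x) f)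
        \<le> (d + e n) + e n"
    proof (intro norm_triangle_le add_mono tail f)
      show "norm (pairing (\<lambda>x. u x - a n x) ?gf) \<le> d + e n"
        by (rule order_trans[OF fourier_stieltjes_norm_upper a(2)])
          (intro fourier_stieltjes_diff u BF a mult f)+
    qed
    finally show "norm (pairing (\<lambda>x. u x - b n x) f) \<le> d + 2 * e n" by simp
  qed
  \<comment> \<open>Both are near-best with error 2 e n, and 13 * 2 = 26; in \<open>key\<close> the
    omitted part raises this to 27.\<close>
  have ab: "norm (a n x - b n x) \<le> 26 * e n" if x: "x \<in> carrier G" for n x
  proof -
    have "?N (\<lambda>x. a n x - b n x) \<le> 13 * (2 * e n)"
      by (rule near_best_approximations_close[OF u dist a(1) _ b Nb])
        (use a(2)[of n] e[of n] in auto)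
    then show ?thesis
      using norm_le_fourier_stieltjes_norm[OF fourier_stieltjes_diff[OF BF[OF a(1)] BF[OF b]] x, of n n] by simp
  qed
  have aa: "?N (\<lambda>x. a n x - a m x) \<le> 13 * (e n + e m)" for n m
    by (rule near_best_approximations_close[OF u dist a(1) _ a(1)])
      (use a(2)[of n] a(2)[of m] e[of n] e[of m] in auto)
  have key: "(1 - g x) * norm (u x - a n x) \<le> 27 * e n" if x: "x \<in> carrier G" for n x
  proof -
    have "contraction G [(1, x)]" using opbound_single[OF x, of 1] by simp
    from tail[OF this, of n] have "norm (of_real (1 - g x) * u x - h n x) \<le> e n" by simp
    then have "norm ((of_real (1 - g x) * u x - h n x) + - (a n x - b n x)) \<le> e n + 26 * e n"
      using ab[OF x, of n] by (intro norm_triangle_le) (simp add: norm_minus_commute)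
    moreover have "(of_real (1 - g x) * u x - h n x) + - (a n x - b n x) = of_real (1 - g x) * (u x - a n x)"
      by (simp add: b_def algebra_simps)
    ultimately have "norm (of_real (1 - g x) * (u x - a n x)) \<le> 27 * e n" by simp
    moreover have "norm (of_real (1 - g x) :: complex) = 1 - g x"
      unfolding norm_of_real using g01[OF x] by simp
    ultimately show ?thesis by (simp only: norm_mult)
  qed
  have lim: "(\<lambda>n. a n x) \<longlonglongrightarrow> u x" if x: "x \<in> carrier G" "g x \<noteq> 1" for x
  proof -
    have p: "1 - g x > 0" using g01[OF x(1)] x(2) by simp
    have "(\<lambda>n. a n x - u x) \<longlonglongrightarrow> 0"
    proof (rule Lim_null_comparison)
      show "\<forall>\<^sub>F n in sequentially. norm (a n x - u x) \<le> 27 / (1 - g x) * e n"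
        using key[OF x(1)] p by (intro always_eventually allI) (simp add: field_simps norm_minus_commute)
      show "(\<lambda>n. 27 / (1 - g x) * e n) \<longlonglongrightarrow> 0" using tendsto_mult_left[OF e_lim, of "27 / (1 - g x)"] by simp
    qed
    then show ?thesis by (simp add: LIM_zero_iff)
  qed
  have Cau: "Cauchy (\<lambda>n. a n x)" if x: "x \<in> carrier G" for x
  proof (rule CauchyI)
    fix r :: real assume "r > 0"
    then have "\<forall>\<^sub>F n in sequentially. e n < r / 26" by (intro order_tendstoD(2)[OF e_lim]) simp
    then obtain M where M: "\<And>n. n \<ge> M \<Longrightarrow> e n < r / 26" unfolding eventually_sequentially by auto
    show "\<exists>M. \<forall>m\<ge>M. \<forall>n\<ge>M. norm (a m x - a n x) < r"
    proof (intro exI[of _ M] allI impI)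
      fix m n assume mn: "M \<le> m" "M \<le> n"
      have "norm (a m x - a n x) \<le> 13 * (e m + e n)"
        using norm_le_fourier_stieltjes_norm[OF fourier_stieltjes_diff[OF BF[OF a(1)] BF[OF a(1)]] x, of m n] aa[of m n]
        by simp
      also have "\<dots> < r" using M[OF mn(1)] M[OF mn(2)] by simp
      finally show "norm (a m x - a n x) < r" .
    qed
  qed
  define l where "l = (\<lambda>x. if x \<in> carrier G then lim (\<lambda>n. a n x) else 0)"
  have l: "(\<lambda>n. a n x) \<longlonglongrightarrow> l x" if x: "x \<in> carrier G" for x
    using Cauchy_convergent[OF Cau[OF x]] x by (simp add: l_def convergent_LIMSEQ_iff)
  \<comment> \<open>Where g = 1 nothing identifies the limit with u. These points are finite in
    number, so the discrepancy can simply be added to the approximants.\<close>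
  have diff: "(\<lambda>x. u x - l x) \<in> ?Fin"
  proof (rule finitely_supportedI[OF one])
    fix x assume x: "x \<notin> {x \<in> carrier G. g x = 1}"
    show "u x - l x = 0"
    proof (cases "x \<in> carrier G")
      case True
      then show ?thesis using LIMSEQ_unique[OF l lim] x by auto
    next
      case False
      then show ?thesis using fourier_stieltjes_group_function[OF u] by (simp add: l_def)
    qed
  qed auto
  have la: "?N (\<lambda>x. l x - a n x) \<le> 13 * e n" for n
  proof (rule fourier_stieltjes_norm_least)
    fix f assume f: "contraction G f"
    have fa: "f \<in> galgebra G" by (rule opbound_galgebra[OF f])
    have "(\<lambda>m. pairing (\<lambda>x. a m x - a n x) f) \<longlonglongrightarrow> pairing (\<lambda>x. l x - a n x) f"
      by (rule pairing_tendsto[OF _ fa]) (intro tendsto_intros l)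
    then have "(\<lambda>m. norm (pairing (\<lambda>x. a m x - a n x) f)) \<longlonglongrightarrow> norm (pairing (\<lambda>x. l x - a n x) f)"
      by (rule tendsto_norm)
    moreover have "(\<lambda>m. 13 * (e m + e n)) \<longlonglongrightarrow> 13 * (0 + e n)"
      by (intro tendsto_intros e_lim)
    moreover have "norm (pairing (\<lambda>x. a m x - a n x) f) \<le> 13 * (e m + e n)" for m
      by (rule order_trans[OF fourier_stieltjes_norm_upper aa])
        (intro fourier_stieltjes_diff BF a f)+
    ultimately show "norm (pairing (\<lambda>x. l x - a n x) f) \<le> 13 * e n"
      using LIMSEQ_le[of "\<lambda>m. norm (pairing (\<lambda>x. a m x - a n x) f)" _ "\<lambda>m. 13 * (e m + e n)"] by auto
  qed
  show "u \<in> fourier_algebra G"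
    unfolding fourier_algebra_def
  proof (intro CollectI conjI allI impI u)
    fix \<epsilon> :: real assume "\<epsilon> > 0"
    then have "\<forall>\<^sub>F n in sequentially. e n < \<epsilon> / 13" by (intro order_tendstoD(2)[OF e_lim]) simp
    then obtain n where n: "e n < \<epsilon> / 13" unfolding eventually_sequentially by auto
    define v where "v = (\<lambda>x. a n x + (u x - l x))"
    have v: "v \<in> ?Fin" unfolding v_def by (intro finitely_supported_add a diff)
    moreover have "?N (\<lambda>x. u x - v x) < \<epsilon>" using la[of n] n by (simp add: v_def)
    ultimately show "\<exists>v\<in>fourier_stieltjes_algebra G \<inter> ?Fin. ?N (\<lambda>x. u x - v x) < \<epsilon>"
      using BF[OF v] by blast
  qed
qed

end

section \<open>A criterion for non-reflexivity\<close>

text \<open>Limits of real and imaginary parts. The factor 2 comes from |Re| + |Im|; only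
  boundedness of the resulting functionals matters.\<close>

lemma generalized_limit_complex:
  obtains L :: "(nat \<Rightarrow> complex) \<Rightarrow> complex" where
    "\<And>s t. Bseq s \<Longrightarrow> Bseq t \<Longrightarrow> L (\<lambda>n. s n + t n) = L s + L t"
    "\<And>c s. Bseq s \<Longrightarrow> L (\<lambda>n. c * s n) = c * L s"
    "\<And>s C. (\<And>n. norm (s n) \<le> C) \<Longrightarrow> norm (L s) \<le> 2 * C"
    "\<And>s c. Bseq s \<Longrightarrow> \<forall>\<^sub>F n in sequentially. c \<le> Re (s n) \<Longrightarrow> c \<le> Re (L s)"
    "\<And>s. Bseq s \<Longrightarrow> \<forall>\<^sub>F n in sequentially. s n = 0 \<Longrightarrow> L s = 0"
proof -
  obtain M where M: "limit_functional M" by (rule limit_functional_exists)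
  have add: "\<And>s t. Bseq s \<Longrightarrow> Bseq t \<Longrightarrow> M (\<lambda>n. s n + t n) = M s + M t"
    and mul: "\<And>c s. Bseq s \<Longrightarrow> M (\<lambda>n. c * s n) = c * M s"
    and up: "\<And>s c. Bseq s \<Longrightarrow> \<forall>\<^sub>F n in sequentially. s n \<le> c \<Longrightarrow> M s \<le> c"
    and lo: "\<And>s c. Bseq s \<Longrightarrow> \<forall>\<^sub>F n in sequentially. c \<le> s n \<Longrightarrow> c \<le> M s"
    using M unfolding limit_functional_def by simp_all
  define L where "L = (\<lambda>s. Complex (M (\<lambda>n. Re (s n))) (M (\<lambda>n. Im (s n))))"
  have B: "Bseq (\<lambda>n. Re (s n))" "Bseq (\<lambda>n. Im (s n))" if s: "Bseq s" for s :: "nat \<Rightarrow> complex"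
  proof -
    obtain K where K: "\<And>n. norm (s n) \<le> K" using s unfolding Bseq_def by blast
    have "norm (Re (s n)) \<le> K" "norm (Im (s n)) \<le> K" for n
      using K[of n] abs_Re_le_cmod[of "s n"] abs_Im_le_cmod[of "s n"] by auto
    then show "Bseq (\<lambda>n. Re (s n))" "Bseq (\<lambda>n. Im (s n))" by (auto intro: BseqI'[of _ K])
  qed
  have Bc: "Bseq (\<lambda>n. c * s n)" if s: "Bseq s" for s :: "nat \<Rightarrow> real" and c
    by (rule Bseq_mult[OF Bfun_const s])
  show thesis
  proof (rule that)
    fix s t :: "nat \<Rightarrow> complex" assume s: "Bseq s" and t: "Bseq t"
    show "L (\<lambda>n. s n + t n) = L s + L t"
      unfolding L_def using add[OF B(1)[OF s] B(1)[OF t]] add[OF B(2)[OF s] B(2)[OF t]]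
      by (simp add: complex_eq_iff)
  next
    fix c and s :: "nat \<Rightarrow> complex" assume s: "Bseq s"
    show "L (\<lambda>n. c * s n) = c * L s"
      unfolding L_def
      using add[OF Bc[OF B(1)[OF s], of "Re c"] Bc[OF B(2)[OF s], of "- Im c"]]
        add[OF Bc[OF B(2)[OF s], of "Re c"] Bc[OF B(1)[OF s], of "Im c"]]
        mul[OF B(1)[OF s], of "Re c"] mul[OF B(2)[OF s], of "- Im c"]
        mul[OF B(2)[OF s], of "Re c"] mul[OF B(1)[OF s], of "Im c"]
      by (simp add: complex_eq_iff)
  next
    fix s :: "nat \<Rightarrow> complex" and C assume C: "\<And>n. norm (s n) \<le> C"
    have s: "Bseq s" by (rule BseqI'[of s C]) (rule C)
    have "Re (s n) \<le> C" "- C \<le> Re (s n)" "Im (s n) \<le> C" "- C \<le> Im (s n)" for n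
      using C[of n] abs_Re_le_cmod[of "s n"] abs_Im_le_cmod[of "s n"] by linarith+
    then have "\<bar>M (\<lambda>n. Re (s n))\<bar> \<le> C" "\<bar>M (\<lambda>n. Im (s n))\<bar> \<le> C"
      using up[OF B(1)[OF s], of C] lo[OF B(1)[OF s], of "-C"]
        up[OF B(2)[OF s], of C] lo[OF B(2)[OF s], of "-C"] by (simp_all add: abs_le_iff)
    then show "norm (L s) \<le> 2 * C" using cmod_le[of "L s"] by (simp add: L_def)
  next
    fix s :: "nat \<Rightarrow> complex" and c assume s: "Bseq s" and "\<forall>\<^sub>F n in sequentially. c \<le> Re (s n)"
    then show "c \<le> Re (L s)" using lo[OF B(1)[OF s]] by (simp add: L_def)
  next
    fix s :: "nat \<Rightarrow> complex" assume s: "Bseq s" and z: "\<forall>\<^sub>F n in sequentially. s n = 0"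
    have r: "\<forall>\<^sub>F n in sequentially. Re (s n) \<le> 0" "\<forall>\<^sub>F n in sequentially. 0 \<le> Re (s n)"
      "\<forall>\<^sub>F n in sequentially. Im (s n) \<le> 0" "\<forall>\<^sub>F n in sequentially. 0 \<le> Im (s n)"
      using z by (auto elim: eventually_mono)
    then show "L s = 0"
      using up[OF B(1)[OF s] r(1)] lo[OF B(1)[OF s] r(2)] up[OF B(2)[OF s] r(3)] lo[OF B(2)[OF s] r(4)]
      by (simp add: L_def complex_eq_iff)
  qed
qed

section \<open>Fejer functions and means over progressions\<close>

lemma pairing_upt: "pairing u (map (\<lambda>l. (c, h l)) [0..<n]) = c * (\<Sum>l<n. u (h l))"
  by (induction n) (auto simp: algebra_simps)

lemma pairing_gmult: "pairing u (gmult G f h) = pairing (\<lambda>x. pairing (\<lambda>s. u (x \<otimes>\<^bsub>G\<^esub> s)) h) f"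
proof (induction f)
  case (Cons p f)
  obtain c x where p: "p = (c, x)" by fastforce
  have "pairing u (map (\<lambda>(d, y). (c * d, x \<otimes>\<^bsub>G\<^esub> y)) h) = c * pairing (\<lambda>s. u (x \<otimes>\<^bsub>G\<^esub> s)) h"
    by (induction h) (auto simp: algebra_simps)
  then show ?case using Cons p by (simp add: gmult_Cons)
qed simp

text \<open>The function \<open>x \<mapsto> \<langle>\<lambda>(x) 1\<^bsub>D\<^esub>, 1\<^bsub>a D\<^esub>\<rangle> / n\<close> for \<open>D = {1, d, \<dots>, d\<^sup>n\<^sup>-\<^sup>1}\<close>.\<close>

definition fejer :: "('a, 'm) monoid_scheme \<Rightarrow> 'a \<Rightarrow> 'a \<Rightarrow> nat \<Rightarrow> 'a \<Rightarrow> real" where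
  "fejer G a d n x =
     (\<Sum>j<n. \<Sum>i<n. if x = a \<otimes>\<^bsub>G\<^esub> d [^]\<^bsub>G\<^esub> i \<otimes>\<^bsub>G\<^esub> inv\<^bsub>G\<^esub> (d [^]\<^bsub>G\<^esub> j) then 1 else 0) / real n"

definition fejer_support :: "('a, 'm) monoid_scheme \<Rightarrow> 'a \<Rightarrow> 'a \<Rightarrow> nat \<Rightarrow> 'a set" where
  "fejer_support G a d n =
     (\<lambda>(i, j). a \<otimes>\<^bsub>G\<^esub> d [^]\<^bsub>G\<^esub> i \<otimes>\<^bsub>G\<^esub> inv\<^bsub>G\<^esub> (d [^]\<^bsub>G\<^esub> j)) ` ({..<n} \<times> {..<n})"

definition progression_mean :: "('a, 'm) monoid_scheme \<Rightarrow> 'a \<Rightarrow> 'a \<Rightarrow> nat \<Rightarrow> 'a gelem" where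
  "progression_mean G a d m = map (\<lambda>l. (of_real (1 / real m), a \<otimes>\<^bsub>G\<^esub> d [^]\<^bsub>G\<^esub> l)) [0..<m]"

context group begin

lemma opbound_upt:
  assumes "\<And>l. h l \<in> carrier G"
  shows "opbound G (real n * norm c) (map (\<lambda>l. (c, h l)) [0..<n])"
proof (induction n)
  case (Suc n)
  have "opbound G (real n * norm c + norm c) (map (\<lambda>l. (c, h l)) [0..<n] @ [(c, h n)])"
    by (intro opbound_append Suc opbound_single assms)
  then show ?case by (simp add: algebra_simps)
qed (simp add: opbound_Nil)

lemma inv_mult_eq_one_iff:
  "x \<in> carrier G \<Longrightarrow> y \<in> carrier G \<Longrightarrow> inv y \<otimes> x = \<one> \<longleftrightarrow> x = y"
  by (metis inv_equality inv_inv inv_closed l_inv)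

lemma gnorm2_upt:
  assumes "\<And>l. h l \<in> carrier G" "inj_on h {..<n}"
  shows "gnorm2 G (gdelta G) (map (\<lambda>l. (of_real c, h l)) [0..<n]) = c\<^sup>2 * real n"
proof -
  have "gform G (gdelta G) (map (\<lambda>l. (of_real c, h l)) [0..<n]) (map (\<lambda>l. (of_real c, h l)) [0..<n])
      = of_real c * (\<Sum>l<n. of_real c * (\<Sum>k<n. gdelta G (inv (h k) \<otimes> h l)))"
    unfolding gform_def pairing_upt by (simp add: gdelta_def if_distrib[of cnj] cong: if_cong)
  also have "(\<Sum>l<n. of_real c * (\<Sum>k<n. gdelta G (inv (h k) \<otimes> h l))) = (\<Sum>l<n. of_real c :: complex)"
  proof (rule sum.cong)
    fix l assume l: "l \<in> {..<n}"
    have "(\<Sum>k<n. gdelta G (inv (h k) \<otimes> h l)) = (\<Sum>k<n. if k = l then 1 else 0)"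
    proof (rule sum.cong)
      fix k assume "k \<in> {..<n}"
      then have "h l = h k \<longleftrightarrow> k = l" using assms(2) l by (auto dest: inj_onD)
      then show "gdelta G (inv (h k) \<otimes> h l) = (if k = l then 1 else 0)"
        unfolding gdelta_def inv_mult_eq_one_iff[OF assms(1) assms(1)] by simp
    qed simp
    then show "of_real c * (\<Sum>k<n. gdelta G (inv (h k) \<otimes> h l)) = (of_real c :: complex)"
      using l by simp
  qed simp
  finally show ?thesis unfolding gnorm2_def by (simp add: power2_eq_square)
qed

context
  fixes a d n
  assumes a [simp]: "a \<in> carrier G" and d [simp]: "d \<in> carrier G"
    and inj: "inj_on (\<lambda>j. d [^] (j::nat)) {..<n}" and n: "0 < n"
begin

lemma inj_translate: "inj_on (\<lambda>j. a \<otimes> d [^] (j::nat)) {..<n}"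
  using inj by (auto simp: inj_on_def)

lemma fejer_nonneg: "0 \<le> fejer G a d n x"
  unfolding fejer_def by (intro divide_nonneg_nonneg sum_nonneg) auto

lemma finite_fejer_support: "finite (fejer_support G a d n)"
  unfolding fejer_support_def by simp

lemma fejer_support_carrier: "fejer_support G a d n \<subseteq> carrier G"
  unfolding fejer_support_def by auto

lemma fejer_outside: "x \<notin> fejer_support G a d n \<Longrightarrow> fejer G a d n x = 0"
  unfolding fejer_support_def fejer_def by (auto intro!: sum.neutral)

lemma finitely_supported_fejer: "(\<lambda>x. of_real (fejer G a d n x)) \<in> finitely_supported G"
  by (rule finitely_supportedI[OF finite_fejer_support fejer_support_carrier]) (simp add: fejer_outside)

text \<open>The function is nonnegative, so this is its absolute sum, the quantity that limits how
  much a combination changes the pairing with it.\<close>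

lemma sum_fejer: "(\<Sum>x\<in>fejer_support G a d n. fejer G a d n x) = real n"
proof -
  have "(\<Sum>x\<in>fejer_support G a d n. fejer G a d n x) = (\<Sum>j<n. \<Sum>i<n. \<Sum>x\<in>fejer_support G a d n.
      if x = a \<otimes> d [^] i \<otimes> inv (d [^] j) then 1 else 0) / real n"
    unfolding fejer_def sum_divide_distrib[symmetric]
    by (subst sum.swap, subst (2) sum.swap) (rule refl)
  also have "\<dots> = (\<Sum>j<n. \<Sum>i<n. 1) / real n"
  proof -
    have "(\<Sum>x\<in>fejer_support G a d n. if x = a \<otimes> d [^] i \<otimes> inv (d [^] j) then 1 else 0) = (1::real)"
      if "i < n" "j < n" for i j
    proof -
      have "a \<otimes> d [^] i \<otimes> inv (d [^] j) \<in> fejer_support G a d n"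
        unfolding fejer_support_def using that by force
      then show ?thesis using finite_fejer_support by simp
    qed
    then show ?thesis by simp
  qed
  finally show ?thesis using n by simp
qed

text \<open>Cauchy-Schwarz in l^2 for the indicators of D and a D, both of square norm n because the
  powers are distinct.\<close>

lemma fourier_stieltjes_norm_fejer:
  "fourier_stieltjes_norm G (\<lambda>x. of_real (fejer G a d n x)) \<le> 1"
proof (rule fourier_stieltjes_norm_least)
  fix f assume f: "contraction G f"
  have fa: "f \<in> galgebra G" by (rule opbound_galgebra[OF f])
  define \<xi> where "\<xi> = map (\<lambda>l. (of_real 1, d [^] l) :: complex \<times> 'a) [0..<n]"
  define \<eta> where "\<eta> = map (\<lambda>l. (of_real 1, a \<otimes> d [^] l) :: complex \<times> 'a) [0..<n]"
  have al: "\<xi> \<in> galgebra G" "\<eta> \<in> galgebra G" unfolding \<xi>_def \<eta>_def galgebra_def by auto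
  have nm: "gnorm2 G (gdelta G) \<xi> = real n" "gnorm2 G (gdelta G) \<eta> = real n"
    unfolding \<xi>_def \<eta>_def using gnorm2_upt[of "\<lambda>l. d [^] l" n 1] gnorm2_upt[of "\<lambda>l. a \<otimes> d [^] l" n 1]
      inj inj_translate by simp_all
  have "gform G (gdelta G) (gmult G f \<xi>) \<eta>
      = pairing (\<lambda>x. \<Sum>j<n. \<Sum>i<n. gdelta G (inv (a \<otimes> d [^] i) \<otimes> (x \<otimes> d [^] j))) f"
    unfolding gform_def pairing_gmult \<xi>_def \<eta>_def pairing_upt
    by (simp add: gdelta_def if_distrib[of cnj] cong: if_cong)
  also have "\<dots> = pairing (\<lambda>x. of_real (real n) * of_real (fejer G a d n x)) f"
  proof (rule pairing_cong)
    fix x assume "x \<in> snd ` set f"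
    then have x: "x \<in> carrier G" using fa by (auto simp: galgebra_def)
    have "gdelta G (inv (a \<otimes> d [^] i) \<otimes> (x \<otimes> d [^] j))
        = of_real (if x = a \<otimes> d [^] i \<otimes> inv (d [^] j) then 1 else 0)" for i j :: nat
    proof -
      have "x \<otimes> d [^] j = a \<otimes> d [^] i \<longleftrightarrow> x = a \<otimes> d [^] i \<otimes> inv (d [^] j)"
        using x by (metis a d inv_solve_right m_closed nat_pow_closed)
      then show ?thesis unfolding gdelta_def using x by (subst inv_mult_eq_one_iff) auto
    qed
    then show "(\<Sum>j<n. \<Sum>i<n. gdelta G (inv (a \<otimes> d [^] i) \<otimes> (x \<otimes> d [^] j)))
        = of_real (real n) * of_real (fejer G a d n x)"
      unfolding fejer_def using n by simp
  qed
  finally have e: "of_real (real n) * pairing (\<lambda>x. of_real (fejer G a d n x)) f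
      = gform G (gdelta G) (gmult G f \<xi>) \<eta>" by (simp add: pairing_cmult)
  have "real n * norm (pairing (\<lambda>x. of_real (fejer G a d n x)) f)
      = norm (gform G (gdelta G) (gmult G f \<xi>) \<eta>)" unfolding e[symmetric] by (simp add: norm_mult)
  also have "\<dots> \<le> l2norm (gmult G f \<xi>) * l2norm \<eta>"
    by (rule gform_Cauchy_Schwarz[OF positive_definite_gdelta]) (use al fa in auto)
  also have "\<dots> \<le> (1 * l2norm \<xi>) * l2norm \<eta>"
    by (intro mult_right_mono opbound_sqrt f positive_definite_gdelta al l2norm_nonneg)
  also have "\<dots> = real n" unfolding nm by simp
  finally show "norm (pairing (\<lambda>x. of_real (fejer G a d n x)) f) \<le> 1" using n by simp
qed

text \<open>The point a d^l arises from i = l + j for each j < n - l. If d has finite order there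
  may be further coincidences, hence an inequality.\<close>

lemma fejer_ge:
  assumes l: "l < n"
  shows "1 - real l / real n \<le> fejer G a d n (a \<otimes> d [^] l)"
proof -
  let ?t = "\<lambda>j i. if a \<otimes> d [^] l = a \<otimes> d [^] i \<otimes> inv (d [^] j) then 1 else (0::real)"
  have "real (n - l) = (\<Sum>j<n - l. 1)" by simp
  also have "\<dots> \<le> (\<Sum>j<n - l. \<Sum>i<n. ?t j i)"
  proof (rule sum_mono)
    fix j assume j: "j \<in> {..<n - l}"
    have "d [^] (l + j) = d [^] l \<otimes> d [^] j" by (rule nat_pow_mult[OF d, symmetric])
    then have "a \<otimes> d [^] l = a \<otimes> d [^] (l + j) \<otimes> inv (d [^] j)" by (simp add: m_assoc)
    then have "1 = ?t j (l + j)" by simp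
    also have "\<dots> \<le> (\<Sum>i<n. ?t j i)"
      by (rule member_le_sum) (use j in auto)
    finally show "1 \<le> (\<Sum>i<n. ?t j i)" .
  qed
  also have "\<dots> \<le> (\<Sum>j<n. \<Sum>i<n. ?t j i)"
    by (rule sum_mono2) (auto intro!: sum_nonneg)
  finally have "real (n - l) / real n \<le> fejer G a d n (a \<otimes> d [^] l)"
    unfolding fejer_def by (rule divide_right_mono) simp
  then show ?thesis using l n by (simp add: of_nat_diff diff_divide_distrib)
qed

lemma contraction_progression_mean:
  assumes "0 < m" shows "contraction G (progression_mean G a d m)"
  unfolding progression_mean_def
  using opbound_upt[of "\<lambda>l. a \<otimes> d [^] l" m "of_real (1 / real m)"] assms
  by (simp add: norm_divide)

lemma l2norm_progression_mean:
  assumes "0 < m" "m \<le> n" shows "l2norm (progression_mean G a d m) = 1 / sqrt (real m)"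
proof -
  have "inj_on (\<lambda>j. a \<otimes> d [^] j) {..<m}"
    using inj_translate by (rule inj_on_subset) (use assms in auto)
  then have "gnorm2 G (gdelta G) (progression_mean G a d m) = (1 / real m)\<^sup>2 * real m"
    unfolding progression_mean_def by (intro gnorm2_upt) auto
  also have "\<dots> = 1 / real m" using assms by (simp add: power2_eq_square)
  finally show ?thesis by (simp add: real_sqrt_divide)
qed

text \<open>The mean sits on the first m of the points a d^l, where the Fejer function is at least 1
  - m / n. So a contraction of l^2 norm 1 / sqrt m almost norms it.\<close>

lemma pairing_fejer_progression_mean:
  assumes "0 < m" "m \<le> n"
  shows "1 - real m / real n \<le> Re (pairing (\<lambda>x. of_real (fejer G a d n x)) (progression_mean G a d m))"
proof -
  have "(\<Sum>l<m. 1 - real m / real n) \<le> (\<Sum>l<m. fejer G a d n (a \<otimes> d [^] l))"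
  proof (rule sum_mono)
    fix l assume l: "l \<in> {..<m}"
    have "1 - real m / real n \<le> 1 - real l / real n" using l n by (simp add: divide_right_mono)
    also have "\<dots> \<le> fejer G a d n (a \<otimes> d [^] l)" by (rule fejer_ge) (use l assms in auto)
    finally show "1 - real m / real n \<le> fejer G a d n (a \<otimes> d [^] l)" .
  qed
  then have "1 - real m / real n \<le> (1 / real m) * (\<Sum>l<m. fejer G a d n (a \<otimes> d [^] l))"
    using assms(1) by (simp add: field_simps)
  then show ?thesis unfolding progression_mean_def pairing_upt
    by (simp only: of_real_sum[symmetric] of_real_mult[symmetric] Re_complex_of_real)
qed

end

section \<open>Linear structure of the Fourier algebra\<close>

lemma finitely_supported_fourier_algebra:
  assumes "u \<in> finitely_supported G" shows "u \<in> fourier_algebra G"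
proof -
  have u: "u \<in> fourier_stieltjes_algebra G" by (rule finitely_supported_fourier_stieltjes[OF assms])
  have "fourier_stieltjes_norm G (\<lambda>x. u x - u x) \<le> 0"
    by (rule fourier_stieltjes_norm_least) simp
  then show ?thesis using u assms unfolding fourier_algebra_def by force
qed

lemma fourier_algebra_add:
  assumes "u \<in> fourier_algebra G" "v \<in> fourier_algebra G"
  shows "(\<lambda>x. u x + v x) \<in> fourier_algebra G"
proof -
  have B: "u \<in> fourier_stieltjes_algebra G" "v \<in> fourier_stieltjes_algebra G"
    using assms unfolding fourier_algebra_def by auto
  show ?thesis unfolding fourier_algebra_def
  proof (intro CollectI conjI allI impI fourier_stieltjes_add B)
    fix e :: real assume e: "0 < e"
    obtain u' where u': "u' \<in> fourier_stieltjes_algebra G" "u' \<in> finitely_supported G"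
      "fourier_stieltjes_norm G (\<lambda>x. u x - u' x) < e / 2"
      using assms(1) e unfolding fourier_algebra_def by (auto dest!: spec[of _ "e / 2"])
    obtain v' where v': "v' \<in> fourier_stieltjes_algebra G" "v' \<in> finitely_supported G"
      "fourier_stieltjes_norm G (\<lambda>x. v x - v' x) < e / 2"
      using assms(2) e unfolding fourier_algebra_def by (auto dest!: spec[of _ "e / 2"])
    have "fourier_stieltjes_norm G (\<lambda>x. (u x - u' x) + (v x - v' x)) < e"
      using fourier_stieltjes_norm_add[OF fourier_stieltjes_diff[OF B(1) u'(1)]
          fourier_stieltjes_diff[OF B(2) v'(1)]] u'(3) v'(3) by linarith
    moreover have "(\<lambda>x. (u x - u' x) + (v x - v' x)) = (\<lambda>x. (u x + v x) - (u' x + v' x))"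
      by (auto simp: algebra_simps)
    ultimately show "\<exists>w\<in>fourier_stieltjes_algebra G \<inter> finitely_supported G.
        fourier_stieltjes_norm G (\<lambda>x. (u x + v x) - w x) < e"
      by (intro bexI[of _ "\<lambda>x. u' x + v' x"])
        (auto intro!: fourier_stieltjes_add finitely_supported_add u' v')
  qed
qed

lemma fourier_algebra_cmult:
  assumes "u \<in> fourier_algebra G"
  shows "(\<lambda>x. c * u x) \<in> fourier_algebra G"
proof -
  have B: "u \<in> fourier_stieltjes_algebra G" using assms unfolding fourier_algebra_def by auto
  show ?thesis unfolding fourier_algebra_def
  proof (intro CollectI conjI allI impI fourier_stieltjes_cmult B)
    fix e :: real assume e: "0 < e"
    have p: "0 < e / (norm c + 1)" using e by (simp add: add_nonneg_pos)
    obtain v where v: "v \<in> fourier_stieltjes_algebra G" "v \<in> finitely_supported G"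
      "fourier_stieltjes_norm G (\<lambda>x. u x - v x) < e / (norm c + 1)"
      using assms p unfolding fourier_algebra_def by (auto dest!: spec[of _ "e / (norm c + 1)"])
    have "fourier_stieltjes_norm G (\<lambda>x. c * (u x - v x)) \<le> norm c * fourier_stieltjes_norm G (\<lambda>x. u x - v x)"
      by (intro fourier_stieltjes_norm_cmult fourier_stieltjes_diff B v)
    also have "\<dots> \<le> norm c * (e / (norm c + 1))" by (intro mult_left_mono) (use v in auto)
    also have "\<dots> < e"
    proof -
      have "norm c + 1 > 0" by (simp add: add_nonneg_pos)
      then show ?thesis using e by (simp add: field_simps)
    qed
    finally show "\<exists>w\<in>fourier_stieltjes_algebra G \<inter> finitely_supported G.
        fourier_stieltjes_norm G (\<lambda>x. c * u x - w x) < e"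
      by (intro bexI[of _ "\<lambda>x. c * v x"])
        (auto intro!: fourier_stieltjes_cmult finitely_supported_mult v simp: right_diff_distrib)
  qed
qed

lemma fourier_supported_add:
  "u \<in> fourier_supported G E \<Longrightarrow> v \<in> fourier_supported G E \<Longrightarrow> (\<lambda>x. u x + v x) \<in> fourier_supported G E"
  by (auto simp: fourier_supported_def fourier_algebra_add)

lemma fourier_supported_cmult:
  "u \<in> fourier_supported G E \<Longrightarrow> (\<lambda>x. c * u x) \<in> fourier_supported G E"
  by (auto simp: fourier_supported_def fourier_algebra_cmult)

end

section \<open>Linear structure and norm of dual spaces\<close>

lemma dual_space_add:
  assumes "\<phi> \<in> dual_space V N" "\<psi> \<in> dual_space V N"
  shows "(\<lambda>u. \<phi> u + \<psi> u) \<in> dual_space V N"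
proof -
  obtain C where C: "\<And>u. u \<in> V \<Longrightarrow> norm (\<phi> u) \<le> C * N u" using assms unfolding dual_space_def by blast
  obtain D where D: "\<And>u. u \<in> V \<Longrightarrow> norm (\<psi> u) \<le> D * N u" using assms unfolding dual_space_def by blast
  have "norm (\<phi> u + \<psi> u) \<le> (C + D) * N u" if "u \<in> V" for u
    unfolding distrib_right by (intro norm_triangle_le add_mono C D that)
  then have "\<exists>C. \<forall>u\<in>V. norm (\<phi> u + \<psi> u) \<le> C * N u" by blast
  then show ?thesis using assms unfolding dual_space_def by (simp add: algebra_simps)
qed

lemma dual_space_cmult:
  assumes "\<phi> \<in> dual_space V N"
  shows "(\<lambda>u. c * \<phi> u) \<in> dual_space V N"
proof -
  obtain C where C: "\<And>u. u \<in> V \<Longrightarrow> norm (\<phi> u) \<le> C * N u" using assms unfolding dual_space_def by blast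
  have "norm (c * \<phi> u) \<le> (norm c * C) * N u" if "u \<in> V" for u
    unfolding norm_mult mult.assoc by (intro mult_left_mono C that) simp
  then have "\<exists>C. \<forall>u\<in>V. norm (c * \<phi> u) \<le> C * N u" by blast
  then show ?thesis using assms unfolding dual_space_def by (simp add: algebra_simps)
qed

lemma dual_norm_upper:
  assumes "\<phi> \<in> dual_space V N" "u \<in> V" "N u \<le> 1" "\<And>v. v \<in> V \<Longrightarrow> 0 \<le> N v"
  shows "norm (\<phi> u) \<le> dual_norm V N \<phi>"
  unfolding dual_norm_def
proof (rule cSup_upper)
  obtain C where C: "\<And>u. u \<in> V \<Longrightarrow> norm (\<phi> u) \<le> C * N u" using assms(1) unfolding dual_space_def by blast
  show "bdd_above {norm (\<phi> u) | u. u \<in> V \<and> N u \<le> 1}"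
  proof (rule bdd_aboveI)
    fix t assume "t \<in> {norm (\<phi> u) | u. u \<in> V \<and> N u \<le> 1}"
    then obtain v where v: "v \<in> V" "N v \<le> 1" "t = norm (\<phi> v)" by blast
    have "t \<le> C * N v" unfolding v(3) by (rule C[OF v(1)])
    also have "\<dots> \<le> \<bar>C\<bar> * N v" by (intro mult_right_mono assms(4) v) simp
    also have "\<dots> \<le> \<bar>C\<bar> * 1" by (intro mult_left_mono v) simp
    finally show "t \<le> \<bar>C\<bar> * 1" .
  qed
qed (use assms in blast)

section \<open>Successive combination of the means and the bidual argument\<close>

context group begin

context
  fixes a d :: "nat \<Rightarrow> 'a" and m :: "nat \<Rightarrow> nat"
  assumes ad: "\<And>k. a k \<in> carrier G" "\<And>k. d k \<in> carrier G"
    and inj: "\<And>k. inj_on (\<lambda>j. d k [^] (j::nat)) {..<44 * m k}"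
    and m0: "\<And>k. 0 < m k"
    and growth: "\<And>j k. j < k \<Longrightarrow> 16 * 2 ^ k * real (44 * m j) \<le> sqrt (real (m k))"
begin

private abbreviation "w k x \<equiv> complex_of_real (fejer G (a k) (d k) (44 * m k) x)"

private abbreviation "c k \<equiv> progression_mean G (a k) (d k) (m k)"

text \<open>The new mean takes over at the new Fejer function, while its small l^2 norm leaves the
  values at the earlier ones almost unchanged.\<close>

private fun T :: "nat \<Rightarrow> 'a gelem" where
  "T 0 = c 0"
| "T (Suc k) = gcombine G (c (Suc k)) (T k)"

private lemma contraction_c: "contraction G (c k)"
  by (rule contraction_progression_mean[OF ad inj]) (use m0 in auto)

private lemma contraction_T: "contraction G (T k)"
  by (induction k) (auto intro: contraction_c contraction_gcombine)

private lemma w_B: "w k \<in> fourier_stieltjes_algebra G"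
  by (intro finitely_supported_fourier_stieltjes finitely_supported_fejer ad inj) (use m0 in simp)

private lemma norm_w: "fourier_stieltjes_norm G (w k) \<le> 1"
  by (intro fourier_stieltjes_norm_fejer ad inj) (use m0 in simp)

text \<open>\<open>pairing_gcombine\<close> with d = 1 and e = 1 / 44: the mean has 1 / 44 of the
  length of the progression, and the loss 11 / 44 leaves 3 / 4.\<close>

private lemma w_diagonal: "3 / 4 \<le> Re (pairing (w k) (T k))"
proof -
  have *: "1 - 1 / 44 \<le> Re (pairing (w k) (c k))"
    using pairing_fejer_progression_mean[OF ad inj, of k "m k"] m0[of k] by simp
  show ?thesis
  proof (cases k)
    case 0
    then show ?thesis using * by simp
  next
    case (Suc l)
    have "1 - 11 * (1 / 44) \<le> Re (pairing (w k) (gcombine G (c k) (T l)))"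
      by (rule pairing_gcombine[OF w_B contraction_c contraction_T _ *]) (use norm_w[of k] in simp)
    then show ?thesis using Suc by simp
  qed
qed

text \<open>The change is at most 4 times the l^2 norm of the new mean times the absolute sum 44
  m_j; the factor 16 of the growth condition makes this at most a quarter of 1 / 2^(k + 1).\<close>

private lemma w_step:
  assumes "j \<le> k"
  shows "Re (pairing (w j) (T k)) - 1 / (4 * 2 ^ Suc k) \<le> Re (pairing (w j) (T (Suc k)))"
proof -
  let ?S = "fejer_support G (a j) (d j) (44 * m j)"
  have n: "0 < 44 * m j" using m0 by simp
  have "(\<Sum>x\<in>{x. w j x \<noteq> 0}. norm (w j x)) \<le> (\<Sum>x\<in>?S. norm (w j x))"
    by (rule sum_mono2) (use fejer_outside[OF ad inj n] finite_fejer_support[OF ad inj n] in auto)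
  also have "\<dots> = real (44 * m j)"
    using sum_fejer[OF ad inj n] fejer_nonneg[OF ad inj n] by simp
  finally have S: "(\<Sum>x\<in>{x. w j x \<noteq> 0}. norm (w j x)) \<le> real (44 * m j)" .
  have l: "l2norm (c (Suc k)) = 1 / sqrt (real (m (Suc k)))"
    by (rule l2norm_progression_mean[OF ad inj]) (use m0 in auto)
  have p: "0 < sqrt (real (m (Suc k)))" using m0 by simp
  have "norm (pairing (w j) (T (Suc k)) - pairing (w j) (T k))
      \<le> 4 * l2norm (c (Suc k)) * (\<Sum>x\<in>{x. w j x \<noteq> 0}. norm (w j x))"
    unfolding T.simps by (intro pairing_gcombine_close finitely_supported_fejer ad inj contraction_c
        contraction_T n)
  also have "\<dots> \<le> 4 * l2norm (c (Suc k)) * real (44 * m j)"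
    by (rule mult_left_mono[OF S]) (simp add: l)
  also have "\<dots> \<le> 1 / (4 * 2 ^ Suc k)"
    using growth[of j "Suc k"] assms p unfolding l by (simp add: field_simps)
  finally have "\<bar>Re (pairing (w j) (T (Suc k)) - pairing (w j) (T k))\<bar> \<le> 1 / (4 * 2 ^ Suc k)"
    using abs_Re_le_cmod order_trans by blast
  then show ?thesis by simp
qed

text \<open>The losses after index j form a geometric series with sum at most 1 / 4, taken off the 3
  / 4 on the diagonal.\<close>

private lemma w_T: 
  assumes "j \<le> k" shows "1 / 2 \<le> Re (pairing (w j) (T k))"
proof -
  have "3 / 4 - (1 / 4) * (1 / 2 ^ j - 1 / 2 ^ (j + i)) \<le> Re (pairing (w j) (T (j + i)))" for i
  proof (induction i)
    case 0
    then show ?case using w_diagonal by simp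
  next
    case (Suc i)
    define q :: real where "q = 1 / 2 ^ (j + i)"
    have e: "(1::real) / 2 ^ Suc (j + i) = q / 2" "1 / (4 * 2 ^ Suc (j + i)) = q / 8"
      by (simp_all add: q_def)
    have "Re (pairing (w j) (T (j + i))) - q / 8 \<le> Re (pairing (w j) (T (Suc (j + i))))"
      unfolding e(2)[symmetric] by (rule w_step) simp
    moreover have "3 / 4 - (1 / 4) * (1 / 2 ^ j - q) \<le> Re (pairing (w j) (T (j + i)))"
      using Suc unfolding q_def .
    moreover have "3 / 4 - (1 / 4) * (A - q / 2) \<le> R'"
      if "R - q / 8 \<le> R'" "3 / 4 - (1 / 4) * (A - q) \<le> R" for R R' A
      using that by argo
    ultimately show ?case unfolding add_Suc_right e(1) by blast
  qed
  from this[of "k - j"] have "3 / 4 - (1 / 4) * (1 / 2 ^ j - 1 / 2 ^ k) \<le> Re (pairing (w j) (T k))"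
    using assms by simp
  moreover have "(1::real) / 2 ^ j \<le> 1" "0 \<le> 1 / (2::real) ^ k" by simp_all
  moreover have "1 / 2 \<le> R" if "3 / 4 - (1 / 4) * (x - y) \<le> R" "x \<le> 1" "0 \<le> y" for R x y :: real
    using that by argo
  ultimately show ?thesis by blast
qed

text \<open>Reflexivity would give a u that represents the bidual limit of the Fejer functions.
  Point evaluations show u = 0, as each point lies in finitely many supports; but the limit
  \<open>\<phi>0\<close> of the functionals given by T has real part at least 1 / 2 at every Fejer
  function, hence at the bidual limit.\<close>

theorem not_reflexive_criterion:
  assumes E: "\<And>k. fejer_support G (a k) (d k) (44 * m k) \<subseteq> E"
    and fin: "\<And>x. finite {k. x \<in> fejer_support G (a k) (d k) (44 * m k)}"
  shows "\<not> reflexive_space (fourier_supported G E) (fourier_stieltjes_norm G)"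
proof
  let ?N = "fourier_stieltjes_norm G"
  define V where "V = fourier_supported G E"
  define D where "D = dual_space V ?N"
  assume "reflexive_space (fourier_supported G E) ?N"
  then have refl: "\<And>\<Phi>. \<Phi> \<in> dual_space D (dual_norm V ?N) \<Longrightarrow> \<exists>u\<in>V. \<forall>\<phi>\<in>D. \<Phi> \<phi> = \<phi> u"
    unfolding reflexive_space_def V_def D_def by blast
  have n: "0 < 44 * m k" for k using m0 by simp
  have VB: "u \<in> fourier_stieltjes_algebra G" if "u \<in> V" for u
    using that unfolding V_def fourier_supported_def fourier_algebra_def by simp
  have wV: "w k \<in> V" for k
  proof -
    have "w k x = 0" if "x \<in> carrier G - E" for x
    proof -
      have "x \<notin> fejer_support G (a k) (d k) (44 * m k)" using that E[of k] by auto
      from fejer_outside[OF ad inj n this] show ?thesis by simp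
    qed
    then show ?thesis
      using finitely_supported_fourier_algebra[OF finitely_supported_fejer[OF ad inj n], of k]
      unfolding V_def fourier_supported_def by simp
  qed
  obtain L :: "(nat \<Rightarrow> complex) \<Rightarrow> complex" where
    add: "\<And>s t. Bseq s \<Longrightarrow> Bseq t \<Longrightarrow> L (\<lambda>n. s n + t n) = L s + L t"
    and mul: "\<And>c s. Bseq s \<Longrightarrow> L (\<lambda>n. c * s n) = c * L s"
    and bound: "\<And>s C. (\<And>n. norm (s n) \<le> C) \<Longrightarrow> norm (L s) \<le> 2 * C"
    and lower: "\<And>s c. Bseq s \<Longrightarrow> \<forall>\<^sub>F n in sequentially. c \<le> Re (s n) \<Longrightarrow> c \<le> Re (L s)"
    and zero: "\<And>s. Bseq s \<Longrightarrow> \<forall>\<^sub>F n in sequentially. s n = 0 \<Longrightarrow> L s = 0"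
    by (fact generalized_limit_complex)
  define \<phi>0 where "\<phi>0 = (\<lambda>u. if u \<in> V then L (\<lambda>k. pairing u (T k)) else 0)"
  have pT: "norm (pairing u (T k)) \<le> ?N u" if "u \<in> V" for u k
    by (rule fourier_stieltjes_norm_upper[OF VB[OF that] contraction_T])
  have BT: "Bseq (\<lambda>k. pairing u (T k))" if "u \<in> V" for u
    by (rule BseqI'[of _ "?N u"]) (rule pT[OF that])
  have \<phi>0: "\<phi>0 \<in> D"
    unfolding D_def dual_space_def
  proof (intro CollectI conjI ballI allI impI)
    fix u v assume u: "u \<in> V" and v: "v \<in> V"
    have "(\<lambda>x. u x + v x) \<in> V" using u v unfolding V_def by (rule fourier_supported_add)
    then show "\<phi>0 (\<lambda>x. u x + v x) = \<phi>0 u + \<phi>0 v"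
      using u v add[OF BT[OF u] BT[OF v]] by (simp add: \<phi>0_def pairing_add)
  next
    fix b u assume u: "u \<in> V"
    have "(\<lambda>x. b * u x) \<in> V" using u unfolding V_def by (rule fourier_supported_cmult)
    then show "\<phi>0 (\<lambda>x. b * u x) = b * \<phi>0 u"
      using u mul[OF BT[OF u]] by (simp add: \<phi>0_def pairing_cmult)
  next
    show "\<exists>C. \<forall>u\<in>V. norm (\<phi>0 u) \<le> C * ?N u"
    proof (intro exI[of _ 2] ballI)
      fix u assume u: "u \<in> V"
      then show "norm (\<phi>0 u) \<le> 2 * ?N u" using bound[of "\<lambda>k. pairing u (T k)", OF pT[OF u]] by (simp add: \<phi>0_def)
    qed
  qed (simp add: \<phi>0_def)
  define \<Phi> where "\<Phi> = (\<lambda>\<phi>. if \<phi> \<in> D then L (\<lambda>k. \<phi> (w k)) else 0)"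
  have dw: "norm (\<phi> (w k)) \<le> dual_norm V ?N \<phi>" if "\<phi> \<in> D" for \<phi> k
    by (rule dual_norm_upper[OF that[unfolded D_def] wV norm_w])
      (rule fourier_stieltjes_norm_nonneg[OF VB])
  have Bw: "Bseq (\<lambda>k. \<phi> (w k))" if "\<phi> \<in> D" for \<phi>
    by (rule BseqI'[of _ "dual_norm V ?N \<phi>"]) (rule dw[OF that])
  have "\<Phi> \<in> dual_space D (dual_norm V ?N)"
    unfolding dual_space_def[of D]
  proof (intro CollectI conjI ballI allI impI)
    fix \<phi> \<psi> assume u: "\<phi> \<in> D" and v: "\<psi> \<in> D"
    have "(\<lambda>u. \<phi> u + \<psi> u) \<in> D" using u v unfolding D_def by (rule dual_space_add)
    then show "\<Phi> (\<lambda>x. \<phi> x + \<psi> x) = \<Phi> \<phi> + \<Phi> \<psi>"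
      using u v add[OF Bw[OF u] Bw[OF v]] by (simp add: \<Phi>_def)
  next
    fix b \<phi> assume u: "\<phi> \<in> D"
    have "(\<lambda>x. b * \<phi> x) \<in> D" using u unfolding D_def by (rule dual_space_cmult)
    then show "\<Phi> (\<lambda>x. b * \<phi> x) = b * \<Phi> \<phi>"
      using u mul[OF Bw[OF u]] by (simp add: \<Phi>_def)
  next
    show "\<exists>C. \<forall>\<phi>\<in>D. norm (\<Phi> \<phi>) \<le> C * dual_norm V ?N \<phi>"
    proof (intro exI[of _ 2] ballI)
      fix \<phi> assume u: "\<phi> \<in> D"
      then show "norm (\<Phi> \<phi>) \<le> 2 * dual_norm V ?N \<phi>"
        using bound[of "\<lambda>k. \<phi> (w k)", OF dw[OF u]] by (simp add: \<Phi>_def)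
    qed
  qed (simp add: \<Phi>_def)
  from refl[OF this] obtain u where u: "u \<in> V" "\<And>\<phi>. \<phi> \<in> D \<Longrightarrow> \<Phi> \<phi> = \<phi> u" by blast
  have "u x = 0" for x
  proof (cases "x \<in> carrier G")
    case False
    then show ?thesis by (rule fourier_stieltjes_group_function[OF VB[OF u(1)]])
  next
    case True
    define ev where "ev = (\<lambda>v. if v \<in> V then v x else 0)"
    have "ev \<in> D"
      unfolding D_def dual_space_def
    proof (intro CollectI conjI ballI allI impI)
      fix u v assume u: "u \<in> V" and v: "v \<in> V"
      have "(\<lambda>x. u x + v x) \<in> V" using u v unfolding V_def by (rule fourier_supported_add)
      then show "ev (\<lambda>x. u x + v x) = ev u + ev v" using u v by (simp add: ev_def)
    next
      fix b u assume u: "u \<in> V"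
      have "(\<lambda>x. b * u x) \<in> V" using u unfolding V_def by (rule fourier_supported_cmult)
      then show "ev (\<lambda>x. b * u x) = b * ev u" using u by (simp add: ev_def)
    next
      show "\<exists>C. \<forall>v\<in>V. norm (ev v) \<le> C * ?N v"
        using norm_le_fourier_stieltjes_norm[OF VB True] by (intro exI[of _ 1]) (simp add: ev_def)
    qed (simp add: ev_def)
    then have "u x = L (\<lambda>k. ev (w k))" using u(2)[of ev] u(1) by (simp add: ev_def \<Phi>_def)
    also have "\<dots> = 0"
    proof (rule zero[OF Bw[OF \<open>ev \<in> D\<close>]])
      obtain M where M: "\<forall>k\<in>{k. x \<in> fejer_support G (a k) (d k) (44 * m k)}. k \<le> M"
        using fin[of x] unfolding finite_nat_set_iff_bounded_le by blast
      have "ev (w k) = 0" if "Suc M \<le> k" for k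
      proof -
        have "x \<notin> fejer_support G (a k) (d k) (44 * m k)" using M that by auto
        from fejer_outside[OF ad inj n this] show ?thesis by (simp add: ev_def)
      qed
      then show "\<forall>\<^sub>F k in sequentially. ev (w k) = 0" unfolding eventually_sequentially by blast
    qed
    finally show ?thesis .
  qed
  then have "u = (\<lambda>x. 0)" by blast
  then have "\<Phi> \<phi>0 = L (\<lambda>k. 0)" using u(2)[OF \<phi>0] u(1) by (simp add: \<phi>0_def)
  also have "\<dots> = 0" by (rule zero) (auto intro: Bfun_const)
  finally have "\<Phi> \<phi>0 = 0" .
  moreover have "1 / 2 \<le> Re (\<Phi> \<phi>0)"
  proof -
    have "1 / 2 \<le> Re (\<phi>0 (w j))" for j
    proof -
      have "\<forall>\<^sub>F k in sequentially. 1 / 2 \<le> Re (pairing (w j) (T k))"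
        using w_T[of j] unfolding eventually_sequentially by blast
      from lower[OF BT[OF wV] this] show ?thesis using wV by (simp add: \<phi>0_def)
    qed
    then have "\<forall>\<^sub>F j in sequentially. 1 / 2 \<le> Re (\<phi>0 (w j))" by simp
    from lower[OF Bw[OF \<phi>0] this] show ?thesis using \<phi>0 by (simp add: \<Phi>_def)
  qed
  ultimately show False by simp
qed

end

end

section \<open>Haar functionals on metrizable locally compact groups\<close>

text \<open>The metric only presents the topology and is not assumed invariant; it lets sequences
  decide compactness and continuity.\<close>

locale metrizable_lc_group = group K + Metric_space "carrier K" d
  for K :: "('b, 'n) monoid_scheme" (structure) and d :: "'b \<Rightarrow> 'b \<Rightarrow> real" +
  assumes topgroup: "topological_group K mtopology"
    and loc_compact: "locally_compact_space mtopology"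
begin

lemma limitin_mult:
  assumes "limitin mtopology s a sequentially" "limitin mtopology t b sequentially"
  shows "limitin mtopology (\<lambda>n. s n \<otimes> t n) (a \<otimes> b) sequentially"
proof -
  have c: "continuous_map (prod_topology mtopology mtopology) mtopology (\<lambda>(x, y). x \<otimes> y)"
    using topgroup unfolding topological_group_def by simp
  have "limitin (prod_topology mtopology mtopology) (\<lambda>n. (s n, t n)) (a, b) sequentially"
    unfolding limitin_pairwise using assms by (simp add: o_def)
  from continuous_map_limit[OF c this] show ?thesis by (simp add: o_def)
qed

lemma limitin_inv:
  assumes "limitin mtopology s a sequentially"
  shows "limitin mtopology (\<lambda>n. inv (s n)) (inv a) sequentially"
proof -
  have c: "continuous_map mtopology mtopology (\<lambda>x. inv x)"
    using topgroup unfolding topological_group_def by simp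
  from continuous_map_limit[OF c assms] show ?thesis by (simp add: o_def)
qed

lemma continuous_map_translate:
  assumes "s \<in> carrier K" shows "continuous_map mtopology mtopology (\<lambda>x. s \<otimes> x)"
proof -
  have c: "continuous_map (prod_topology mtopology mtopology) mtopology (\<lambda>(x, y). x \<otimes> y)"
    using topgroup unfolding topological_group_def by simp
  have "continuous_map mtopology (prod_topology mtopology mtopology) (\<lambda>x. (s, x))"
    by (intro continuous_map_pairedI) (use assms in auto)
  from continuous_map_compose[OF this c] show ?thesis by (simp add: o_def)
qed

lemma continuous_map_inverse: "continuous_map mtopology mtopology (\<lambda>x. inv x)"
  using topgroup unfolding topological_group_def by simp

text \<open>A countable base at the identity. Since d is not invariant, closeness of x and y is
  expressed by \<open>inv x \<otimes> y \<in> nbhd n\<close> and not by d x y.\<close>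

definition nbhd :: "nat \<Rightarrow> 'b set" where
  "nbhd n = mball \<one> (1 / (real n + 1))"

lemma one_nbhd: "\<one> \<in> nbhd n"
  unfolding nbhd_def by simp

lemma nbhd_mono: "m \<le> n \<Longrightarrow> nbhd n \<subseteq> nbhd m"
  unfolding nbhd_def by (rule mball_subset_concentric) (simp add: frac_le)

lemma limitin_nbhd:
  assumes "\<And>n. b n \<in> nbhd n"
  shows "limitin mtopology b \<one> sequentially"
  unfolding limitin_metric
proof (intro conjI allI impI)
  fix e :: real assume e: "0 < e"
  obtain N where N: "1 / (real N + 1) < e"
    using reals_Archimedean[OF e] by (auto simp: inverse_eq_divide add.commute)
  have "b n \<in> carrier K \<and> d (b n) \<one> < e" if "N \<le> n" for n
  proof -
    have "b n \<in> nbhd N" using assms[of n] nbhd_mono[OF that] by auto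
    then show ?thesis using N unfolding nbhd_def by (auto simp: commute)
  qed
  then show "\<forall>\<^sub>F n in sequentially. b n \<in> carrier K \<and> d (b n) \<one> < e"
    unfolding eventually_sequentially by blast
qed simp

text \<open>Functions on \<open>K\<close> are only looked at on the carrier.\<close>

definition CC :: "('b \<Rightarrow> real) set" where
  "CC = {f. continuous_map mtopology euclideanreal f \<and> (\<forall>x\<in>carrier K. 0 \<le> f x) \<and>
     (\<exists>S. compactin mtopology S \<and> (\<forall>x\<in>carrier K - S. f x = 0))}"

text \<open>Additivity of the Haar functional is proved on the smaller cone \<open>CC\<close>; the
  larger one also holds indicators of compact sets and small balls, which serve as error terms and
  as normaliser.\<close>

definition BC :: "('b \<Rightarrow> real) set" where
  "BC = {f. (\<forall>x\<in>carrier K. 0 \<le> f x) \<and> (\<exists>M. \<forall>x\<in>carrier K. f x \<le> M) \<and>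
     (\<exists>S. compactin mtopology S \<and> (\<forall>x\<in>carrier K - S. f x = 0))}"

lemma BC_I:
  assumes "\<And>x. x \<in> carrier K \<Longrightarrow> 0 \<le> f x" "\<And>x. x \<in> carrier K \<Longrightarrow> f x \<le> M"
    "compactin mtopology S" "\<And>x. x \<in> carrier K - S \<Longrightarrow> f x = 0"
  shows "f \<in> BC"
  unfolding BC_def using assms by blast

text \<open>In a sequence of counterexamples one of the two points lies in the compact S. Along a
  convergent subsequence both points have the same limit, as their quotients tend to 1.\<close>

lemma uniform_continuity:
  assumes f: "continuous_map mtopology euclideanreal f" and S: "compactin mtopology S"
    and off: "\<And>x. x \<in> carrier K - S \<Longrightarrow> f x = 0" and e: "0 < (e::real)"
  obtains n where "\<And>x y. x \<in> carrier K \<Longrightarrow> y \<in> carrier K \<Longrightarrow> inv x \<otimes> y \<in> nbhd n \<Longrightarrow> \<bar>f x - f y\<bar> < e"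
proof (rule ccontr)
  assume "\<not> thesis"
  then have "\<exists>x y. x \<in> carrier K \<and> y \<in> carrier K \<and> inv x \<otimes> y \<in> nbhd n \<and> e \<le> \<bar>f x - f y\<bar>" for n
    using that[of n] not_le by blast
  then obtain x y where xy: "\<And>n. x n \<in> carrier K" "\<And>n. y n \<in> carrier K"
    "\<And>n. inv (x n) \<otimes> y n \<in> nbhd n" "\<And>n. e \<le> \<bar>f (x n) - f (y n)\<bar>" by metis
  define b where "b = (\<lambda>n. inv (x n) \<otimes> y n)"
  have b: "limitin mtopology b \<one> sequentially" unfolding b_def by (rule limitin_nbhd[OF xy(3)])
  have bc: "b n \<in> carrier K" for n unfolding b_def using xy by simp
  \<comment> \<open>\<open>z n\<close> is the point that lies in S, and
    \<open>z n \<otimes> g n\<close> is the other one.\<close>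
  define z where "z = (\<lambda>n. if x n \<in> S then x n else y n)"
  define g where "g = (\<lambda>n. if x n \<in> S then b n else inv (b n))"
  have zS: "z n \<in> S" for n
  proof (rule ccontr)
    assume "z n \<notin> S"
    then have "f (x n) = 0" "f (y n) = 0"
      using off[of "x n"] off[of "y n"] xy(1,2)[of n] by (auto simp: z_def split: if_splits)
    then show False using xy(4)[of n] e by simp
  qed
  have zg: "e \<le> \<bar>f (z n) - f (z n \<otimes> g n)\<bar>" for n
  proof (cases "x n \<in> S")
    case True
    have "x n \<otimes> b n = y n" using xy(1,2)[of n] by (simp add: b_def m_assoc[symmetric])
    then show ?thesis using True xy(4)[of n] by (simp add: z_def g_def)
  next
    case False
    have "y n \<otimes> inv (b n) = x n" using xy(1,2)[of n] by (simp add: b_def inv_mult_group m_assoc[symmetric])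
    then show ?thesis using False xy(4)[of n] by (simp add: z_def g_def abs_minus_commute)
  qed
  have "limitin mtopology (\<lambda>n. inv (b n)) (inv \<one>) sequentially" by (rule limitin_inv[OF b])
  then have ib: "limitin mtopology (\<lambda>n. inv (b n)) \<one> sequentially" by simp
  have g: "limitin mtopology g \<one> sequentially"
    unfolding limitin_metric
  proof (intro conjI allI impI)
    fix r :: real assume r: "0 < r"
    have "\<forall>\<^sub>F n in sequentially. b n \<in> carrier K \<and> d (b n) \<one> < r"
      "\<forall>\<^sub>F n in sequentially. inv (b n) \<in> carrier K \<and> d (inv (b n)) \<one> < r"
      using b ib r unfolding limitin_metric by auto
    then show "\<forall>\<^sub>F n in sequentially. g n \<in> carrier K \<and> d (g n) \<one> < r"
      by eventually_elim (auto simp: g_def)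
  qed simp
  obtain l r where r: "strict_mono (r::nat \<Rightarrow> nat)" "limitin mtopology (z \<circ> r) l sequentially"
    using S zS unfolding compactin_sequentially by (metis image_subset_iff)
  have gr: "limitin mtopology (g \<circ> r) \<one> sequentially" by (rule limitin_subsequence[OF r(1) g])
  have lc: "l \<in> carrier K" using limitin_mspace[OF r(2)] .
  have 1: "(\<lambda>n. f (z (r n))) \<longlonglongrightarrow> f l"
    using continuous_map_limit[OF f r(2)] by (simp add: o_def)
  have "limitin mtopology (\<lambda>n. z (r n) \<otimes> g (r n)) (l \<otimes> \<one>) sequentially"
    using limitin_mult[OF r(2) gr] by (simp add: o_def)
  from continuous_map_limit[OF f this] have 2: "(\<lambda>n. f (z (r n) \<otimes> g (r n))) \<longlonglongrightarrow> f l"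
    using lc by (simp add: o_def)
  have "(\<lambda>n. \<bar>f (z (r n)) - f (z (r n) \<otimes> g (r n))\<bar>) \<longlonglongrightarrow> \<bar>f l - f l\<bar>"
    by (intro tendsto_intros 1 2)
  then have "e \<le> \<bar>f l - f l\<bar>"
    by (rule LIMSEQ_le_const) (use zg in auto)
  then show False using e by simp
qed

subsection \<open>Covering numbers\<close>

definition cover :: "nat \<Rightarrow> (real \<times> 'b) list \<Rightarrow> 'b \<Rightarrow> real" where
  "cover n xs y = (\<Sum>(c, x)\<leftarrow>xs. if inv x \<otimes> y \<in> nbhd n then c else 0)"

definition weights :: "(real \<times> 'b) list set" where
  "weights = {xs. \<forall>(c, x)\<in>set xs. 0 \<le> c \<and> x \<in> carrier K}"

definition total :: "(real \<times> 'b) list \<Rightarrow> real" where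
  "total xs = (\<Sum>(c, x)\<leftarrow>xs. c)"

definition covers :: "nat \<Rightarrow> (real \<times> 'b) list \<Rightarrow> ('b \<Rightarrow> real) \<Rightarrow> bool" where
  "covers n xs f \<longleftrightarrow> xs \<in> weights \<and> (\<forall>y\<in>carrier K. f y \<le> cover n xs y)"

text \<open>Haar's covering number (f : V) for V = \<open>nbhd n\<close>, with weighted left
  translates of the indicator of V.\<close>

definition cov :: "nat \<Rightarrow> ('b \<Rightarrow> real) \<Rightarrow> real" where
  "cov n f = Inf {total xs | xs. covers n xs f}"

lemma total_nonneg: "xs \<in> weights \<Longrightarrow> 0 \<le> total xs"
  unfolding total_def weights_def by (intro sum_list_nonneg) auto

lemma cover_nonneg: "xs \<in> weights \<Longrightarrow> 0 \<le> cover n xs y"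
  unfolding cover_def weights_def by (intro sum_list_nonneg) auto

lemma cover_le_total: "xs \<in> weights \<Longrightarrow> cover n xs y \<le> total xs"
  unfolding cover_def total_def weights_def by (intro sum_list_mono) auto

lemma covers_append: "covers n xs f \<Longrightarrow> covers n ys g \<Longrightarrow> covers n (xs @ ys) (\<lambda>x. f x + g x)"
  unfolding covers_def weights_def cover_def by (auto intro: add_mono)

lemma total_append: "total (xs @ ys) = total xs + total ys"
  by (simp add: total_def)

lemma covers_scale:
  assumes "covers n xs f" "0 \<le> a"
  shows "covers n (map (\<lambda>(c, x). (a * c, x)) xs) (\<lambda>x. a * f x)"
    "total (map (\<lambda>(c, x). (a * c, x)) xs) = a * total xs"
proof -
  have "cover n (map (\<lambda>(c, x). (a * c, x)) xs) y = a * cover n xs y" for y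
    by (induction xs) (auto simp: cover_def distrib_left)
  then show "covers n (map (\<lambda>(c, x). (a * c, x)) xs) (\<lambda>x. a * f x)"
    using assms unfolding covers_def weights_def by (auto intro: mult_left_mono)
  show "total (map (\<lambda>(c, x). (a * c, x)) xs) = a * total xs"
    by (induction xs) (auto simp: total_def distrib_left)
qed

lemma covers_translate:
  assumes "covers n xs f" "s \<in> carrier K"
  shows "covers n (map (\<lambda>(c, x). (c, s \<otimes> x)) xs) (\<lambda>y. f (inv s \<otimes> y))"
    "total (map (\<lambda>(c, x). (c, s \<otimes> x)) xs) = total xs"
proof -
  have "cover n (map (\<lambda>(c, x). (c, s \<otimes> x)) xs) y = cover n xs (inv s \<otimes> y)"
    if "y \<in> carrier K" "xs \<in> weights" for y xs
    using that assms(2)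
    by (induction xs) (auto simp: cover_def weights_def inv_mult_group m_assoc)
  then show "covers n (map (\<lambda>(c, x). (c, s \<otimes> x)) xs) (\<lambda>y. f (inv s \<otimes> y))"
    using assms unfolding covers_def by (auto simp: weights_def)
  show "total (map (\<lambda>(c, x). (c, s \<otimes> x)) xs) = total xs"
    by (induction xs) (auto simp: total_def)
qed

lemma finite_translate_cover:
  assumes S: "compactin mtopology S" and U: "openin mtopology U" "\<one> \<in> U"
  obtains xs where "set xs \<subseteq> carrier K" "\<And>y. y \<in> S \<Longrightarrow> \<exists>x\<in>set xs. inv x \<otimes> y \<in> U"
proof -
  have SK: "S \<subseteq> carrier K" using compactin_subset_topspace[OF S] by simp
  define W where "W = (\<lambda>x. {y \<in> carrier K. inv x \<otimes> y \<in> U})"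
  have W: "openin mtopology (W x)" if "x \<in> carrier K" for x
    using openin_continuous_map_preimage[OF continuous_map_translate U(1), of "inv x"] that
    by (simp add: W_def)
  have "x \<in> W x" if "x \<in> S" for x using SK U(2) that by (auto simp: W_def subset_iff)
  then have "S \<subseteq> \<Union> (W ` S)" by blast
  moreover have "\<forall>V\<in>W ` S. openin mtopology V" using W SK by auto
  ultimately obtain F where F: "finite F" "F \<subseteq> W ` S" "S \<subseteq> \<Union> F"
    using S unfolding compactin_def by meson
  obtain C where C: "finite C" "C \<subseteq> S" "F = W ` C" using finite_subset_image[OF F(1,2)] by blast
  obtain xs where xs: "set xs = C" using finite_list[OF C(1)] by blast
  show thesis
    by (rule that[of xs]) (use xs C F SK in \<open>auto simp: W_def\<close>)
qed

lemma openin_nbhd: "openin mtopology (nbhd n)"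
  unfolding nbhd_def by simp

lemma covers_exists:
  assumes "f \<in> BC" obtains xs where "covers n xs f"
proof -
  obtain M S where M: "\<And>x. x \<in> carrier K \<Longrightarrow> f x \<le> M" and S: "compactin mtopology S"
    "\<And>x. x \<in> carrier K - S \<Longrightarrow> f x = 0" using assms unfolding BC_def by blast
  obtain xs where xs: "set xs \<subseteq> carrier K" "\<And>y. y \<in> S \<Longrightarrow> \<exists>x\<in>set xs. inv x \<otimes> y \<in> nbhd n"
    by (fact finite_translate_cover[OF S(1) openin_nbhd[of n] one_nbhd])
  let ?xs = "map (\<lambda>x. (\<bar>M\<bar>, x)) xs"
  have w: "?xs \<in> weights" using xs(1) by (auto simp: weights_def)
  have "f y \<le> cover n ?xs y" if y: "y \<in> carrier K" for y
  proof (cases "y \<in> S")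
    case True
    then obtain x where x: "x \<in> set xs" "inv x \<otimes> y \<in> nbhd n" using xs(2) by blast
    have "f y \<le> (if inv x \<otimes> y \<in> nbhd n then \<bar>M\<bar> else 0)" using M[OF y] x by simp
    also have "\<dots> \<le> (\<Sum>x\<leftarrow>xs. if inv x \<otimes> y \<in> nbhd n then \<bar>M\<bar> else 0)"
      by (rule member_le_sum_list) (use x in auto)
    finally show ?thesis by (simp add: cover_def o_def)
  next
    case False
    then show ?thesis using S(2)[of y] y cover_nonneg[OF w] by simp
  qed
  then show thesis using w that unfolding covers_def by blast
qed

lemma cov_le: "covers n xs f \<Longrightarrow> cov n f \<le> total xs"
  unfolding cov_def
  by (rule cInf_lower) (auto intro!: bdd_belowI[of _ 0] total_nonneg simp: covers_def)

lemma cov_ge: "f \<in> BC \<Longrightarrow> (\<And>xs. covers n xs f \<Longrightarrow> a \<le> total xs) \<Longrightarrow> a \<le> cov n f"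
  unfolding cov_def
  by (rule cInf_greatest) (use covers_exists[of f n] in auto)

lemma cov_nonneg: "f \<in> BC \<Longrightarrow> 0 \<le> cov n f"
  by (rule cov_ge) (auto intro: total_nonneg simp: covers_def)

lemma cov_add:
  assumes "f \<in> BC" "g \<in> BC"
  shows "cov n (\<lambda>x. f x + g x) \<le> cov n f + cov n g"
proof -
  have *: "cov n (\<lambda>x. f x + g x) \<le> total xs + total ys" if "covers n xs f" "covers n ys g" for xs ys
    using cov_le[OF covers_append[OF that]] by (simp add: total_append)
  have "cov n (\<lambda>x. f x + g x) - total ys \<le> cov n f" if "covers n ys g" for ys
    by (rule cov_ge[OF assms(1)]) (use *[OF _ that] in \<open>simp add: diff_le_eq\<close>)
  then have "cov n (\<lambda>x. f x + g x) - cov n f \<le> cov n g"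
    by (intro cov_ge[OF assms(2)]) (simp add: diff_le_eq add.commute)
  then show ?thesis by simp
qed

lemma cov_mono:
  assumes "g \<in> BC" "\<And>x. x \<in> carrier K \<Longrightarrow> f x \<le> g x"
  shows "cov n f \<le> cov n g"
proof (rule cov_ge[OF assms(1)])
  fix xs assume "covers n xs g"
  then have "covers n xs f" using assms(2) unfolding covers_def by (meson order_trans)
  then show "cov n f \<le> total xs" by (rule cov_le)
qed

lemma cov_scale_le:
  assumes "f \<in> BC" "0 < a" shows "cov n (\<lambda>x. a * f x) \<le> a * cov n f"
proof -
  have "cov n (\<lambda>x. a * f x) / a \<le> cov n f"
  proof (rule cov_ge[OF assms(1)])
    fix xs assume xs: "covers n xs f"
    show "cov n (\<lambda>x. a * f x) / a \<le> total xs"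
      using cov_le[OF covers_scale(1)[OF xs, of a]] covers_scale(2)[OF xs, of a] assms(2)
      by (simp add: field_simps)
  qed
  then show ?thesis using assms(2) by (simp add: field_simps)
qed

lemma BC_scale:
  assumes "f \<in> BC" "0 \<le> a" shows "(\<lambda>x. a * f x) \<in> BC"
proof -
  obtain M S where f: "\<And>x. x \<in> carrier K \<Longrightarrow> 0 \<le> f x \<and> f x \<le> M" "compactin mtopology S"
    "\<And>x. x \<in> carrier K - S \<Longrightarrow> f x = 0" using assms unfolding BC_def by blast
  show ?thesis
  proof (rule BC_I[OF _ _ f(2)])
    fix x assume "x \<in> carrier K"
    from f(1)[OF this] show "0 \<le> a * f x" "a * f x \<le> a * M"
      using assms(2) by (auto intro: mult_left_mono)
  qed (use f(3) in simp)
qed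

lemma BC_add:
  assumes "f \<in> BC" "g \<in> BC" shows "(\<lambda>x. f x + g x) \<in> BC"
proof -
  obtain M S where f: "\<And>x. x \<in> carrier K \<Longrightarrow> 0 \<le> f x \<and> f x \<le> M" "compactin mtopology S"
    "\<And>x. x \<in> carrier K - S \<Longrightarrow> f x = 0" using assms unfolding BC_def by blast
  obtain N T where g: "\<And>x. x \<in> carrier K \<Longrightarrow> 0 \<le> g x \<and> g x \<le> N" "compactin mtopology T"
    "\<And>x. x \<in> carrier K - T \<Longrightarrow> g x = 0" using assms unfolding BC_def by blast
  have "f x + g x \<le> M + N" if "x \<in> carrier K" for x using f(1)[OF that] g(1)[OF that] by simp
  moreover have "compactin mtopology (S \<union> T)" by (rule compactin_Un[OF f(2) g(2)])
  moreover have "f x + g x = 0" if "x \<in> carrier K - (S \<union> T)" for x using f(3)[of x] g(3)[of x] that by simp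
  moreover have "0 \<le> f x + g x" if "x \<in> carrier K" for x using f(1)[OF that] g(1)[OF that] by simp
  ultimately show ?thesis by (rule BC_I[rotated])
qed

lemma compactin_translate:
  assumes "compactin mtopology S" "s \<in> carrier K"
  shows "compactin mtopology ((\<lambda>x. s \<otimes> x) ` S)"
  by (rule image_compactin[OF assms(1) continuous_map_translate[OF assms(2)]])

lemma BC_translate:
  assumes "f \<in> BC" "s \<in> carrier K" shows "(\<lambda>x. f (inv s \<otimes> x)) \<in> BC"
proof -
  obtain M S where f: "\<And>x. x \<in> carrier K \<Longrightarrow> 0 \<le> f x \<and> f x \<le> M" "compactin mtopology S"
    "\<And>x. x \<in> carrier K - S \<Longrightarrow> f x = 0" using assms unfolding BC_def by blast
  have "f (inv s \<otimes> x) = 0" if "x \<in> carrier K - (\<lambda>x. s \<otimes> x) ` S" for x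
  proof (rule f(3))
    have "x = s \<otimes> (inv s \<otimes> x)" using that assms(2) by (simp add: m_assoc[symmetric])
    then show "inv s \<otimes> x \<in> carrier K - S" using that assms(2) by auto
  qed
  moreover have "0 \<le> f (inv s \<otimes> x)" "f (inv s \<otimes> x) \<le> M" if "x \<in> carrier K" for x
    using f(1)[of "inv s \<otimes> x"] assms(2) that by auto
  ultimately show ?thesis
    by (intro BC_I[OF _ _ compactin_translate[OF f(2) assms(2)]])
qed

lemma cov_translate_le:
  assumes "f \<in> BC" "s \<in> carrier K"
  shows "cov n (\<lambda>x. f (inv s \<otimes> x)) \<le> cov n f"
proof (rule cov_ge[OF assms(1)])
  fix xs assume xs: "covers n xs f"
  show "cov n (\<lambda>x. f (inv s \<otimes> x)) \<le> total xs"
    using cov_le[OF covers_translate(1)[OF xs assms(2)]] covers_translate(2)[OF xs assms(2)] by simp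
qed

lemma CC_subset_BC: "f \<in> CC \<Longrightarrow> f \<in> BC"
proof -
  assume f: "f \<in> CC"
  then obtain S where S: "compactin mtopology S" "\<And>x. x \<in> carrier K - S \<Longrightarrow> f x = 0"
    and c: "continuous_map mtopology euclideanreal f" unfolding CC_def by blast
  have "compactin euclideanreal (f ` S)" by (rule image_compactin[OF S(1) c])
  then have "bounded (f ` S)" by (simp add: compact_imp_bounded)
  then obtain M where M: "\<And>x. x \<in> S \<Longrightarrow> \<bar>f x\<bar> \<le> M" unfolding bounded_iff by auto
  have "f x \<le> \<bar>M\<bar>" if "x \<in> carrier K" for x
    using M[of x] S(2)[of x] that by (cases "x \<in> S") auto
  then show "f \<in> BC" using f S unfolding BC_def CC_def by auto
qed

end

section \<open>The Haar functional as a generalised limit of covering ratios\<close>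

context metrizable_lc_group begin

context
  fixes r :: real and C :: "'b set" and L :: "(nat \<Rightarrow> real) \<Rightarrow> real"
  assumes r: "0 < r" and C: "compactin mtopology C" "mball \<one> r \<subseteq> C"
    and L: "limit_functional L"
begin

lemma L_add: "Bseq s \<Longrightarrow> Bseq t \<Longrightarrow> L (\<lambda>n. s n + t n) = L s + L t"
  and L_mul: "Bseq s \<Longrightarrow> L (\<lambda>n. c * s n) = c * L s"
  and L_lo: "Bseq s \<Longrightarrow> \<forall>\<^sub>F n in sequentially. c \<le> s n \<Longrightarrow> c \<le> L s"
  using L unfolding limit_functional_def by simp_all

lemma L_mono:
  assumes "Bseq s" "Bseq t" "\<forall>\<^sub>F n in sequentially. s n \<le> t n"
  shows "L s \<le> L t"
proof -
  have ms: "Bseq (\<lambda>n. -1 * s n)" by (rule Bseq_mult[OF Bfun_const assms(1)])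
  have "Bseq (\<lambda>n. t n + -1 * s n)" by (rule Bseq_plus[OF assms(2) ms])
  then have "0 \<le> L (\<lambda>n. t n + -1 * s n)"
    by (rule L_lo) (use assms(3) in \<open>auto elim: eventually_mono\<close>)
  then show ?thesis unfolding L_add[OF assms(2) ms] L_mul[OF assms(1)] by simp
qed

text \<open>The reference function of Haar's construction; its covering numbers are at least 1, so
  it is safe to divide by them.\<close>

definition unit_ball :: "'b \<Rightarrow> real" where
  "unit_ball x = (if x \<in> mball \<one> r then 1 else 0)"

lemma unit_ball_BC: "unit_ball \<in> BC"
  by (rule BC_I[OF _ _ C(1), of _ 1]) (use C in \<open>auto simp: unit_ball_def\<close>)

lemma cov_unit_ball: "1 \<le> cov n unit_ball"
proof (rule cov_ge[OF unit_ball_BC])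
  fix xs assume xs: "covers n xs unit_ball"
  have "1 \<le> cover n xs \<one>" using xs r unfolding covers_def unit_ball_def by (auto dest!: bspec[of _ _ \<one>])
  also have "\<dots> \<le> total xs" by (rule cover_le_total) (use xs in \<open>simp add: covers_def\<close>)
  finally show "1 \<le> total xs" .
qed

lemma cov_sum_translates:
  assumes g: "g \<in> BC" and xs: "set xs \<subseteq> carrier K"
  shows "(\<lambda>y. \<Sum>x\<leftarrow>xs. g (inv x \<otimes> y)) \<in> BC \<and>
    cov n (\<lambda>y. \<Sum>x\<leftarrow>xs. g (inv x \<otimes> y)) \<le> real (length xs) * cov n g"
  using xs
proof (induction xs)
  case Nil
  have z: "(\<lambda>y. 0) \<in> BC" using BC_scale[OF g, of 0] by simp
  moreover have "cov n (\<lambda>y. 0) \<le> total []"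
    by (rule cov_le) (simp add: covers_def weights_def cover_def)
  ultimately show ?case by (simp add: total_def)
next
  case (Cons x xs)
  have t: "(\<lambda>y. g (inv x \<otimes> y)) \<in> BC" using BC_translate[OF g] Cons.prems by simp
  have i: "(\<lambda>y. \<Sum>x\<leftarrow>xs. g (inv x \<otimes> y)) \<in> BC" using Cons by simp
  have "cov n (\<lambda>y. g (inv x \<otimes> y)) \<le> cov n g" using cov_translate_le[OF g] Cons.prems by simp
  then show ?case using cov_add[OF t i, of n] BC_add[OF t i] Cons by (simp add: algebra_simps)
qed

text \<open>Finitely many translates of g dominate f up to a factor. The point is that M does not
  depend on n: this bounds the ratios from above, and in \<open>haar_pos\<close> from below.\<close>

lemma cov_le_multiple:
  assumes f: "f \<in> BC" and g: "g \<in> BC" and U: "openin mtopology U" "\<one> \<in> U"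
    and e: "0 < e" "\<And>x. x \<in> U \<Longrightarrow> e \<le> g x"
  obtains M where "0 < M" "\<And>n. cov n f \<le> M * cov n g"
proof -
  obtain N S where N: "\<And>x. x \<in> carrier K \<Longrightarrow> f x \<le> N" and S: "compactin mtopology S"
    "\<And>x. x \<in> carrier K - S \<Longrightarrow> f x = 0" using f unfolding BC_def by blast
  obtain xs where xs: "set xs \<subseteq> carrier K" "\<And>y. y \<in> S \<Longrightarrow> \<exists>x\<in>set xs. inv x \<otimes> y \<in> U"
    by (fact finite_translate_cover[OF S(1) U])
  define M where "M = (\<bar>N\<bar> + 1) / e"
  have M: "0 < M" using e by (simp add: M_def)
  define G where "G = (\<lambda>y. \<Sum>x\<leftarrow>xs. g (inv x \<otimes> y))"
  have G: "G \<in> BC" "\<And>n. cov n G \<le> real (length xs) * cov n g"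
    using cov_sum_translates[OF g xs(1)] unfolding G_def by auto
  have fG: "f y \<le> M * G y" if y: "y \<in> carrier K" for y
  proof -
    have g0: "0 \<le> g (inv x \<otimes> y)" if "x \<in> set xs" for x
      using g xs(1) that y unfolding BC_def by auto
    show ?thesis
    proof (cases "y \<in> S")
      case True
      then obtain x where x: "x \<in> set xs" "inv x \<otimes> y \<in> U" using xs(2) by blast
      have "e \<le> g (inv x \<otimes> y)" by (rule e(2)[OF x(2)])
      also have "\<dots> \<le> G y" unfolding G_def by (rule member_le_sum_list) (use x g0 in auto)
      finally have "M * e \<le> M * G y" using M by simp
      moreover have "f y \<le> M * e" using N[OF y] e(1) by (simp add: M_def)
      ultimately show ?thesis by linarith
    next
      case False
      have "0 \<le> G y" unfolding G_def by (intro sum_list_nonneg) (use g0 in auto)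
      then show ?thesis using S(2)[of y] False y M by simp
    qed
  qed
  show thesis
  proof (rule that[of "M * (real (length xs) + 1)"])
    show "0 < M * (real (length xs) + 1)" using M by simp
    fix n
    have "cov n f \<le> cov n (\<lambda>y. M * G y)" by (rule cov_mono[OF BC_scale[OF G(1)]]) (use M fG in auto)
    also have "\<dots> \<le> M * cov n G" by (rule cov_scale_le[OF G(1) M])
    also have "\<dots> \<le> M * (real (length xs) * cov n g)" using G(2)[of n] M by simp
    also have "\<dots> \<le> M * ((real (length xs) + 1) * cov n g)"
      using M cov_nonneg[OF g, of n] by (intro mult_left_mono mult_right_mono) auto
    finally show "cov n f \<le> M * (real (length xs) + 1) * cov n g" by (simp add: mult.assoc)
  qed
qed

definition ratio :: "('b \<Rightarrow> real) \<Rightarrow> nat \<Rightarrow> real" where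
  "ratio f n = cov n f / cov n unit_ball"

text \<open>A generalised limit over shrinking neighbourhoods takes the place of Haar's compactness
  argument in a product space.\<close>

definition haar :: "('b \<Rightarrow> real) \<Rightarrow> real" where
  "haar f = L (ratio f)"

lemma ratio_nonneg: "f \<in> BC \<Longrightarrow> 0 \<le> ratio f n"
  unfolding ratio_def using cov_nonneg[of f n] cov_unit_ball[of n] by simp

lemma Bseq_ratio: "f \<in> BC \<Longrightarrow> Bseq (ratio f)"
proof -
  assume f: "f \<in> BC"
  obtain M where M: "0 < M" "\<And>n. cov n f \<le> M * cov n unit_ball"
    by (rule cov_le_multiple[OF f unit_ball_BC openin_mball[of \<one> r], of 1])
      (use r in \<open>auto simp: unit_ball_def\<close>)
  have "norm (ratio f n) \<le> M" for n
  proof -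
    have "ratio f n \<le> M"
      using M(2)[of n] cov_unit_ball[of n] by (simp add: ratio_def divide_le_eq)
    then show ?thesis using ratio_nonneg[OF f, of n] by simp
  qed
  then show ?thesis by (rule BseqI')
qed

lemma haar_mono:
  assumes "f \<in> BC" "g \<in> BC" "\<And>x. x \<in> carrier K \<Longrightarrow> f x \<le> g x"
  shows "haar f \<le> haar g"
  unfolding haar_def
proof (rule L_mono[OF Bseq_ratio Bseq_ratio])
  have "ratio f n \<le> ratio g n" for n
    unfolding ratio_def using cov_mono[OF assms(2,3)] cov_unit_ball[of n] by (intro divide_right_mono) auto
  then show "\<forall>\<^sub>F n in sequentially. ratio f n \<le> ratio g n" by simp
qed (use assms in auto)

lemma haar_cong:
  assumes "f \<in> BC" "g \<in> BC" "\<And>x. x \<in> carrier K \<Longrightarrow> f x = g x"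
  shows "haar f = haar g"
  using haar_mono[OF assms(1,2)] haar_mono[OF assms(2,1)] assms(3) by (intro antisym) auto

lemma haar_nonneg: "f \<in> BC \<Longrightarrow> 0 \<le> haar f"
  unfolding haar_def by (rule L_lo[OF Bseq_ratio]) (use ratio_nonneg in auto)

lemma haar_add_le:
  assumes "f \<in> BC" "g \<in> BC"
  shows "haar (\<lambda>x. f x + g x) \<le> haar f + haar g"
proof -
  have "ratio (\<lambda>x. f x + g x) n \<le> ratio f n + ratio g n" for n
    unfolding ratio_def add_divide_distrib[symmetric]
    using cov_add[OF assms, of n] cov_unit_ball[of n] by (intro divide_right_mono) auto
  moreover have "Bseq (\<lambda>n. ratio f n + ratio g n)" by (intro Bseq_plus Bseq_ratio assms)
  ultimately have "L (ratio (\<lambda>x. f x + g x)) \<le> L (\<lambda>n. ratio f n + ratio g n)"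
    by (intro L_mono Bseq_ratio BC_add assms) auto
  then show ?thesis unfolding haar_def L_add[OF Bseq_ratio[OF assms(1)] Bseq_ratio[OF assms(2)]] .
qed

lemma haar_scale:
  assumes "f \<in> BC" "0 \<le> a"
  shows "haar (\<lambda>x. a * f x) = a * haar f"
proof -
  have le: "haar (\<lambda>x. a * f x) \<le> a * haar f" if f: "f \<in> BC" and a: "0 < a" for f a
  proof -
    have "ratio (\<lambda>x. a * f x) n \<le> a * ratio f n" for n
      unfolding ratio_def times_divide_eq_right
      using cov_scale_le[OF f a, of n] cov_unit_ball[of n] by (intro divide_right_mono) auto
    then have "L (ratio (\<lambda>x. a * f x)) \<le> L (\<lambda>n. a * ratio f n)"
      by (intro L_mono Bseq_ratio BC_scale f Bseq_mult[OF Bfun_const]) (use a in auto)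
    then show ?thesis unfolding haar_def L_mul[OF Bseq_ratio[OF f]] .
  qed
  show ?thesis
  proof (cases "a = 0")
    \<comment> \<open>Scaling the zero function by 2 and by 1 / 2 pins its value.\<close>
    case True
    have "haar (\<lambda>x. 2 * (0 * f x)) \<le> 2 * haar (\<lambda>x. 0 * f x)" "haar (\<lambda>x. (1/2) * (0 * f x)) \<le> (1/2) * haar (\<lambda>x. 0 * f x)"
      by (intro le BC_scale assms; simp)+
    then show ?thesis using True by simp
  next
    case False
    then have a: "0 < a" using assms by simp
    have "haar (\<lambda>x. (1 / a) * (a * f x)) \<le> (1 / a) * haar (\<lambda>x. a * f x)"
      by (intro le BC_scale assms) (use a in simp)
    then have "a * haar f \<le> haar (\<lambda>x. a * f x)" using a by (simp add: field_simps)
    then show ?thesis using le[OF assms(1) a] by simp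
  qed
qed

lemma haar_translate:
  assumes "f \<in> BC" "s \<in> carrier K"
  shows "haar (\<lambda>x. f (inv s \<otimes> x)) = haar f"
proof -
  have le: "haar (\<lambda>x. f (inv s \<otimes> x)) \<le> haar f" if f: "f \<in> BC" and s: "s \<in> carrier K" for f s
  proof -
    have "ratio (\<lambda>x. f (inv s \<otimes> x)) n \<le> ratio f n" for n
      unfolding ratio_def using cov_translate_le[OF f s, of n] cov_unit_ball[of n]
      by (intro divide_right_mono) auto
    then show ?thesis unfolding haar_def
      by (intro L_mono Bseq_ratio BC_translate f s) auto
  qed
  have "haar f = haar (\<lambda>x. f (inv s \<otimes> (inv (inv s) \<otimes> x)))"
    using assms by (intro haar_cong BC_translate[of "\<lambda>x. f (inv s \<otimes> x)" "inv s"] BC_translate)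
      (auto simp: m_assoc[symmetric])
  also have "\<dots> \<le> haar (\<lambda>x. f (inv s \<otimes> x))"
    by (rule le[of "\<lambda>x. f (inv s \<otimes> x)" "inv s"]) (use assms in \<open>auto intro: BC_translate\<close>)
  finally show ?thesis using le[OF assms] by simp
qed

text \<open>After a translation f is bounded below near the identity, so finitely many translates
  dominate the reference ball with a factor that is uniform in n.\<close>

lemma haar_pos:
  assumes "f \<in> CC" "x \<in> carrier K" "0 < f x"
  shows "0 < haar f"
proof -
  have fB: "f \<in> BC" by (rule CC_subset_BC[OF assms(1)])
  define g where "g = (\<lambda>y. f (x \<otimes> y))"
  have gB: "g \<in> BC" using BC_translate[OF fB, of "inv x"] assms(2) by (simp add: g_def)
  have hg: "haar g = haar f" using haar_translate[OF fB, of "inv x"] assms(2) by (simp add: g_def)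
  have cg: "continuous_map mtopology euclideanreal g"
    using continuous_map_compose[OF continuous_map_translate[OF assms(2)], of euclideanreal f] assms(1)
    by (simp add: g_def o_def CC_def)
  define U where "U = {y \<in> carrier K. g y \<in> {f x / 2<..}}"
  have U: "openin mtopology U"
    using openin_continuous_map_preimage[OF cg, of "{f x / 2<..}"] by (simp add: U_def)
  have "\<one> \<in> U" using assms by (simp add: U_def g_def)
  obtain M where M: "0 < M" "\<And>n. cov n unit_ball \<le> M * cov n g"
    by (rule cov_le_multiple[OF unit_ball_BC gB U \<open>\<one> \<in> U\<close>, of "f x / 2"])
      (use assms in \<open>auto simp: U_def\<close>)
  have "1 / M \<le> ratio g n" for n
    using M(2)[of n] cov_unit_ball[of n] M(1) by (simp add: ratio_def field_simps)
  then have "1 / M \<le> haar g" unfolding haar_def by (intro L_lo Bseq_ratio gB) auto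
  then show ?thesis using M(1) hg by (smt (verit) divide_pos_pos)
qed

text \<open>A cover of the sum is split by multiplying its weight at x with the share of f1 or f2 in
  the sum at x, which hardly varies over a small translate. Adding e to the denominator q keeps the
  shares continuous and is paid for by e times the indicator of a compact set.\<close>

lemma haar_superadditive:
  assumes f: "f1 \<in> CC" "f2 \<in> CC"
  shows "haar f1 + haar f2 \<le> haar (\<lambda>x. f1 x + f2 x)"
proof -
  obtain S1 where S1: "compactin mtopology S1" "\<And>x. x \<in> carrier K - S1 \<Longrightarrow> f1 x = 0"
    using f unfolding CC_def by blast
  obtain S2 where S2: "compactin mtopology S2" "\<And>x. x \<in> carrier K - S2 \<Longrightarrow> f2 x = 0"
    using f unfolding CC_def by blast
  define S where "S = S1 \<union> S2"
  have S: "compactin mtopology S" unfolding S_def by (rule compactin_Un[OF S1(1) S2(1)])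
  have nn: "0 \<le> f1 x" "0 \<le> f2 x" if "x \<in> carrier K" for x
    using f that unfolding CC_def by auto
  have c12: "continuous_map mtopology euclideanreal f1" "continuous_map mtopology euclideanreal f2"
    using f unfolding CC_def by auto
  note B = CC_subset_BC[OF f(1)] CC_subset_BC[OF f(2)]
  define I where "I = (\<lambda>x. if x \<in> S then 1 else (0::real))"
  have IB: "I \<in> BC" by (rule BC_I[OF _ _ S, of _ 1]) (auto simp: I_def)
  let ?b = "haar (\<lambda>x. f1 x + f2 x)"
  have key: "haar f1 + haar f2 \<le> (1 + 2 * e) * (?b + e * haar I)" if e: "0 < e" for e
  proof -
    define q where "q = (\<lambda>x. f1 x + f2 x + e)"
    have q: "0 < q x" if "x \<in> carrier K" for x using nn[OF that] e by (simp add: q_def)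
    have "\<exists>n. \<forall>x\<in>carrier K. \<forall>y\<in>carrier K. inv x \<otimes> y \<in> nbhd n \<longrightarrow> \<bar>f x / q x - f y / q y\<bar> < e"
      if "f \<in> {f1, f2}" for f
    proof -
      have cf: "continuous_map mtopology euclideanreal f" using c12 that by auto
      have "continuous_map mtopology euclideanreal (\<lambda>x. f x / q x)"
        using cf c12 q unfolding q_def by (intro continuous_intros) fastforce+
      moreover have "f x / q x = 0" if "x \<in> carrier K - S" for x
        using that S1(2)[of x] S2(2)[of x] \<open>f \<in> {f1, f2}\<close> by (auto simp: S_def)
      ultimately show ?thesis using uniform_continuity[OF _ S _ e, of "\<lambda>x. f x / q x"] by metis
    qed
    then obtain n1 n2 where
      n1: "\<And>x y. x \<in> carrier K \<Longrightarrow> y \<in> carrier K \<Longrightarrow> inv x \<otimes> y \<in> nbhd n1 \<Longrightarrow> \<bar>f1 x / q x - f1 y / q y\<bar> < e" and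
      n2: "\<And>x y. x \<in> carrier K \<Longrightarrow> y \<in> carrier K \<Longrightarrow> inv x \<otimes> y \<in> nbhd n2 \<Longrightarrow> \<bar>f2 x / q x - f2 y / q y\<bar> < e"
      by (metis insertCI)
    have QB: "(\<lambda>x. (f1 x + f2 x) + e * I x) \<in> BC"
      using BC_add[OF BC_add[OF B] BC_scale[OF IB, of e]] e by simp
    have "cov n f1 + cov n f2 \<le> (1 + 2 * e) * cov n (\<lambda>x. (f1 x + f2 x) + e * I x)"
      if n: "n1 + n2 \<le> n" for n
    proof -
      have "(cov n f1 + cov n f2) / (1 + 2 * e) \<le> cov n (\<lambda>x. (f1 x + f2 x) + e * I x)"
      proof (rule cov_ge[OF QB])
        fix xs assume xs: "covers n xs (\<lambda>x. (f1 x + f2 x) + e * I x)"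
        have w: "\<And>c x. (c, x) \<in> set xs \<Longrightarrow> 0 \<le> c \<and> x \<in> carrier K"
          using xs unfolding covers_def weights_def by auto
        \<comment> \<open>The extra e absorbs the oscillation of f / q over a translate; from both
          functions together it yields the factor 1 + 2 e.\<close>
        define Y where "Y = (\<lambda>f. map (\<lambda>(c, x). (c * (f x / q x + e), x)) xs)"
        have Yc: "covers n (Y f) f" if fc: "f \<in> {f1, f2}" for f
          unfolding covers_def
        proof (intro conjI ballI)
          have f0: "0 \<le> f x" if "x \<in> carrier K" for x using nn[OF that] fc by auto
          show "Y f \<in> weights"
            unfolding weights_def Y_def
          proof safe
            fix a b assume "(a, b) \<in> set (map (\<lambda>(c, x). (c * (f x / q x + e), x)) xs)"
            then obtain c where cb: "(c, b) \<in> set xs" "a = c * (f b / q b + e)" by auto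
            show "b \<in> carrier K" "0 \<le> a" using w[OF cb(1)] f0[of b] q[of b] e cb(2)
              by (auto intro!: mult_nonneg_nonneg add_nonneg_nonneg divide_nonneg_nonneg less_imp_le)
          qed
          then have Yw: "Y f \<in> weights" .
          fix y assume y: "y \<in> carrier K"
          show "f y \<le> cover n (Y f) y"
          proof (cases "y \<in> S")
            case False
            then have "f y = 0" using S1(2)[of y] S2(2)[of y] fc y by (auto simp: S_def)
            then show ?thesis using cover_nonneg[OF Yw] by simp
          next
            case True
            have "f y = (f y / q y) * ((f1 y + f2 y) + e * I y)"
              using True q[OF y] by (simp add: I_def q_def)
            also have "\<dots> \<le> (f y / q y) * cover n xs y"
              using xs y f0[OF y] q[OF y] unfolding covers_def by (intro mult_left_mono) auto
            also have "\<dots> = (\<Sum>(c, x)\<leftarrow>xs. if inv x \<otimes> y \<in> nbhd n then c * (f y / q y) else 0)"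
              unfolding cover_def by (induction xs) (auto simp: algebra_simps)
            also have "\<dots> \<le> (\<Sum>(c, x)\<leftarrow>xs. if inv x \<otimes> y \<in> nbhd n then c * (f x / q x + e) else 0)"
            proof (rule sum_list_mono, safe)
              fix c x assume cx: "(c, x) \<in> set xs"
              show "(if inv x \<otimes> y \<in> nbhd n then c * (f y / q y) else 0)
                  \<le> (if inv x \<otimes> y \<in> nbhd n then c * (f x / q x + e) else 0)"
              proof (cases "inv x \<otimes> y \<in> nbhd n")
                case True
                then have "inv x \<otimes> y \<in> nbhd n1" "inv x \<otimes> y \<in> nbhd n2"
                  using nbhd_mono[of n1 n] nbhd_mono[of n2 n] n by auto
                then have "\<bar>f x / q x - f y / q y\<bar> < e"
                  using n1[of x y] n2[of x y] w[OF cx] y fc by auto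
                then have "f y / q y \<le> f x / q x + e" by (simp add: abs_less_iff)
                then have "c * (f y / q y) \<le> c * (f x / q x + e)"
                  using w[OF cx] by (intro mult_left_mono) auto
                then show ?thesis using True by (simp only: if_True)
              qed simp
            qed
            also have "\<dots> = cover n (Y f) y"
              unfolding cover_def Y_def by (induction xs) auto
            finally show ?thesis .
          qed
        qed
        have "total (Y f1) + total (Y f2) = (\<Sum>(c, x)\<leftarrow>xs. c * ((f1 x + f2 x) / q x + 2 * e))"
          unfolding total_def Y_def by (induction xs) (auto simp: algebra_simps add_divide_distrib)
        also have "\<dots> \<le> (\<Sum>(c, x)\<leftarrow>xs. (1 + 2 * e) * c)"
        proof (rule sum_list_mono, safe)
          fix c x assume cx: "(c, x) \<in> set xs"
          have "(f1 x + f2 x) / q x \<le> 1" using q[of x] w[OF cx] e by (simp add: q_def)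
          then show "c * ((f1 x + f2 x) / q x + 2 * e) \<le> (1 + 2 * e) * c"
            using w[OF cx] by (subst mult.commute, intro mult_right_mono) auto
        qed
        also have "\<dots> = (1 + 2 * e) * total xs"
          unfolding total_def by (induction xs) (auto simp: algebra_simps)
        finally have "cov n f1 + cov n f2 \<le> (1 + 2 * e) * total xs"
          using cov_le[OF Yc[of f1]] cov_le[OF Yc[of f2]] by simp
        then show "(cov n f1 + cov n f2) / (1 + 2 * e) \<le> total xs" using e by (simp add: field_simps)
      qed
      then show ?thesis using e by (simp add: field_simps)
    qed
    then have rr: "ratio f1 n + ratio f2 n \<le> (1 + 2 * e) * ratio (\<lambda>x. (f1 x + f2 x) + e * I x) n"
      if "n1 + n2 \<le> n" for n
      unfolding ratio_def add_divide_distrib[symmetric] times_divide_eq_right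
      using cov_unit_ball[of n] that by (intro divide_right_mono) auto
    have "Bseq (\<lambda>n. ratio f1 n + ratio f2 n)" by (intro Bseq_plus Bseq_ratio B)
    then have "L (\<lambda>n. ratio f1 n + ratio f2 n) \<le> L (\<lambda>n. (1 + 2 * e) * ratio (\<lambda>x. (f1 x + f2 x) + e * I x) n)"
      by (rule L_mono[OF _ Bseq_mult[OF Bfun_const Bseq_ratio[OF QB]]])
        (use rr in \<open>auto simp: eventually_sequentially\<close>)
    then have "haar f1 + haar f2 \<le> (1 + 2 * e) * haar (\<lambda>x. (f1 x + f2 x) + e * I x)"
      unfolding haar_def L_add[OF Bseq_ratio[OF B(1)] Bseq_ratio[OF B(2)]] L_mul[OF Bseq_ratio[OF QB]] .
    also have "\<dots> \<le> (1 + 2 * e) * (?b + e * haar I)"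
      using haar_add_le[OF BC_add[OF B] BC_scale[OF IB, of e]] haar_scale[OF IB, of e] e
      by (intro mult_left_mono) auto
    finally show ?thesis .
  qed
  have "((\<lambda>e. (1 + 2 * e) * (?b + e * haar I)) \<longlongrightarrow> (1 + 2 * 0) * (?b + 0 * haar I)) (at_right 0)"
    by (intro tendsto_intros)
  then have "haar f1 + haar f2 \<le> (1 + 2 * 0) * (?b + 0 * haar I)"
    by (rule tendsto_lowerbound) (use key in \<open>auto simp: eventually_at_filter\<close>)
  then show ?thesis by simp
qed

lemma haar_add: "f \<in> CC \<Longrightarrow> g \<in> CC \<Longrightarrow> haar (\<lambda>x. f x + g x) = haar f + haar g"
  by (intro antisym haar_add_le haar_superadditive CC_subset_BC)

lemma CC_I:
  assumes "continuous_map mtopology euclideanreal f" "\<And>x. x \<in> carrier K \<Longrightarrow> 0 \<le> f x"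
    "compactin mtopology S" "\<And>x. x \<in> carrier K - S \<Longrightarrow> f x = 0"
  shows "f \<in> CC"
  unfolding CC_def using assms by blast

lemma CC_scale:
  assumes "f \<in> CC" "0 \<le> a" shows "(\<lambda>x. a * f x) \<in> CC"
proof -
  obtain S where S: "compactin mtopology S" "\<And>x. x \<in> carrier K - S \<Longrightarrow> f x = 0"
    using assms unfolding CC_def by blast
  show ?thesis
    by (rule CC_I[OF _ _ S(1)]) (use assms S(2) in \<open>auto simp: CC_def intro!: continuous_intros\<close>)
qed

lemma CC_add:
  assumes "f \<in> CC" "g \<in> CC" shows "(\<lambda>x. f x + g x) \<in> CC"
proof -
  obtain S where S: "compactin mtopology S" "\<And>x. x \<in> carrier K - S \<Longrightarrow> f x = 0"
    using assms unfolding CC_def by blast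
  obtain T where T: "compactin mtopology T" "\<And>x. x \<in> carrier K - T \<Longrightarrow> g x = 0"
    using assms unfolding CC_def by blast
  show ?thesis
    by (rule CC_I[OF _ _ compactin_Un[OF S(1) T(1)]])
      (use assms S(2) T(2) in \<open>auto simp: CC_def intro!: continuous_intros\<close>)
qed

lemma CC_mult:
  assumes "f \<in> CC" "g \<in> CC" shows "(\<lambda>x. f x * g x) \<in> CC"
proof -
  obtain S where S: "compactin mtopology S" "\<And>x. x \<in> carrier K - S \<Longrightarrow> f x = 0"
    using assms unfolding CC_def by blast
  show ?thesis
    by (rule CC_I[OF _ _ S(1)])
      (use assms S(2) in \<open>auto simp: CC_def intro!: continuous_intros\<close>)
qed

lemma CC_square_diff:
  assumes "f \<in> CC" "g \<in> CC" shows "(\<lambda>x. (f x - g x)\<^sup>2) \<in> CC"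
proof -
  obtain S where S: "compactin mtopology S" "\<And>x. x \<in> carrier K - S \<Longrightarrow> f x = 0"
    using assms unfolding CC_def by blast
  obtain T where T: "compactin mtopology T" "\<And>x. x \<in> carrier K - T \<Longrightarrow> g x = 0"
    using assms unfolding CC_def by blast
  show ?thesis
    by (rule CC_I[OF _ _ compactin_Un[OF S(1) T(1)]])
      (use assms S(2) T(2) in \<open>auto simp: CC_def intro!: continuous_intros\<close>)
qed

lemma CC_translate:
  assumes "f \<in> CC" "s \<in> carrier K" shows "(\<lambda>x. f (inv s \<otimes> x)) \<in> CC"
proof -
  obtain S where S: "compactin mtopology S" "\<And>x. x \<in> carrier K - S \<Longrightarrow> f x = 0"
    using assms unfolding CC_def by blast
  show ?thesis
  proof (rule CC_I[OF _ _ compactin_translate[OF S(1) assms(2)]])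
    show "continuous_map mtopology euclideanreal (\<lambda>x. f (inv s \<otimes> x))"
      using continuous_map_compose[OF continuous_map_translate[of "inv s"], of euclideanreal f] assms
      by (simp add: o_def CC_def)
    show "0 \<le> f (inv s \<otimes> x)" if "x \<in> carrier K" for x using assms that by (simp add: CC_def)
    show "f (inv s \<otimes> x) = 0" if x: "x \<in> carrier K - (\<lambda>x. s \<otimes> x) ` S" for x
    proof (rule S(2))
      have "x = s \<otimes> (inv s \<otimes> x)" using x assms(2) by (simp add: m_assoc[symmetric])
      then show "inv s \<otimes> x \<in> carrier K - S" using x assms(2) by auto
    qed
  qed
qed

lemma haar_sum:
  assumes "finite I" "I \<noteq> {}" "\<And>i. i \<in> I \<Longrightarrow> f i \<in> CC" "\<And>i. i \<in> I \<Longrightarrow> 0 \<le> c i"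
  shows "(\<lambda>x. \<Sum>i\<in>I. c i * f i x) \<in> CC \<and> haar (\<lambda>x. \<Sum>i\<in>I. c i * f i x) = (\<Sum>i\<in>I. c i * haar (f i))"
  using assms
proof (induction I rule: finite_ne_induct)
  case (singleton i)
  then show ?case using CC_scale[of "f i" "c i"] haar_scale[OF CC_subset_BC, of "f i" "c i"] by simp
next
  case (insert i I)
  have i: "(\<lambda>x. c i * f i x) \<in> CC" "haar (\<lambda>x. c i * f i x) = c i * haar (f i)"
    using CC_scale[of "f i" "c i"] haar_scale[OF CC_subset_BC, of "f i" "c i"] insert by simp_all
  have I: "(\<lambda>x. \<Sum>i\<in>I. c i * f i x) \<in> CC" "haar (\<lambda>x. \<Sum>i\<in>I. c i * f i x) = (\<Sum>i\<in>I. c i * haar (f i))"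
    using insert by simp_all
  show ?case using CC_add[OF i(1) I(1)] haar_add[OF i(1) I(1)] i(2) I(2) insert(3) insert(1) by simp
qed

section \<open>Inner products of translated tent functions\<close>

definition bump :: "'b \<Rightarrow> real" where
  "bump x = max 0 (1 - d x \<one> / r)"

definition bumps :: "'b \<Rightarrow> 'b \<Rightarrow> real" where
  "bumps s x = bump (inv s \<otimes> x)"

lemma bump_CC: "bump \<in> CC"
proof (rule CC_I[OF _ _ C(1)])
  have "continuous_map mtopology euclideanreal (\<lambda>x. mdist (metric (carrier K, d)) x \<one>)"
    by (intro continuous_map_mdist) (auto simp: continuous_map_id[unfolded id_def])
  then have "continuous_map mtopology euclideanreal (\<lambda>x. d x \<one>)" by simp
  then show "continuous_map mtopology euclideanreal bump"
    unfolding bump_def using r by (intro continuous_intros) auto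
  show "bump x = 0" if x: "x \<in> carrier K - C" for x
  proof -
    have "x \<notin> mball \<one> r" using x C(2) by auto
    then have "r \<le> d x \<one>" using x by (simp add: commute)
    then show ?thesis using r by (simp add: bump_def)
  qed
qed (simp add: bump_def)

lemma bumps_CC: "s \<in> carrier K \<Longrightarrow> bumps s \<in> CC"
  unfolding bumps_def by (rule CC_translate[OF bump_CC])

lemma bump_one: "bump \<one> = 1" by (simp add: bump_def)

text \<open>The tent function has its maximum at the identity alone; this is what separates distinct
  translates in \<open>overlap_less\<close>.\<close>

lemma bump_less_one: "x \<in> carrier K \<Longrightarrow> x \<noteq> \<one> \<Longrightarrow> bump x < 1"
  using mdist_pos_less[of x \<one>] r by (simp add: bump_def)

text \<open>A coefficient of the left regular representation of K before normalisation. A real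
  nonnegative vector is used so that the integrands stay in \<open>CC\<close>.\<close>

definition overlap :: "'b \<Rightarrow> 'b \<Rightarrow> real" where
  "overlap s t = haar (\<lambda>x. bumps s x * bumps t x)"

lemma overlap_translate:
  assumes "u \<in> carrier K" "s \<in> carrier K" "t \<in> carrier K"
  shows "overlap (u \<otimes> s) (u \<otimes> t) = overlap s t"
proof -
  define f where "f = (\<lambda>x. bumps s x * bumps t x)"
  have f: "f \<in> BC" unfolding f_def by (intro CC_subset_BC CC_mult bumps_CC assms)
  have "overlap (u \<otimes> s) (u \<otimes> t) = haar (\<lambda>x. f (inv u \<otimes> x))"
    unfolding overlap_def
  proof (rule haar_cong[OF _ BC_translate[OF f assms(1)]])
    show "(\<lambda>x. bumps (u \<otimes> s) x * bumps (u \<otimes> t) x) \<in> BC"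
      by (intro CC_subset_BC CC_mult bumps_CC m_closed assms)
  qed (use assms in \<open>simp add: f_def bumps_def inv_mult_group m_assoc\<close>)
  then show ?thesis using haar_translate[OF f assms(1)] by (simp add: overlap_def f_def)
qed

lemma overlap_one_pos: "0 < overlap \<one> \<one>"
  unfolding overlap_def
  by (rule haar_pos[OF CC_mult[OF bumps_CC bumps_CC], of _ _ \<one>]) (auto simp: bumps_def bump_one)

lemma overlap_diag:
  assumes "s \<in> carrier K" shows "overlap s s = overlap \<one> \<one>"
  using overlap_translate[of s \<one> \<one>] assms by simp

text \<open>The square is expanded with the mixed product moved to the other side, since
  \<open>haar\<close> is additive on nonnegative functions.\<close>

lemma overlap_square_diff:
  assumes "s \<in> carrier K" "t \<in> carrier K"
  shows "haar (\<lambda>x. (bumps s x - bumps t x)\<^sup>2) = 2 * overlap \<one> \<one> - 2 * overlap s t"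
proof -
  note B = bumps_CC[OF assms(1)] bumps_CC[OF assms(2)]
  have 1: "haar (\<lambda>x. (bumps s x - bumps t x)\<^sup>2 + 2 * (bumps s x * bumps t x))
      = haar (\<lambda>x. (bumps s x - bumps t x)\<^sup>2) + 2 * overlap s t"
    using haar_add[OF CC_square_diff[OF B] CC_scale[OF CC_mult[OF B], of 2]]
      haar_scale[OF CC_subset_BC[OF CC_mult[OF B]], of 2] by (simp add: overlap_def)
  have e: "(\<lambda>x. (bumps s x - bumps t x)\<^sup>2 + 2 * (bumps s x * bumps t x))
      = (\<lambda>x. bumps s x * bumps s x + bumps t x * bumps t x)"
    by (simp add: power2_eq_square algebra_simps)
  have "haar (\<lambda>x. bumps s x * bumps s x + bumps t x * bumps t x) = overlap s s + overlap t t"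
    using haar_add[OF CC_mult[OF B(1) B(1)] CC_mult[OF B(2) B(2)]] by (simp add: overlap_def)
  then show ?thesis using 1 unfolding e overlap_diag[OF assms(1)] overlap_diag[OF assms(2)] by simp
qed

lemma overlap_less:
  assumes "s \<in> carrier K" "t \<in> carrier K" "s \<noteq> t" shows "overlap s t < overlap \<one> \<one>"
proof -
  note B = bumps_CC[OF assms(1)] bumps_CC[OF assms(2)]
  have "inv t \<otimes> s \<noteq> \<one>" using assms by (metis inv_equality inv_inv inv_closed)
  then have "bumps t s < 1" using bump_less_one[of "inv t \<otimes> s"] assms by (simp add: bumps_def)
  moreover have "bumps s s = 1" using assms by (simp add: bumps_def bump_one)
  ultimately have "0 < haar (\<lambda>x. (bumps s x - bumps t x)\<^sup>2)"
    by (intro haar_pos[OF CC_square_diff[OF B] assms(1)]) simp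
  then show ?thesis unfolding overlap_square_diff[OF assms(1,2)] by simp
qed

lemma overlap_nonneg: "s \<in> carrier K \<Longrightarrow> t \<in> carrier K \<Longrightarrow> 0 \<le> overlap s t"
  unfolding overlap_def by (intro haar_nonneg CC_subset_BC CC_mult bumps_CC)

text \<open>For each x the values of the translates at x form an admissible v, so the integrand is
  nonnegative pointwise. Positive and negative coefficients are integrated separately because
  \<open>CC\<close> is only a cone.\<close>

lemma overlap_quadratic_form:
  fixes n :: nat
  assumes s: "\<And>i. i < n \<Longrightarrow> s i \<in> carrier K"
    and pos: "\<And>v :: 'b \<Rightarrow> real. 0 \<le> (\<Sum>i<n. \<Sum>j<n. a i j * (v (s i) * v (s j)))"
  shows "0 \<le> (\<Sum>i<n. \<Sum>j<n. a i j * overlap (s i) (s j))"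
proof (cases "n = 0")
  case False
  define I where "I = {..<n} \<times> {..<n}"
  define f where "f = (\<lambda>p x. bumps (s (fst p)) x * bumps (s (snd p)) x)"
  define ap am where "ap = (\<lambda>p. max 0 (a (fst p) (snd p)))" and "am = (\<lambda>p. max 0 (- a (fst p) (snd p)))"
  have I: "finite I" "I \<noteq> {}" using False by (auto simp: I_def)
  have f: "f p \<in> CC" if "p \<in> I" for p
    unfolding f_def by (intro CC_mult bumps_CC s) (use that in \<open>auto simp: I_def\<close>)
  have p: "(\<lambda>x. \<Sum>i\<in>I. ap i * f i x) \<in> CC" "haar (\<lambda>x. \<Sum>i\<in>I. ap i * f i x) = (\<Sum>i\<in>I. ap i * haar (f i))"
    using haar_sum[OF I f, where c = ap] by (auto simp: ap_def)
  have m: "(\<lambda>x. \<Sum>i\<in>I. am i * f i x) \<in> CC" "haar (\<lambda>x. \<Sum>i\<in>I. am i * f i x) = (\<Sum>i\<in>I. am i * haar (f i))"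
    using haar_sum[OF I f, where c = am] by (auto simp: am_def)
  have split: "a (fst p) (snd p) = ap p - am p" for p by (auto simp: ap_def am_def)
  have "haar (\<lambda>x. \<Sum>i\<in>I. am i * f i x) \<le> haar (\<lambda>x. \<Sum>i\<in>I. ap i * f i x)"
  proof (rule haar_mono[OF CC_subset_BC[OF m(1)] CC_subset_BC[OF p(1)]])
    fix x
    have "0 \<le> (\<Sum>i<n. \<Sum>j<n. a i j * (bumps (s i) x * bumps (s j) x))"
      using pos[of "\<lambda>t. bumps t x"] .
    also have "\<dots> = (\<Sum>p\<in>I. (ap p - am p) * f p x)"
      unfolding I_def sum.cartesian_product f_def split[symmetric] by (simp add: case_prod_beta)
    finally show "(\<Sum>i\<in>I. am i * f i x) \<le> (\<Sum>i\<in>I. ap i * f i x)"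
      by (simp add: left_diff_distrib sum_subtractf)
  qed
  then have "0 \<le> (\<Sum>p\<in>I. (ap p - am p) * haar (f p))"
    unfolding p(2) m(2) by (simp add: left_diff_distrib sum_subtractf)
  also have "\<dots> = (\<Sum>i<n. \<Sum>j<n. a i j * overlap (s i) (s j))"
    unfolding I_def sum.cartesian_product split[symmetric] overlap_def f_def by (simp add: case_prod_beta)
  finally show ?thesis .
qed simp

text \<open>As (x^-1 s)^-1 (x^-1 p) = s^-1 p does not involve x, uniform continuity of the tent
  function after inversion bounds the difference of the two translates by \<eta> everywhere. Its
  square is at most \<eta> times their sum, whose integral does not depend on s.\<close>

lemma overlap_continuous:
  assumes p: "p \<in> carrier K" and e: "0 < e"
  obtains n where "\<And>s. s \<in> carrier K \<Longrightarrow> inv s \<otimes> p \<in> nbhd n \<Longrightarrow> overlap \<one> \<one> - overlap s p < e"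
proof -
  define h where "h = haar bump"
  have h0: "0 \<le> h" unfolding h_def by (rule haar_nonneg[OF CC_subset_BC[OF bump_CC]])
  define \<eta> where "\<eta> = e / (h + 1)"
  have \<eta>: "0 < \<eta>" using e h0 by (simp add: \<eta>_def)
  obtain S where S: "compactin mtopology S" "\<And>x. x \<in> carrier K - S \<Longrightarrow> bump x = 0"
    using bump_CC unfolding CC_def by blast
  have c: "continuous_map mtopology euclideanreal (\<lambda>x. bump (inv x))"
    using continuous_map_compose[OF continuous_map_inverse, of euclideanreal bump] bump_CC
    by (simp add: o_def CC_def)
  have S': "compactin mtopology ((\<lambda>x. inv x) ` S)" by (rule image_compactin[OF S(1) continuous_map_inverse])
  have off: "bump (inv x) = 0" if x: "x \<in> carrier K - (\<lambda>x. inv x) ` S" for x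
  proof (rule S(2))
    have "x \<in> (\<lambda>x. inv x) ` S" if "inv x \<in> S"
      by (rule image_eqI[OF _ that]) (use x in simp)
    then show "inv x \<in> carrier K - S" using x by auto
  qed
  obtain n where n: "\<And>x y. x \<in> carrier K \<Longrightarrow> y \<in> carrier K \<Longrightarrow> inv x \<otimes> y \<in> nbhd n
      \<Longrightarrow> \<bar>bump (inv x) - bump (inv y)\<bar> < \<eta>"
    by (fact uniform_continuity[of "\<lambda>x. bump (inv x)" "(\<lambda>x. inv x) ` S" \<eta>, OF c S' off \<eta>, simplified])
  show thesis
  proof (rule that)
    fix s assume s: "s \<in> carrier K" "inv s \<otimes> p \<in> nbhd n"
    note B = bumps_CC[OF s(1)] bumps_CC[OF p]
    have le: "(bumps s x - bumps p x)\<^sup>2 \<le> \<eta> * (bumps s x + bumps p x)" if x: "x \<in> carrier K" for x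
    proof -
      have "inv (inv x \<otimes> s) \<otimes> (inv x \<otimes> p) = inv s \<otimes> p"
        using x s p by (simp add: inv_mult_group m_assoc) (simp add: m_assoc[symmetric])
      then have "\<bar>bump (inv (inv x \<otimes> s)) - bump (inv (inv x \<otimes> p))\<bar> < \<eta>"
        using n[of "inv x \<otimes> s" "inv x \<otimes> p"] x s p by simp
      then have 1: "\<bar>bumps s x - bumps p x\<bar> \<le> \<eta>"
        using x s p by (simp add: bumps_def inv_mult_group)
      have "0 \<le> bumps s x" "0 \<le> bumps p x" by (simp_all add: bumps_def bump_def)
      then have 2: "\<bar>bumps s x - bumps p x\<bar> \<le> bumps s x + bumps p x" by simp
      have "(bumps s x - bumps p x)\<^sup>2 = \<bar>bumps s x - bumps p x\<bar> * \<bar>bumps s x - bumps p x\<bar>"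
        by (simp add: power2_eq_square)
      also have "\<dots> \<le> \<eta> * (bumps s x + bumps p x)" by (intro mult_mono 1 2) (use \<eta> in auto)
      finally show ?thesis .
    qed
    have hb: "haar (bumps t) = h" if "t \<in> carrier K" for t
      unfolding h_def bumps_def by (rule haar_translate[OF CC_subset_BC[OF bump_CC] that])
    have "2 * overlap \<one> \<one> - 2 * overlap s p = haar (\<lambda>x. (bumps s x - bumps p x)\<^sup>2)"
      by (rule overlap_square_diff[OF s(1) p, symmetric])
    also have "\<dots> \<le> haar (\<lambda>x. \<eta> * (bumps s x + bumps p x))"
      by (rule haar_mono[OF CC_subset_BC[OF CC_square_diff[OF B]] CC_subset_BC[OF CC_scale[OF CC_add[OF B]]]])
        (use le \<eta> in auto)
    also have "\<dots> = \<eta> * (2 * h)"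
      using haar_scale[OF CC_subset_BC[OF CC_add[OF B]], of \<eta>] haar_add[OF B] hb[OF s(1)] hb[OF p] \<eta> by simp
    finally have "overlap \<one> \<one> - overlap s p \<le> \<eta> * h" by simp
    also have "\<dots> < e" using e h0 by (simp add: \<eta>_def field_simps)
    finally show "overlap \<one> \<one> - overlap s p < e" .
  qed
qed

end

end

context metrizable_lc_group begin

text \<open>The kernel is \<open>\<langle>v\<^sub>s, v\<^sub>t\<rangle>\<close> for the left translates of a unit vector \<open>v\<close> in \<open>L\<^sup>2(K)\<close>. Positivity is
  stated in a form that survives entrywise products with positive semidefinite matrices.\<close>

theorem invariant_kernel:
  obtains \<kappa> :: "'b \<Rightarrow> 'b \<Rightarrow> real" where
    "\<And>n a s. (\<And>i. i < n \<Longrightarrow> s i \<in> carrier K) \<Longrightarrow>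
      (\<And>v :: 'b \<Rightarrow> real. 0 \<le> (\<Sum>i<n. \<Sum>j<n. a i j * (v (s i) * v (s j)))) \<Longrightarrow>
      0 \<le> (\<Sum>i<(n::nat). \<Sum>j<n. a i j * \<kappa> (s i) (s j))"
    "\<And>u s t. u \<in> carrier K \<Longrightarrow> s \<in> carrier K \<Longrightarrow> t \<in> carrier K \<Longrightarrow> \<kappa> (u \<otimes> s) (u \<otimes> t) = \<kappa> s t"
    "\<And>s t. \<kappa> s t = \<kappa> t s"
    "\<And>s. s \<in> carrier K \<Longrightarrow> \<kappa> s s = 1"
    "\<And>s t. s \<in> carrier K \<Longrightarrow> t \<in> carrier K \<Longrightarrow> 0 \<le> \<kappa> s t"
    "\<And>s t. s \<in> carrier K \<Longrightarrow> t \<in> carrier K \<Longrightarrow> s \<noteq> t \<Longrightarrow> \<kappa> s t < 1"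
    "\<And>p e. p \<in> carrier K \<Longrightarrow> 0 < e \<Longrightarrow>
      \<exists>n. \<forall>s\<in>carrier K. inv s \<otimes> p \<in> nbhd n \<longrightarrow> 1 - \<kappa> s p < e"
proof -
  obtain U C where U: "openin mtopology U" "compactin mtopology C" "\<one> \<in> U" "U \<subseteq> C"
    using bspec[OF loc_compact[unfolded locally_compact_space_def topspace_mtopology] one_closed] by blast
  obtain r where r: "0 < r" "mball \<one> r \<subseteq> U" using U(1,3) unfolding openin_mtopology by blast
  have rC: "mball \<one> r \<subseteq> C" using r(2) U(4) by blast
  obtain L where L: "limit_functional L" by (rule limit_functional_exists)
  note ctxt = r(1) U(2) rC L
  define N where "N = overlap r L \<one> \<one>"
  have N: "0 < N" unfolding N_def by (rule overlap_one_pos[OF ctxt])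
  define \<kappa> where "\<kappa> = (\<lambda>s t. overlap r L s t / N)"
  show thesis
  proof (rule that[of \<kappa>])
    fix n a and s :: "nat \<Rightarrow> 'b"
    assume s: "\<And>i. i < n \<Longrightarrow> s i \<in> carrier K"
      and pos: "\<And>v :: 'b \<Rightarrow> real. 0 \<le> (\<Sum>i<n. \<Sum>j<n. a i j * (v (s i) * v (s j)))"
    have "0 \<le> (\<Sum>i<n. \<Sum>j<n. a i j * overlap r L (s i) (s j))"
      by (rule overlap_quadratic_form[OF ctxt]) (fact s, fact pos)
    then have "0 \<le> (\<Sum>i<n. \<Sum>j<n. a i j * overlap r L (s i) (s j)) / N" using N by simp
    then show "0 \<le> (\<Sum>i<n. \<Sum>j<n. a i j * \<kappa> (s i) (s j))"
      by (simp add: \<kappa>_def sum_divide_distrib)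
  next
    show "\<kappa> (u \<otimes> s) (u \<otimes> t) = \<kappa> s t" if "u \<in> carrier K" "s \<in> carrier K" "t \<in> carrier K" for u s t
      using overlap_translate[OF ctxt that] by (simp add: \<kappa>_def)
    show "\<kappa> s t = \<kappa> t s" for s t
      unfolding \<kappa>_def overlap_def[OF ctxt] by (simp add: mult.commute)
    show "\<kappa> s s = 1" if "s \<in> carrier K" for s
      using overlap_diag[OF ctxt that] N by (simp add: \<kappa>_def N_def)
    show "0 \<le> \<kappa> s t" if "s \<in> carrier K" "t \<in> carrier K" for s t
      using overlap_nonneg[OF ctxt that] N by (simp add: \<kappa>_def)
    show "\<kappa> s t < 1" if "s \<in> carrier K" "t \<in> carrier K" "s \<noteq> t" for s t
      using overlap_less[OF ctxt that] N by (simp add: \<kappa>_def N_def)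
    fix p and e :: real assume p: "p \<in> carrier K" and e: "0 < e"
    have "0 < e * N" using e N by simp
    from overlap_continuous[OF ctxt p this] obtain n where
      n: "\<And>s. s \<in> carrier K \<Longrightarrow> inv s \<otimes> p \<in> nbhd n \<Longrightarrow> N - overlap r L s p < e * N"
      unfolding N_def[symmetric] by blast
    show "\<exists>n. \<forall>s\<in>carrier K. inv s \<otimes> p \<in> nbhd n \<longrightarrow> 1 - \<kappa> s p < e"
      using n N by (intro exI[of _ n]) (simp add: \<kappa>_def field_simps)
  qed
qed

end

section \<open>Multipliers from an invariant kernel\<close>

lemma pairing_upt_list: "pairing u (map (\<lambda>i. (c i, x i)) [0..<n]) = (\<Sum>i<n. c i * u (x i))"
  by (induction n) auto

lemma gform_upt_list:
  "gform G \<phi> (map (\<lambda>i. (c i, x i)) [0..<n]) (map (\<lambda>i. (c' i, x' i)) [0..<m])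
    = (\<Sum>i<n. \<Sum>j<m. c i * cnj (c' j) * \<phi> (inv\<^bsub>G\<^esub> (x' j) \<otimes>\<^bsub>G\<^esub> x i))"
  unfolding gform_def pairing_upt_list by (simp add: sum_distrib_left mult.assoc)

context group begin

context
  fixes H :: "'a set" and K :: "('c, 'n) monoid_scheme" and \<alpha> :: "'a \<Rightarrow> 'c"
    and \<kappa> :: "'c \<Rightarrow> 'c \<Rightarrow> real" and p :: 'c
  assumes H: "subgroup H G" and K: "group K"
    and \<alpha>_carrier: "\<And>x. x \<in> H \<Longrightarrow> \<alpha> x \<in> carrier K"
    and \<alpha>_mult: "\<And>x y. x \<in> H \<Longrightarrow> y \<in> H \<Longrightarrow> \<alpha> (x \<otimes> y) = \<alpha> x \<otimes>\<^bsub>K\<^esub> \<alpha> y"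
    and \<kappa>_pos: "\<And>n a s. (\<And>i. i < n \<Longrightarrow> s i \<in> carrier K) \<Longrightarrow>
      (\<And>v :: 'c \<Rightarrow> real. 0 \<le> (\<Sum>i<n. \<Sum>j<n. a i j * (v (s i) * v (s j)))) \<Longrightarrow>
      0 \<le> (\<Sum>i<(n::nat). \<Sum>j<n. a i j * \<kappa> (s i) (s j))"
    and \<kappa>_inv: "\<And>u s t. u \<in> carrier K \<Longrightarrow> s \<in> carrier K \<Longrightarrow> t \<in> carrier K \<Longrightarrow>
      \<kappa> (u \<otimes>\<^bsub>K\<^esub> s) (u \<otimes>\<^bsub>K\<^esub> t) = \<kappa> s t"
    and \<kappa>_sym: "\<And>s t. \<kappa> s t = \<kappa> t s"
    and \<kappa>_diag: "\<And>s. s \<in> carrier K \<Longrightarrow> \<kappa> s s = 1"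
    and p: "p \<in> carrier K"
begin

text \<open>The difference is the Gram matrix of the projections of the \<open>v\<^bsub>s i\<^esub>\<close> to the complement of \<open>v\<^sub>p\<close>.\<close>

lemma kernel_Bessel:
  fixes n :: nat and a :: "nat \<Rightarrow> nat \<Rightarrow> real" and s :: "nat \<Rightarrow> 'c"
  assumes s: "\<And>i. i < n \<Longrightarrow> s i \<in> carrier K"
    and pos: "\<And>v :: 'c \<Rightarrow> real. 0 \<le> (\<Sum>i<n. \<Sum>j<n. a i j * (v (s i) * v (s j)))"
  shows "(\<Sum>i<n. \<Sum>j<n. a i j * (\<kappa> (s i) p * \<kappa> (s j) p)) \<le> (\<Sum>i<n. \<Sum>j<n. a i j * \<kappa> (s i) (s j))"
proof -
  define k where "k = (\<lambda>i. \<kappa> (s i) p)"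
  define t where "t = s(n := p)"
  \<comment> \<open>The quadratic form in the points t obtained by replacing v (s i) with v (s i) -
    k i * v p; the index n stands for p.\<close>
  define b where "b = (\<lambda>i j. if i < n then (if j < n then a i j else - (\<Sum>j<n. a i j * k j))
    else if j < n then - (\<Sum>i<n. a i j * k i) else (\<Sum>i<n. \<Sum>j<n. a i j * (k i * k j)))"
  have ex: "(\<Sum>i<Suc n. \<Sum>j<Suc n. b i j * M (t i) (t j))
      = (\<Sum>i<n. \<Sum>j<n. a i j * M (s i) (s j)) - (\<Sum>i<n. (\<Sum>j<n. a i j * k j) * M (s i) p)
        - (\<Sum>j<n. (\<Sum>i<n. a i j * k i) * M p (s j)) + (\<Sum>i<n. \<Sum>j<n. a i j * (k i * k j)) * M p p"
    for M :: "'c \<Rightarrow> 'c \<Rightarrow> real"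
  proof -
    have "(\<Sum>i<n. \<Sum>j<n. b i j * M (t i) (t j)) = (\<Sum>i<n. \<Sum>j<n. a i j * M (s i) (s j))"
      by (intro sum.cong) (auto simp: b_def t_def)
    moreover have "(\<Sum>i<n. b i n * M (t i) (t n)) = - (\<Sum>i<n. (\<Sum>j<n. a i j * k j) * M (s i) p)"
      unfolding sum_negf[symmetric] by (intro sum.cong) (auto simp: b_def t_def)
    moreover have "(\<Sum>j<n. b n j * M (t n) (t j)) = - (\<Sum>j<n. (\<Sum>i<n. a i j * k i) * M p (s j))"
      unfolding sum_negf[symmetric] by (intro sum.cong) (auto simp: b_def t_def)
    moreover have "b n n * M (t n) (t n) = (\<Sum>i<n. \<Sum>j<n. a i j * (k i * k j)) * M p p"
      by (simp add: b_def t_def)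
    ultimately show ?thesis by (simp add: sum.distrib)
  qed
  have sw: "(\<Sum>j<n. (\<Sum>i<n. a i j * k i) * m j) = (\<Sum>i<n. \<Sum>j<n. a i j * (k i * m j))" for m
    by (subst sum.swap) (simp add: sum_distrib_right mult.assoc)
  have sl: "(\<Sum>i<n. (\<Sum>j<n. a i j * k j) * m i) = (\<Sum>i<n. \<Sum>j<n. a i j * (m i * k j))" for m
    by (simp add: sum_distrib_left sum_distrib_right mult_ac)
  have "0 \<le> (\<Sum>i<Suc n. \<Sum>j<Suc n. b i j * \<kappa> (t i) (t j))"
  proof (rule \<kappa>_pos)
    show "t i \<in> carrier K" if "i < Suc n" for i using that s p by (auto simp: t_def less_Suc_eq)
    fix v :: "'c \<Rightarrow> real"
    have "(\<Sum>i<Suc n. \<Sum>j<Suc n. b i j * (v (t i) * v (t j)))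
        = (\<Sum>i<n. \<Sum>j<n. a i j * ((v (s i) - \<kappa> (s i) p * v p) * (v (s j) - \<kappa> (s j) p * v p)))"
      unfolding ex[of "\<lambda>x y. v x * v y"] sw sl k_def
      by (simp add: algebra_simps sum.distrib sum_subtractf sum_distrib_left sum_distrib_right)
        (rule sum.swap)
    then show "0 \<le> (\<Sum>i<Suc n. \<Sum>j<Suc n. b i j * (v (t i) * v (t j)))"
      using pos[of "\<lambda>x. v x - \<kappa> x p * v p"] by simp
  qed
  also have "(\<Sum>i<Suc n. \<Sum>j<Suc n. b i j * \<kappa> (t i) (t j))
      = (\<Sum>i<n. \<Sum>j<n. a i j * \<kappa> (s i) (s j)) - (\<Sum>i<n. \<Sum>j<n. a i j * (k i * k j))"
  proof -
    have "\<kappa> p (s j) = k j" "\<kappa> (s j) p = k j" for j unfolding k_def by (rule \<kappa>_sym, rule refl)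
    then show ?thesis unfolding ex[of \<kappa>] sw sl using \<kappa>_diag[OF p] by simp
  qed
  finally show ?thesis by (simp add: k_def)
qed

text \<open>\<phi> times the positive definite function \<kappa>(\<alpha> x, 1) of H, extended by 0.
  On H its matrix is that of \<phi> multiplied entrywise by \<kappa>(\<alpha> x, \<alpha> y), the
  larger side in \<open>kernel_Bessel\<close>.\<close>

definition twist :: "('a \<Rightarrow> complex) \<Rightarrow> 'a \<Rightarrow> complex" where
  "twist \<phi> x = (if x \<in> H then \<phi> x * of_real (\<kappa> (\<alpha> x) \<one>\<^bsub>K\<^esub>) else 0)"

definition kernel_mult :: "'a \<Rightarrow> real" where
  "kernel_mult x = (if x \<in> H then \<kappa> (\<alpha> x) p else 0)"

lemma H_carrier: "x \<in> H \<Longrightarrow> x \<in> carrier G"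
  using subgroup.mem_carrier[OF H] .

lemma \<alpha>_quotient:
  assumes "x \<in> H" "y \<in> H"
  shows "\<kappa> (\<alpha> (inv y \<otimes> x)) \<one>\<^bsub>K\<^esub> = \<kappa> (\<alpha> x) (\<alpha> y)"
proof -
  have i: "inv y \<in> H" using subgroup.m_inv_closed[OF H assms(2)] .
  have c: "\<alpha> x \<in> carrier K" "\<alpha> y \<in> carrier K" "\<alpha> (inv y) \<in> carrier K" using assms i \<alpha>_carrier by auto
  have one: "\<alpha> \<one> = \<one>\<^bsub>K\<^esub>"
  proof -
    have h: "\<one> \<in> H" using subgroup.one_closed[OF H] .
    have "\<alpha> \<one> \<otimes>\<^bsub>K\<^esub> \<alpha> \<one> = \<alpha> \<one>" using \<alpha>_mult[OF h h] by simp
    then show ?thesis using \<alpha>_carrier[OF h] K by (metis group.r_cancel_one)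
  qed
  have "\<alpha> y \<otimes>\<^bsub>K\<^esub> \<alpha> (inv y \<otimes> x) = \<alpha> x"
    using \<alpha>_mult[of y "inv y \<otimes> x"] assms i subgroup.m_closed[OF H i assms(1)] H_carrier
    by (simp add: m_assoc[symmetric])
  moreover have "\<alpha> (inv y \<otimes> x) \<in> carrier K" using \<alpha>_carrier subgroup.m_closed[OF H i assms(1)] by blast
  ultimately show ?thesis
    using \<kappa>_inv[of "\<alpha> y" "\<alpha> (inv y \<otimes> x)" "\<one>\<^bsub>K\<^esub>"] c K
    by (simp add: group.is_monoid monoid.r_one)
qed

lemma quotient_in_H: "x \<in> H \<Longrightarrow> y \<in> H \<Longrightarrow> inv y \<otimes> x \<in> H"
  using subgroup.m_closed[OF H subgroup.m_inv_closed[OF H]] .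

lemma list_as_upt: "f = map (\<lambda>i. (fst (f ! i), snd (f ! i))) [0..<length f]"
  by (simp add: map_nth)

text \<open>Positivity of \<phi> with coefficients c i * v (s i) is exactly the hypothesis of the
  entrywise product with \<kappa>. As \<kappa> is real, only real parts enter the norms; the
  imaginary part of the form vanishes by Hermitian symmetry.\<close>

lemma gform_twist_on_H:
  assumes pd: "positive_definite G \<phi>" and f: "snd ` set f \<subseteq> H"
  shows "gnorm2 G \<phi> (map (\<lambda>(c, x). (of_real (kernel_mult x) * c, x)) f) \<le> gnorm2 G (twist \<phi>) f"
    "Im (gform G (twist \<phi>) f f) = 0" "0 \<le> gnorm2 G (twist \<phi>) f"
proof -
  define n where "n = length f"
  define c where "c = (\<lambda>i. fst (f ! i))"
  define x where "x = (\<lambda>i. snd (f ! i))"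
  have fl: "f = map (\<lambda>i. (c i, x i)) [0..<n]" unfolding c_def x_def n_def by (rule list_as_upt)
  have x: "x i \<in> H" if "i < n" for i
    using f nth_mem[of i f] that unfolding x_def n_def by auto
  define P where "P = (\<lambda>i j. c i * cnj (c j) * \<phi> (inv (x j) \<otimes> x i))"
  define s where "s = (\<lambda>i. \<alpha> (x i))"
  have tw: "gform G (twist \<phi>) f f = (\<Sum>i<n. \<Sum>j<n. P i j * of_real (\<kappa> (s i) (s j)))"
    unfolding fl gform_upt_list
    by (intro sum.cong) (auto simp: twist_def quotient_in_H x \<alpha>_quotient s_def P_def)
  have sc: "s i \<in> carrier K" if "i < n" for i unfolding s_def by (intro \<alpha>_carrier x that)
  have pos: "0 \<le> (\<Sum>i<n. \<Sum>j<n. Re (P i j) * (v (s i) * v (s j)))" for v :: "'c \<Rightarrow> real"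
  proof -
    define h where "h = map (\<lambda>i. (c i * of_real (v (s i)), x i)) [0..<n]"
    have "h \<in> galgebra G" unfolding h_def galgebra_def using x H_carrier by auto
    then have "0 \<le> gnorm2 G \<phi> h" by (rule gnorm2_nonneg[OF pd])
    also have "gform G \<phi> h h = (\<Sum>i<n. \<Sum>j<n. P i j * of_real (v (s i) * v (s j)))"
      unfolding h_def gform_upt_list by (simp add: P_def mult_ac)
    then have "gnorm2 G \<phi> h = (\<Sum>i<n. \<Sum>j<n. Re (P i j) * (v (s i) * v (s j)))"
      unfolding gnorm2_def by simp
    finally show ?thesis .
  qed
  have "map (\<lambda>(c, x). (of_real (kernel_mult x) * c, x)) f
      = map (\<lambda>i. (of_real (\<kappa> (s i) p) * c i, x i)) [0..<n]"
    unfolding fl using x by (auto simp: kernel_mult_def s_def)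
  then have "gform G \<phi> (map (\<lambda>(c, x). (of_real (kernel_mult x) * c, x)) f) (map (\<lambda>(c, x). (of_real (kernel_mult x) * c, x)) f)
      = (\<Sum>i<n. \<Sum>j<n. P i j * of_real (\<kappa> (s i) p * \<kappa> (s j) p))"
    unfolding P_def by (simp only: gform_upt_list) (simp add: mult_ac)
  then have "gnorm2 G \<phi> (map (\<lambda>(c, x). (of_real (kernel_mult x) * c, x)) f)
      = (\<Sum>i<n. \<Sum>j<n. Re (P i j) * (\<kappa> (s i) p * \<kappa> (s j) p))"
    unfolding gnorm2_def by simp
  also have "\<dots> \<le> (\<Sum>i<n. \<Sum>j<n. Re (P i j) * \<kappa> (s i) (s j))"
    by (rule kernel_Bessel[where a = "\<lambda>i j. Re (P i j)"]) (fact sc, fact pos)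
  also have "\<dots> = gnorm2 G (twist \<phi>) f" unfolding gnorm2_def tw by simp
  finally show le: "gnorm2 G \<phi> (map (\<lambda>(c, x). (of_real (kernel_mult x) * c, x)) f) \<le> gnorm2 G (twist \<phi>) f" .
  have "0 \<le> (\<Sum>i<n. \<Sum>j<n. Re (P i j) * \<kappa> (s i) (s j))"
    by (rule \<kappa>_pos) (fact sc, fact pos)
  then show "0 \<le> gnorm2 G (twist \<phi>) f" unfolding gnorm2_def tw by simp
  have cP: "cnj (P i j) = P j i" if "i < n" "j < n" for i j
  proof -
    have "gform G \<phi> [(1, x j)] [(1, x i)] = cnj (gform G \<phi> [(1, x i)] [(1, x j)])"
      by (rule gform_commute[OF pd]) (use x that H_carrier in auto)
    then show ?thesis by (simp add: P_def mult_ac)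
  qed
  have "cnj (gform G (twist \<phi>) f f) = (\<Sum>i<n. \<Sum>j<n. P j i * of_real (\<kappa> (s j) (s i)))"
    unfolding tw using cP by (simp add: \<kappa>_sym)
  also have "\<dots> = gform G (twist \<phi>) f f" unfolding tw by (rule sum.swap)
  finally show "Im (gform G (twist \<phi>) f f) = 0" by (simp add: complex_eq_iff)
qed

lemma gform_twist_cross:
  assumes "\<And>x y. x \<in> snd ` set f \<Longrightarrow> y \<in> snd ` set g \<Longrightarrow> inv y \<otimes> x \<notin> H"
  shows "gform G (twist \<phi>) f g = 0"
proof -
  have "pairing (\<lambda>y. cnj (twist \<phi> (inv y \<otimes> x))) g = pairing (\<lambda>y. 0) g" if "x \<in> snd ` set f" for x
    by (rule pairing_cong) (use assms[OF that] in \<open>auto simp: twist_def\<close>)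
  then have "gform G (twist \<phi>) f g = pairing (\<lambda>x. 0) f"
    unfolding gform_def by (intro pairing_cong) simp
  then show ?thesis by simp
qed

lemma gcoeff_partition: "gcoeff (filter P f @ filter (\<lambda>q. \<not> P q) f) x = gcoeff f x"
  by (induction f) auto

lemma inv_quotient: "x \<in> carrier G \<Longrightarrow> y \<in> carrier G \<Longrightarrow> inv y \<otimes> x \<in> H \<longleftrightarrow> inv x \<otimes> y \<in> H"
proof -
  assume c: "x \<in> carrier G" "y \<in> carrier G"
  have "inv (inv y \<otimes> x) = inv x \<otimes> y" "inv (inv x \<otimes> y) = inv y \<otimes> x"
    using c by (simp_all add: inv_mult_group)
  then show ?thesis using subgroup.m_inv_closed[OF H] by metis
qed

text \<open>\<open>twist\<close> vanishes off H, so distinct left cosets of H are orthogonal for its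
  form; the coset of x is split off.\<close>

lemma gform_twist_partition:
  assumes f: "f \<in> galgebra G" and x: "x \<in> carrier G"
  shows "gform G (twist \<phi>) f f
    = gform G (twist \<phi>) (filter (\<lambda>q. inv x \<otimes> snd q \<in> H) f) (filter (\<lambda>q. inv x \<otimes> snd q \<in> H) f)
    + gform G (twist \<phi>) (filter (\<lambda>q. inv x \<otimes> snd q \<notin> H) f) (filter (\<lambda>q. inv x \<otimes> snd q \<notin> H) f)"
proof -
  let ?f1 = "filter (\<lambda>q. inv x \<otimes> snd q \<in> H) f" and ?f2 = "filter (\<lambda>q. inv x \<otimes> snd q \<notin> H) f"
  have no: "inv z \<otimes> y \<notin> H" if y: "y \<in> snd ` set ?f1" and z: "z \<in> snd ` set ?f2" for y z
  proof
    assume h: "inv z \<otimes> y \<in> H"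
    have c: "y \<in> carrier G" "z \<in> carrier G" using y z f by (auto simp: galgebra_def)
    have "inv x \<otimes> y \<in> H" "inv x \<otimes> z \<notin> H" using y z by auto
    moreover have "inv y \<otimes> z \<in> H" using h inv_quotient[OF c] by simp
    moreover have "inv x \<otimes> z = (inv x \<otimes> y) \<otimes> (inv y \<otimes> z)"
      using x c inv_closed[OF x] inv_closed[OF c(1)]
      by (simp add: m_assoc) (simp add: m_assoc[symmetric])
    ultimately show False using subgroup.m_closed[OF H] by metis
  qed
  have "gform G (twist \<phi>) ?f1 ?f2 = 0" by (rule gform_twist_cross) (rule no)
  moreover have "gform G (twist \<phi>) ?f2 ?f1 = 0"
  proof (rule gform_twist_cross)
    fix y z assume y: "y \<in> snd ` set ?f2" and z: "z \<in> snd ` set ?f1"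
    have c: "y \<in> carrier G" "z \<in> carrier G" using y z f by (auto simp: galgebra_def)
    show "inv z \<otimes> y \<notin> H" using no[OF z y] inv_quotient[OF c] by simp
  qed
  moreover have "gform G (twist \<phi>) f f = gform G (twist \<phi>) (?f1 @ ?f2) (?f1 @ ?f2)"
    by (rule gform_gcoeff_cong) (simp_all only: gcoeff_partition)
  ultimately show ?thesis by simp
qed

lemma gform_translate:
  assumes "f \<in> galgebra G" "x \<in> carrier G"
  shows "gform G \<phi> (map (\<lambda>(c, y). (c, x \<otimes> y)) f) (map (\<lambda>(c, y). (c, x \<otimes> y)) f) = gform G \<phi> f f"
proof -
  have e: "pairing u (map (\<lambda>(c, y). (c, x \<otimes> y)) g) = pairing (\<lambda>y. u (x \<otimes> y)) g" for u g
    by (induction g) auto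
  have "inv (x \<otimes> z) \<otimes> (x \<otimes> y) = inv z \<otimes> y" if "y \<in> carrier G" "z \<in> carrier G" for y z
  proof -
    have "inv x \<otimes> (x \<otimes> y) = y" using that assms(2) by (simp add: m_assoc[symmetric])
    then show ?thesis using that assms(2) by (simp add: inv_mult_group m_assoc)
  qed
  then have "pairing (\<lambda>z. cnj (\<phi> (inv (x \<otimes> z) \<otimes> (x \<otimes> y)))) f = pairing (\<lambda>z. cnj (\<phi> (inv z \<otimes> y))) f"
    if "y \<in> carrier G" for y
    using that assms(1) by (intro pairing_cong) (auto simp: galgebra_def)
  then show ?thesis unfolding gform_def e
    using assms(1) by (intro pairing_cong) (auto simp: galgebra_def)
qed

text \<open>Induction on the number of terms: the coset of the first point is split off and
  translated into H, where \<open>gform_twist_on_H\<close> applies.\<close>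

lemma positive_definite_twist:
  assumes pd: "positive_definite G \<phi>"
  shows "positive_definite G (twist \<phi>)"
proof (rule positive_definiteI)
  show "twist \<phi> \<in> group_functions G" using H_carrier by (auto simp: group_functions_def twist_def)
  fix f assume "f \<in> galgebra G"
  then show "gform G (twist \<phi>) f f \<in> \<real>\<^sub>\<ge>\<^sub>0"
  proof (induction "length f" arbitrary: f rule: less_induct)
    case less
    show ?case
    proof (cases f)
      case Nil
      then show ?thesis by simp
    next
      case (Cons q f')
      define x where "x = snd q"
      have x: "x \<in> carrier G" using less(2) Cons by (simp add: x_def galgebra_def)
      let ?f1 = "filter (\<lambda>q. inv x \<otimes> snd q \<in> H) f" and ?f2 = "filter (\<lambda>q. inv x \<otimes> snd q \<notin> H) f"
      have al: "?f1 \<in> galgebra G" "?f2 \<in> galgebra G" using less(2) by (auto simp: galgebra_def)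
      have "inv x \<otimes> snd q \<in> H" using x subgroup.one_closed[OF H] by (simp add: x_def)
      then have "length ?f2 < length f" using Cons by (simp add: le_imp_less_Suc)
      from less(1)[OF this al(2)] have 2: "gform G (twist \<phi>) ?f2 ?f2 \<in> \<real>\<^sub>\<ge>\<^sub>0" .
      define g where "g = map (\<lambda>(c, y). (c, inv x \<otimes> y)) ?f1"
      have g: "snd ` set g \<subseteq> H" by (auto simp: g_def)
      have "gform G (twist \<phi>) ?f1 ?f1 = gform G (twist \<phi>) g g"
        unfolding g_def by (rule gform_translate[OF al(1), symmetric]) (use x in simp)
      also have "\<dots> \<in> \<real>\<^sub>\<ge>\<^sub>0"
        using gform_twist_on_H(2,3)[OF pd g] by (auto simp: gnorm2_def complex_nonneg_Reals_iff)
      finally show ?thesis using 2 unfolding gform_twist_partition[OF less(2) x] by (rule nonneg_Reals_add_I)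
    qed
  qed
qed

text \<open>For a state \<phi> the twist is again a state, so f has norm at most 1 in its form.
  Dropping the terms outside H decreases this norm and does not change the multiplied element; on H
  the Bessel inequality compares the two.\<close>

lemma contraction_kernel_mult:
  assumes f: "contraction G f"
  shows "contraction G (map (\<lambda>(c, x). (of_real (kernel_mult x) * c, x)) f)"
proof -
  let ?g = "map (\<lambda>(c, x). (of_real (kernel_mult x) * c, x))"
  have fa: "f \<in> galgebra G" by (rule opbound_galgebra[OF f])
  have ga: "?g f \<in> galgebra G" using fa by (auto simp: galgebra_def)
  have one: "\<alpha> \<one> \<in> carrier K" using \<alpha>_carrier subgroup.one_closed[OF H] by blast
  show ?thesis
    unfolding contraction_iff_state[OF ga]
  proof (intro allI impI)
    fix \<phi> assume "positive_definite G \<phi> \<and> \<phi> \<one> = 1"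
    then have pd: "positive_definite G \<phi>" and \<phi>1: "\<phi> \<one> = 1" by auto
    have h1: "\<one> \<in> H" using subgroup.one_closed[OF H] .
    have "\<kappa> (\<alpha> (inv \<one> \<otimes> \<one>)) \<one>\<^bsub>K\<^esub> = 1"
      unfolding \<alpha>_quotient[OF h1 h1] by (rule \<kappa>_diag[OF one])
    then have "twist \<phi> \<one> = 1" using \<phi>1 h1 by (simp add: twist_def)
    then have 1: "gnorm2 G (twist \<phi>) f \<le> 1"
      using f positive_definite_twist[OF pd] unfolding contraction_iff_state[OF fa] by blast
    let ?f1 = "filter (\<lambda>q. inv \<one> \<otimes> snd q \<in> H) f" and ?f2 = "filter (\<lambda>q. inv \<one> \<otimes> snd q \<notin> H) f"
    have al: "?f1 \<in> galgebra G" "?f2 \<in> galgebra G" using fa by (auto simp: galgebra_def)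
    have "gnorm2 G (twist \<phi>) f = gnorm2 G (twist \<phi>) ?f1 + gnorm2 G (twist \<phi>) ?f2"
      unfolding gnorm2_def gform_twist_partition[OF fa one_closed] by simp
    then have 2: "gnorm2 G (twist \<phi>) ?f1 \<le> 1"
      using 1 gnorm2_nonneg[OF positive_definite_twist[OF pd] al(2)] by simp
    have "snd ` set ?f1 \<subseteq> H" using fa by (auto simp: galgebra_def subset_iff)
    from gform_twist_on_H(1)[OF pd this] have 3: "gnorm2 G \<phi> (?g ?f1) \<le> 1" using 2 by simp
    have "gcoeff (?g f) y = gcoeff (?g ?f1) y" for y
      using fa by (induction f) (auto simp: kernel_mult_def)
    then have "gnorm2 G \<phi> (?g f) = gnorm2 G \<phi> (?g ?f1)"
      unfolding gnorm2_def by (intro arg_cong[of _ _ Re] gform_gcoeff_cong)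
    then show "gnorm2 G \<phi> (?g f) \<le> 1" using 3 by simp
  qed
qed

lemma contraction_kernel_multiplier:
  assumes "contraction G f"
  shows "contraction G (map (\<lambda>(c, x). (of_real (if x \<in> H then \<kappa> (\<alpha> x) p else 0) * c, x)) f)"
  using contraction_kernel_mult[OF assms] unfolding kernel_mult_def .

end

end

section \<open>Choosing the set\<close>

context metrizable_lc_group begin

lemma limitin_const: "a \<in> carrier K \<Longrightarrow> limitin mtopology (\<lambda>n. a) a sequentially"
  by (simp add: limitin_metric)

lemma limitin_powers:
  assumes "limitin mtopology b \<one> sequentially"
  shows "limitin mtopology (\<lambda>n. b n [^] (i::nat)) \<one> sequentially"
proof (induction i)
  case 0
  then show ?case by (simp add: limitin_const)
next
  case (Suc i)
  from limitin_mult[OF this assms] show ?case by simp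
qed

lemma limitin_avoids_finite:
  assumes "limitin mtopology b \<one> sequentially" "finite F" "F \<subseteq> carrier K" "\<one> \<notin> F"
  shows "\<forall>\<^sub>F n in sequentially. b n \<notin> F"
proof -
  have "\<forall>\<^sub>F n in sequentially. b n \<noteq> x" if "x \<in> F" for x
  proof -
    have x: "x \<in> carrier K" "x \<noteq> \<one>" using that assms by auto
    then have "0 < d x \<one>" using mdist_pos_less by simp
    then have "\<forall>\<^sub>F n in sequentially. b n \<in> carrier K \<and> d (b n) \<one> < d x \<one>"
      using assms(1) unfolding limitin_metric by blast
    then show ?thesis by eventually_elim auto
  qed
  then have "\<forall>\<^sub>F n in sequentially. \<forall>x\<in>F. b n \<noteq> x"
    by (intro eventually_ball_finite assms(2)) blast
  then show ?thesis by eventually_elim auto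
qed

lemma eventually_near:
  assumes "limitin mtopology s q sequentially" "p \<in> carrier K" "inv q \<otimes> p \<in> nbhd n"
  shows "\<forall>\<^sub>F k in sequentially. inv (s k) \<otimes> p \<in> nbhd n"
proof -
  have "limitin mtopology (\<lambda>k. inv (s k) \<otimes> p) (inv q \<otimes> p) sequentially"
    by (intro limitin_mult limitin_inv limitin_const assms)
  then show ?thesis using openin_nbhd assms(3) unfolding limitin_def by blast
qed

end

context group begin

text \<open>\<open>ord\<close> is 0 for elements of infinite order, so the hypothesis admits order 0
  and every order from n on.\<close>

lemma inj_on_powers:
  assumes "x \<in> carrier G" "\<not> (0 < ord x \<and> ord x < n)"
  shows "inj_on (\<lambda>j. x [^] (j::nat)) {..<n}"
proof -
  have *: "x [^] i \<noteq> x [^] j" if "i < j" "j < n" for i j :: nat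
  proof
    assume e: "x [^] i = x [^] j"
    have "x [^] i \<otimes> x [^] (j - i) = x [^] i \<otimes> \<one>"
      using nat_pow_mult[OF assms(1), of i "j - i"] that e assms(1) by simp
    then have "x [^] (j - i) = \<one>" using assms(1) by simp
    then have "ord x dvd j - i" using pow_eq_id[OF assms(1)] by simp
    then have "0 < ord x" "ord x \<le> j - i" using that by (auto intro: dvd_imp_le Nat.gr0I)
    then show False using assms(2) that by simp
  qed
  show ?thesis
  proof (rule inj_onI)
    fix i j assume ij: "i \<in> {..<n}" "j \<in> {..<n}" "x [^] i = x [^] j"
    show "i = j"
    proof (rule linorder_cases[of i j])
      assume "i < j" then show ?thesis using *[of i j] ij by simp
    next
      assume "j < i" then show ?thesis using *[of j i] ij by simp
    qed
  qed
qed

lemma subgroup_nat_pow: "subgroup H G \<Longrightarrow> x \<in> H \<Longrightarrow> x [^] (n::nat) \<in> H"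
  by (induction n) (auto intro: subgroup.one_closed subgroup.m_closed)

end

text \<open>With \<open>x\<^sub>k\<close> in \<open>A\<close> and \<open>\<alpha> x\<^sub>k \<longlongrightarrow> p\<close>, take \<open>d = x\<^sub>k\<^sup>-\<^sup>1 x\<^bsub>k+1\<^esub>\<close> and \<open>a = x\<^sub>l\<close>: first \<open>k\<close> is chosen so large
  that the relevant powers of \<open>d\<close> are distinct and close to \<open>1\<close>, then \<open>l\<close> so large that \<open>a\<close> times
  these powers is close to, but different from, \<open>p\<close>.\<close>

lemma (in metrizable_lc_group) progression_near_limit_point:
  fixes G :: "('a, 'm) monoid_scheme"
  assumes G: "group G" and H: "subgroup H G"
    and \<alpha>_carrier: "\<And>x. x \<in> H \<Longrightarrow> \<alpha> x \<in> carrier K"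
    and \<alpha>_mult: "\<And>x y. x \<in> H \<Longrightarrow> y \<in> H \<Longrightarrow> \<alpha> (x \<otimes>\<^bsub>G\<^esub> y) = \<alpha> x \<otimes> \<alpha> y"
    and \<alpha>_inj: "inj_on \<alpha> H"
    and x: "\<And>k. x k \<in> H" "inj (\<lambda>k. \<alpha> (x k))" "limitin mtopology (\<lambda>k. \<alpha> (x k)) p sequentially"
    and ord: "\<And>n. 0 < n \<Longrightarrow> finite {y \<in> H. group.ord G y = n}"
  obtains a b where "a \<in> H" "b \<in> H" "inj_on (\<lambda>j. b [^]\<^bsub>G\<^esub> (j::nat)) {..<N}"
    "\<And>y. y \<in> fejer_support G a b N \<Longrightarrow> y \<in> H \<and> \<alpha> y \<noteq> p \<and> inv (\<alpha> y) \<otimes> p \<in> nbhd n"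
proof -
  interpret G: group G by (rule G)
  have HG: "y \<in> carrier G" if "y \<in> H" for y using subgroup.mem_carrier[OF H that] .
  have p: "p \<in> carrier K" using limitin_mspace[OF x(3)] .
  have \<alpha>_one: "\<alpha> \<one>\<^bsub>G\<^esub> = \<one>"
  proof -
    have h: "\<one>\<^bsub>G\<^esub> \<in> H" using subgroup.one_closed[OF H] .
    have "\<alpha> \<one>\<^bsub>G\<^esub> \<otimes> \<alpha> \<one>\<^bsub>G\<^esub> = \<alpha> \<one>\<^bsub>G\<^esub>" using \<alpha>_mult[OF h h] by simp
    then show ?thesis using \<alpha>_carrier[OF h] by (metis r_cancel_one)
  qed
  have \<alpha>_inv: "\<alpha> (inv\<^bsub>G\<^esub> y) = inv (\<alpha> y)" if y: "y \<in> H" for y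
  proof -
    have i: "inv\<^bsub>G\<^esub> y \<in> H" using subgroup.m_inv_closed[OF H y] .
    have "\<alpha> (inv\<^bsub>G\<^esub> y) \<otimes> \<alpha> y = \<one>" using \<alpha>_mult[OF i y] HG[OF y] \<alpha>_one by simp
    then show ?thesis using \<alpha>_carrier[OF i] \<alpha>_carrier[OF y] by (metis inv_equality)
  qed
  have \<alpha>_pow: "\<alpha> (y [^]\<^bsub>G\<^esub> (i::nat)) = \<alpha> y [^] i" if y: "y \<in> H" for y i
    by (induction i) (simp_all add: \<alpha>_one \<alpha>_mult G.subgroup_nat_pow[OF H y] y)
  define s where "s = (\<lambda>k. \<alpha> (x k))"
  have sc: "s k \<in> carrier K" for k unfolding s_def using \<alpha>_carrier x(1) by blast
  have s: "limitin mtopology s p sequentially" unfolding s_def by (rule x(3))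
  have s': "limitin mtopology (\<lambda>k. s (Suc k)) p sequentially"
    using limitin_subsequence[OF _ s, of Suc] by (simp add: strict_mono_def o_def)
  define b where "b = (\<lambda>k. inv\<^bsub>G\<^esub> (x k) \<otimes>\<^bsub>G\<^esub> x (Suc k))"
  have bH: "b k \<in> H" for k
    unfolding b_def by (intro subgroup.m_closed[OF H] subgroup.m_inv_closed[OF H] x)
  have \<alpha>b: "\<alpha> (b k) = inv (s k) \<otimes> s (Suc k)" for k
    unfolding b_def s_def by (simp add: \<alpha>_mult \<alpha>_inv x(1) subgroup.m_inv_closed[OF H])
  have "limitin mtopology (\<lambda>k. inv (s k) \<otimes> s (Suc k)) (inv p \<otimes> p) sequentially"
    by (intro limitin_mult limitin_inv s s')
  then have b1: "limitin mtopology (\<lambda>k. \<alpha> (b k)) \<one> sequentially" using p by (simp add: \<alpha>b)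
  \<comment> \<open>The elements whose powers could repeat before N. \<open>\<alpha> (b k)\<close>
    tends to 1, so it leaves the finite image of all of them but the identity, which is excluded
    because the sequence is injective.\<close>
  define Q where "Q = (\<Union>m\<in>{1..<N}. {y \<in> H. group.ord G y = m})"
  have Q: "finite Q" "Q \<subseteq> H" unfolding Q_def using ord by auto
  have "\<one> \<notin> \<alpha> ` (Q - {\<one>\<^bsub>G\<^esub>})"
  proof
    assume "\<one> \<in> \<alpha> ` (Q - {\<one>\<^bsub>G\<^esub>})"
    then obtain y where y: "y \<in> Q" "y \<noteq> \<one>\<^bsub>G\<^esub>" "\<alpha> y = \<alpha> \<one>\<^bsub>G\<^esub>" using \<alpha>_one by force
    then show False using inj_onD[OF \<alpha>_inj y(3)] Q(2) subgroup.one_closed[OF H] by auto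
  qed
  then have ev1: "\<forall>\<^sub>F k in sequentially. \<alpha> (b k) \<notin> \<alpha> ` (Q - {\<one>\<^bsub>G\<^esub>})"
    by (intro limitin_avoids_finite b1) (use Q \<alpha>_carrier in auto)
  \<comment> \<open>The image of the (i - j)-th power of \<open>b k\<close>. With N fixed, finitely
    many pairs have to be controlled, each for all large k.\<close>
  define z where "z = (\<lambda>k i j. \<alpha> (b k) [^] (i::nat) \<otimes> inv (\<alpha> (b k) [^] (j::nat)))"
  have zc: "z k i j \<in> carrier K" for k i j unfolding z_def using \<alpha>_carrier[OF bH] by simp
  have zlim: "limitin mtopology (\<lambda>k. p \<otimes> z k i j) p sequentially" for i j
  proof -
    have "limitin mtopology (\<lambda>k. p \<otimes> z k i j) (p \<otimes> (\<one> \<otimes> inv \<one>)) sequentially"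
      unfolding z_def by (intro limitin_mult limitin_inv limitin_const limitin_powers b1 p)
    then show ?thesis using p by simp
  qed
  have "\<forall>\<^sub>F k in sequentially. inv (p \<otimes> z k i j) \<otimes> p \<in> nbhd n" for i j
    by (rule eventually_near[OF zlim p]) (use p one_nbhd in simp)
  then have "\<forall>\<^sub>F k in sequentially. \<forall>i\<in>{..<N}. \<forall>j\<in>{..<N}. inv (p \<otimes> z k i j) \<otimes> p \<in> nbhd n"
    by (intro eventually_ball_finite ballI finite_lessThan)
  with ev1 have "\<forall>\<^sub>F k in sequentially. \<alpha> (b k) \<notin> \<alpha> ` (Q - {\<one>\<^bsub>G\<^esub>}) \<and>
      (\<forall>i\<in>{..<N}. \<forall>j\<in>{..<N}. inv (p \<otimes> z k i j) \<otimes> p \<in> nbhd n)"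
    by eventually_elim blast
  then obtain k where k: "\<alpha> (b k) \<notin> \<alpha> ` (Q - {\<one>\<^bsub>G\<^esub>})"
    "\<And>i j. i < N \<Longrightarrow> j < N \<Longrightarrow> inv (p \<otimes> z k i j) \<otimes> p \<in> nbhd n"
    unfolding eventually_sequentially by blast
  have "b k \<noteq> \<one>\<^bsub>G\<^esub>"
  proof
    assume "b k = \<one>\<^bsub>G\<^esub>"
    then have "inv (s k) \<otimes> s (Suc k) = \<one>" using \<alpha>b[of k] \<alpha>_one by simp
    then have "s (Suc k) = s k" using sc by (metis inv_equality inv_inv inv_closed)
    then have "Suc k = k" using x(2) unfolding s_def inj_def by blast
    then show False by simp
  qed
  then have bQ: "b k \<notin> Q" using k(1) by blast
  have inj: "inj_on (\<lambda>j. b k [^]\<^bsub>G\<^esub> (j::nat)) {..<N}"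
    by (rule G.inj_on_powers[OF HG[OF bH]]) (use bQ bH in \<open>auto simp: Q_def\<close>)
  have ev2: "\<forall>\<^sub>F l in sequentially. inv (s l \<otimes> z k i j) \<otimes> p \<in> nbhd n" if "i < N" "j < N" for i j
    by (rule eventually_near[OF _ p k(2)[OF that]]) (intro limitin_mult limitin_const s zc)
  \<comment> \<open>The sequence s is injective, so for given i and j at most one l is lost.\<close>
  have ev3: "\<forall>\<^sub>F l in sequentially. s l \<otimes> z k i j \<noteq> p" for i j
  proof -
    have "s l = p \<otimes> inv (z k i j)" if "s l \<otimes> z k i j = p" for l
      using that sc[of l] zc[of k i j] inv_solve_right[OF sc p zc] by blast
    then have "{l. s l \<otimes> z k i j = p} \<subseteq> s -` {p \<otimes> inv (z k i j)}" by blast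
    moreover have "finite (s -` {p \<otimes> inv (z k i j)})"
      using x(2) unfolding s_def[symmetric] by (intro finite_vimageI) auto
    ultimately have "finite {l. s l \<otimes> z k i j = p}" by (rule finite_subset)
    then show ?thesis unfolding cofinite_eq_sequentially[symmetric] eventually_cofinite by simp
  qed
  have "\<forall>\<^sub>F l in sequentially. \<forall>i\<in>{..<N}. \<forall>j\<in>{..<N}.
      inv (s l \<otimes> z k i j) \<otimes> p \<in> nbhd n \<and> s l \<otimes> z k i j \<noteq> p"
    by (intro eventually_ball_finite ballI finite_lessThan eventually_conj ev2 ev3) auto
  then obtain l where l: "\<And>i j. i < N \<Longrightarrow> j < N \<Longrightarrow>
      inv (s l \<otimes> z k i j) \<otimes> p \<in> nbhd n \<and> s l \<otimes> z k i j \<noteq> p"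
    unfolding eventually_sequentially by blast
  show thesis
  proof (rule that[OF x(1)[of l] bH[of k] inj])
    fix y assume "y \<in> fejer_support G (x l) (b k) N"
    then obtain i j where ij: "i < N" "j < N"
      and y: "y = x l \<otimes>\<^bsub>G\<^esub> b k [^]\<^bsub>G\<^esub> i \<otimes>\<^bsub>G\<^esub> inv\<^bsub>G\<^esub> (b k [^]\<^bsub>G\<^esub> j)"
      unfolding fejer_support_def by auto
    have h: "b k [^]\<^bsub>G\<^esub> i \<in> H" "b k [^]\<^bsub>G\<^esub> j \<in> H" "inv\<^bsub>G\<^esub> (b k [^]\<^bsub>G\<^esub> j) \<in> H"
      "x l \<otimes>\<^bsub>G\<^esub> b k [^]\<^bsub>G\<^esub> i \<in> H"
      using G.subgroup_nat_pow[OF H bH] subgroup.m_inv_closed[OF H] subgroup.m_closed[OF H] x(1) by blast+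
    have "y \<in> H" unfolding y using h subgroup.m_closed[OF H] by blast
    moreover have "\<alpha> y = s l \<otimes> z k i j"
      unfolding y z_def s_def using h x(1) bH \<alpha>_carrier by (simp add: \<alpha>_mult \<alpha>_inv \<alpha>_pow m_assoc)
    ultimately show "y \<in> H \<and> \<alpha> y \<noteq> p \<and> inv (\<alpha> y) \<otimes> p \<in> nbhd n" using l[OF ij] by simp
  qed
qed

text \<open>The square in the recursion makes the square root exact; neighbouring indices suffice by
  monotonicity.\<close>

lemma rapidly_growing_sequence:
  obtains m :: "nat \<Rightarrow> nat" where "\<And>k. 0 < m k"
    "\<And>j k. j < k \<Longrightarrow> 16 * 2 ^ k * real (44 * m j) \<le> sqrt (real (m k))"
proof -
  define m where "m = rec_nat 1 (\<lambda>k r. (16 * 2 ^ Suc k * (44 * r))\<^sup>2 :: nat)"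
  have S: "m (Suc k) = (16 * 2 ^ Suc k * (44 * m k))\<^sup>2" for k by (simp add: m_def)
  have pos: "0 < m k" for k by (induction k) (simp add: m_def, simp add: S)
  have "m k \<le> m (Suc k)" for k
  proof -
    have "m k \<le> 16 * 2 ^ Suc k * (44 * m k)" by simp
    also have "\<dots> \<le> (16 * 2 ^ Suc k * (44 * m k))\<^sup>2" by (rule self_le_power) (use pos[of k] in auto)
    finally show ?thesis by (simp add: S)
  qed
  then have mono: "m j \<le> m k" if "j \<le> k" for j k using that by (rule lift_Suc_mono_le)
  show thesis
  proof (rule that[OF pos])
    fix j k :: nat assume "j < k"
    then obtain i where k: "k = Suc i" and "j \<le> i" by (cases k) auto
    have "16 * 2 ^ k * real (44 * m j) \<le> real (16 * 2 ^ Suc i * (44 * m i))"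
      using mono[OF \<open>j \<le> i\<close>] unfolding k by simp
    also have "\<dots> = sqrt (real (m k))" unfolding k S of_nat_power by (simp only: real_sqrt_abs abs_of_nat)
    finally show "16 * 2 ^ k * real (44 * m j) \<le> sqrt (real (m k))" .
  qed
qed

lemma sum_powers_half_le:
  assumes "finite J" "J \<subseteq> {k0..}"
  shows "(\<Sum>k\<in>J. 1 / 2 ^ k) \<le> 2 / (2::real) ^ k0"
proof -
  obtain M where M: "\<forall>k\<in>J. k \<le> M" using assms(1) finite_nat_set_iff_bounded_le by blast
  have g: "(\<Sum>k\<in>{k0..<k0 + i}. 1 / (2::real) ^ k) = 2 / 2 ^ k0 - 2 / 2 ^ (k0 + i)" for i
  proof (induction i)
    case (Suc i)
    have "2 / 2 ^ (k0 + Suc i) = 1 / (2::real) ^ (k0 + i)"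
      "2 / 2 ^ (k0 + i) = 1 / (2::real) ^ (k0 + i) + 1 / 2 ^ (k0 + i)" by simp_all
    then show ?case using Suc by simp
  qed simp
  have "J \<subseteq> {k0..<k0 + Suc M}" using assms(2) M by force
  then have "(\<Sum>k\<in>J. 1 / (2::real) ^ k) \<le> (\<Sum>k\<in>{k0..<k0 + Suc M}. 1 / 2 ^ k)"
    by (intro sum_mono2) auto
  also have "\<dots> \<le> 2 / 2 ^ k0" unfolding g by simp
  finally show ?thesis .
qed

text \<open>The sets may overlap, so every point is charged to a single index. Outside the first k0
  sets all these indices are at least k0, and the k-th set costs at most 1 / 2^k.\<close>

lemma summable_tail:
  fixes h :: "'a \<Rightarrow> real" and S :: "nat \<Rightarrow> 'a set"
  assumes fin: "\<And>k. finite (S k)" and small: "\<And>k x. x \<in> S k \<Longrightarrow> h x \<le> 1 / (2 ^ k * real (card (S k)))"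
    and e: "0 < \<epsilon>"
  shows "\<exists>F. finite F \<and> F \<subseteq> (\<Union>k. S k) \<and> (\<forall>F'. finite F' \<longrightarrow> F' \<subseteq> (\<Union>k. S k) - F \<longrightarrow> sum h F' \<le> \<epsilon>)"
proof -
  obtain k0 where k0: "(1 / 2) ^ k0 < \<epsilon> / 2"
    using real_arch_pow_inv[of "\<epsilon> / 2" "1 / 2"] e by auto
  define F where "F = (\<Union>k\<in>{..<k0}. S k)"
  have "sum h F' \<le> \<epsilon>" if F': "finite F'" "F' \<subseteq> (\<Union>k. S k) - F" for F'
  proof -
    have "\<forall>x\<in>F'. \<exists>k. x \<in> S k \<and> k0 \<le> k"
    proof
      fix x assume "x \<in> F'"
      then obtain k where "x \<in> S k" "x \<notin> F" using F'(2) by auto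
      then show "\<exists>k. x \<in> S k \<and> k0 \<le> k" unfolding F_def by (intro exI[of _ k]) (auto simp: not_less[symmetric])
    qed
    then obtain q where q: "\<And>x. x \<in> F' \<Longrightarrow> x \<in> S (q x) \<and> k0 \<le> q x" by metis
    have "sum h F' = (\<Sum>k\<in>q ` F'. sum h {x \<in> F'. q x = k})" by (rule sum.image_gen[OF F'(1)])
    also have "\<dots> \<le> (\<Sum>k\<in>q ` F'. 1 / 2 ^ k)"
    proof (rule sum_mono)
      fix k assume "k \<in> q ` F'"
      define R where "R = {x \<in> F'. q x = k}"
      have R: "R \<subseteq> S k" using q by (auto simp: R_def)
      have "R \<noteq> {}" using \<open>k \<in> q ` F'\<close> by (auto simp: R_def)
      then have c: "0 < card (S k)" using R fin[of k] by (auto simp: card_gt_0_iff)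
      have "sum h R \<le> (\<Sum>x\<in>R. 1 / (2 ^ k * real (card (S k))))" by (rule sum_mono) (use R small in auto)
      also have "\<dots> = real (card R) / (2 ^ k * real (card (S k)))" by simp
      also have "\<dots> \<le> real (card (S k)) / (2 ^ k * real (card (S k)))"
        by (intro divide_right_mono) (use card_mono[OF fin R] in auto)
      also have "\<dots> = 1 / 2 ^ k" using c by simp
      finally show "sum h {x \<in> F'. q x = k} \<le> 1 / 2 ^ k" by (simp add: R_def)
    qed
    also have "\<dots> \<le> 2 / 2 ^ k0" by (rule sum_powers_half_le) (use F' q in auto)
    also have "\<dots> \<le> \<epsilon>" using k0 by (simp add: power_divide)
    finally show ?thesis .
  qed
  moreover have "finite F" unfolding F_def using fin by simp
  moreover have "F \<subseteq> (\<Union>k. S k)" unfolding F_def by blast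
  ultimately show ?thesis by blast
qed

theorem theorem8p13:
  fixes \<Gamma> :: "('a, 'm) monoid_scheme"
    and A :: "'a set"
    and K :: "('b, 'n) monoid_scheme"
    and T :: "'b topology"
  assumes "group \<Gamma>"
    and "A \<subseteq> carrier \<Gamma>" and "countable A"
    and "locally_compact_group K T" and "metrizable_space T"
    and "convergently_embedded \<Gamma> A K T"
    and "\<forall>n>0. finite {x \<in> generate \<Gamma> A. group.ord \<Gamma> x = n}"
  shows "\<exists>E. riesz_set \<Gamma> E \<and>
           \<not> reflexive_space (fourier_supported \<Gamma> E) (fourier_stieltjes_norm \<Gamma>)"
proof -
  interpret G: group \<Gamma> by (rule assms(1))
  have tg: "topological_group K T" "locally_compact_space T"
    using assms(4) unfolding locally_compact_group_def by auto
  have Kg: "group K" and top: "topspace T = carrier K" using tg(1) unfolding topological_group_def by auto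
  obtain M d where M: "Metric_space M d" "T = Metric_space.mtopology M d"
    using assms(5) unfolding metrizable_space_def by blast
  have MK: "M = carrier K" using top Metric_space.topspace_mtopology[OF M(1)] M(2) by simp
  interpret K: metrizable_lc_group K d
    using Kg M tg unfolding MK by (simp add: metrizable_lc_group_def metrizable_lc_group_axioms_def)
  have T: "T = K.mtopology" using M(2) MK by simp
  define H where "H = generate \<Gamma> A"
  have H: "subgroup H \<Gamma>" unfolding H_def by (rule G.generate_is_subgroup[OF assms(2)])
  obtain \<alpha> p where \<alpha>: "\<alpha> \<in> hom (subgroup_generated \<Gamma> A) K" "inj_on \<alpha> H"
    and p: "T derived_set_of (\<alpha> ` A) = {p}"
    using assms(6) unfolding convergently_embedded_def H_def by blast
  have carH: "carrier (subgroup_generated \<Gamma> A) = H"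
    using assms(2) by (simp add: carrier_subgroup_generated H_def Int_absorb1)
  have \<alpha>_carrier: "\<alpha> x \<in> carrier K" if "x \<in> H" for x
    using \<alpha>(1) that carH by (auto simp: hom_def)
  have \<alpha>_mult: "\<alpha> (x \<otimes>\<^bsub>\<Gamma>\<^esub> y) = \<alpha> x \<otimes>\<^bsub>K\<^esub> \<alpha> y" if "x \<in> H" "y \<in> H" for x y
    using \<alpha>(1) that carH by (auto simp: hom_def)
  have AH: "A \<subseteq> H" unfolding H_def by (auto intro: generate.incl)
  have HG: "H \<subseteq> carrier \<Gamma>" using subgroup.subset[OF H] .
  have "p \<in> K.mtopology derived_set_of (\<alpha> ` A)" using p T by simp
  then obtain \<sigma> where \<sigma>: "range \<sigma> \<subseteq> \<alpha> ` A" "inj \<sigma>" "limitin K.mtopology \<sigma> p sequentially"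
    unfolding K.derived_set_of_sequentially_inj by blast
  have "\<forall>k. \<exists>x\<in>A. \<sigma> k = \<alpha> x" using \<sigma>(1) by blast
  then obtain x where x: "\<And>k. x k \<in> A" "\<And>k. \<sigma> k = \<alpha> (x k)" by metis
  have \<sigma>x: "\<sigma> = (\<lambda>k. \<alpha> (x k))" using x(2) by blast
  have pK: "p \<in> carrier K" using K.limitin_mspace[OF \<sigma>(3)] .
  obtain \<kappa> :: "'b \<Rightarrow> 'b \<Rightarrow> real" where
    \<kappa>_pos: "\<And>n a s. (\<And>i. i < n \<Longrightarrow> s i \<in> carrier K) \<Longrightarrow>
      (\<And>v :: 'b \<Rightarrow> real. 0 \<le> (\<Sum>i<n. \<Sum>j<n. a i j * (v (s i) * v (s j)))) \<Longrightarrow>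
      0 \<le> (\<Sum>i<(n::nat). \<Sum>j<n. a i j * \<kappa> (s i) (s j))"
    and \<kappa>_inv: "\<And>u s t. u \<in> carrier K \<Longrightarrow> s \<in> carrier K \<Longrightarrow> t \<in> carrier K \<Longrightarrow>
      \<kappa> (u \<otimes>\<^bsub>K\<^esub> s) (u \<otimes>\<^bsub>K\<^esub> t) = \<kappa> s t"
    and \<kappa>_sym: "\<And>s t. \<kappa> s t = \<kappa> t s"
    and \<kappa>_diag: "\<And>s. s \<in> carrier K \<Longrightarrow> \<kappa> s s = 1"
    and \<kappa>_nonneg: "\<And>s t. s \<in> carrier K \<Longrightarrow> t \<in> carrier K \<Longrightarrow> 0 \<le> \<kappa> s t"
    and \<kappa>_less: "\<And>s t. s \<in> carrier K \<Longrightarrow> t \<in> carrier K \<Longrightarrow> s \<noteq> t \<Longrightarrow> \<kappa> s t < 1"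
    and \<kappa>_cont: "\<And>p e. p \<in> carrier K \<Longrightarrow> 0 < e \<Longrightarrow>
      \<exists>n. \<forall>s\<in>carrier K. inv\<^bsub>K\<^esub> s \<otimes>\<^bsub>K\<^esub> p \<in> K.nbhd n \<longrightarrow> 1 - \<kappa> s p < e"
    by (fact K.invariant_kernel)
  define g where "g = (\<lambda>x. if x \<in> H then \<kappa> (\<alpha> x) p else 0)"
  have g_mult: "contraction \<Gamma> (map (\<lambda>(c, x). (of_real (g x) * c, x)) f)" if "contraction \<Gamma> f" for f
    unfolding g_def
    by (rule G.contraction_kernel_multiplier[where K = K and \<kappa> = \<kappa> and \<alpha> = \<alpha> and p = p and H = H])
      (fact H Kg \<alpha>_carrier \<alpha>_mult \<kappa>_pos \<kappa>_inv \<kappa>_sym \<kappa>_diag pK that)+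
  have g01: "0 \<le> g x \<and> g x \<le> 1" for x
    using \<kappa>_nonneg[OF \<alpha>_carrier pK] \<kappa>_less[OF \<alpha>_carrier pK] \<kappa>_diag[OF pK]
    by (cases "\<alpha> x = p") (auto simp: g_def less_imp_le)
  have g_less: "g x < 1" if "x \<in> H" "\<alpha> x \<noteq> p" for x
    using \<kappa>_less[OF \<alpha>_carrier[OF that(1)] pK that(2)] that by (simp add: g_def)
  \<comment> \<open>g x = 1 forces \<open>\<alpha> x = p\<close>, which happens at most once in
    H.\<close>
  have g_one: "finite {x \<in> carrier \<Gamma>. g x = 1}"
  proof -
    have "{x \<in> carrier \<Gamma>. g x = 1} \<subseteq> \<alpha> -` {p} \<inter> H"
      using g_less by (fastforce simp: g_def split: if_splits)
    moreover have "finite (\<alpha> -` {p} \<inter> H)" by (rule finite_vimage_IntI) (use \<alpha>(2) in auto)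
    ultimately show ?thesis by (rule finite_subset)
  qed
  obtain m :: "nat \<Rightarrow> nat" where m: "\<And>k. 0 < m k"
    "\<And>j k. j < k \<Longrightarrow> 16 * 2 ^ k * real (44 * m j) \<le> sqrt (real (m k))"
    by (fact rapidly_growing_sequence)
  have "\<exists>a b. a \<in> H \<and> b \<in> H \<and> inj_on (\<lambda>j. b [^]\<^bsub>\<Gamma>\<^esub> (j::nat)) {..<N} \<and>
      (\<forall>y\<in>fejer_support \<Gamma> a b N. y \<in> H \<and> 0 < 1 - g y \<and> 1 - g y < e)" if e: "0 < e" for N e
  proof -
    obtain n where n: "\<forall>s\<in>carrier K. inv\<^bsub>K\<^esub> s \<otimes>\<^bsub>K\<^esub> p \<in> K.nbhd n \<longrightarrow> 1 - \<kappa> s p < e"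
      using \<kappa>_cont[OF pK e] by blast
    obtain a b where ab: "a \<in> H" "b \<in> H" "inj_on (\<lambda>j. b [^]\<^bsub>\<Gamma>\<^esub> (j::nat)) {..<N}"
      "\<And>y. y \<in> fejer_support \<Gamma> a b N \<Longrightarrow> y \<in> H \<and> \<alpha> y \<noteq> p \<and> inv\<^bsub>K\<^esub> (\<alpha> y) \<otimes>\<^bsub>K\<^esub> p \<in> K.nbhd n"
    proof (rule K.progression_near_limit_point[where G = \<Gamma> and H = H and \<alpha> = \<alpha> and x = x and p = p and N = N and n = n])
      show "inj (\<lambda>k. \<alpha> (x k))" "limitin K.mtopology (\<lambda>k. \<alpha> (x k)) p sequentially" using \<sigma> \<sigma>x by simp_all
      show "x k \<in> H" for k using x(1) AH by blast
      show "finite {y \<in> H. G.ord y = n}" if "0 < n" for n using assms(7) that by (simp add: H_def)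
    qed (use H \<alpha>_carrier \<alpha>_mult \<alpha>(2) assms(1) in blast)+
    have "y \<in> H \<and> 0 < 1 - g y \<and> 1 - g y < e" if y: "y \<in> fejer_support \<Gamma> a b N" for y
      using ab(4)[OF y] g_less[of y] n \<alpha>_carrier[of y] by (simp add: g_def)
    then show ?thesis using ab(1-3) by blast
  qed
  note patch = this
  \<comment> \<open>A support has at most (44 m_k)^2 points, so 1 - g sums to at most 1 / 2^k over
    the k-th one.\<close>
  define e where "e = (\<lambda>k. 1 / (2 ^ k * real ((44 * m k) * (44 * m k))))"
  have e: "0 < e k" for k unfolding e_def using m(1)[of k] by simp
  have "\<forall>k. \<exists>a b. a \<in> H \<and> b \<in> H \<and> inj_on (\<lambda>j. b [^]\<^bsub>\<Gamma>\<^esub> (j::nat)) {..<44 * m k} \<and>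
      (\<forall>y\<in>fejer_support \<Gamma> a b (44 * m k). y \<in> H \<and> 0 < 1 - g y \<and> 1 - g y < e k)"
    using patch e by blast
  then obtain a b where ab: "\<And>k. a k \<in> H" "\<And>k. b k \<in> H"
    "\<And>k. inj_on (\<lambda>j. b k [^]\<^bsub>\<Gamma>\<^esub> (j::nat)) {..<44 * m k}"
    "\<And>k y. y \<in> fejer_support \<Gamma> (a k) (b k) (44 * m k) \<Longrightarrow> y \<in> H \<and> 0 < 1 - g y \<and> 1 - g y < e k"
    by metis
  define S where "S = (\<lambda>k. fejer_support \<Gamma> (a k) (b k) (44 * m k))"
  have Sfin: "finite (S k)" for k unfolding S_def fejer_support_def by simp
  have Scard: "card (S k) \<le> (44 * m k) * (44 * m k)" for k
    unfolding S_def fejer_support_def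
    using card_image_le[of "{..<44 * m k} \<times> {..<44 * m k}"] by (simp add: card_cartesian_product)
  define E where "E = (\<Union>k. S k)"
  have EH: "E \<subseteq> H" using ab(4) unfolding E_def S_def by blast
  have small: "1 - g y \<le> 1 / (2 ^ k * real (card (S k)))" if y: "y \<in> S k" for k y
  proof -
    have "0 < card (S k)" using y Sfin by (auto simp: card_gt_0_iff)
    then have "e k \<le> 1 / (2 ^ k * real (card (S k)))"
      unfolding e_def by (intro divide_left_mono mult_left_mono) (use Scard[of k] m(1)[of k] in \<open>auto simp del: of_nat_mult\<close>)
    then show ?thesis using ab(4)[of y k] y unfolding S_def by simp
  qed
  have "riesz_set \<Gamma> E"
  proof (rule G.riesz_criterion)
    show "E \<subseteq> carrier \<Gamma>" using EH HG by blast
    show "contraction \<Gamma> (map (\<lambda>(c, x). (of_real (g x) * c, x)) f)" if "contraction \<Gamma> f" for f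
      by (rule g_mult[OF that])
    show "finite {x \<in> carrier \<Gamma>. g x = 1}" by (rule g_one)
    fix \<epsilon> :: real assume "0 < \<epsilon>"
    from summable_tail[OF Sfin small this]
    show "\<exists>F. finite F \<and> F \<subseteq> E \<and> (\<forall>F'. finite F' \<longrightarrow> F' \<subseteq> E - F \<longrightarrow> (\<Sum>x\<in>F'. 1 - g x) \<le> \<epsilon>)"
      unfolding E_def .
  qed (rule g01)
  moreover have "\<not> reflexive_space (fourier_supported \<Gamma> E) (fourier_stieltjes_norm \<Gamma>)"
  proof (rule G.not_reflexive_criterion[where a = a and d = b and m = m])
    show "fejer_support \<Gamma> (a k) (b k) (44 * m k) \<subseteq> E" for k unfolding E_def S_def by blast
    fix y
    show "finite {k. y \<in> fejer_support \<Gamma> (a k) (b k) (44 * m k)}"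
    \<comment> \<open>On every support 1 - g is positive, and on the k-th one it is at most 1 / 2^k;
      hence a given y belongs to finitely many of them.\<close>
    proof (cases "0 < 1 - g y")
      case False
      then have "{k. y \<in> fejer_support \<Gamma> (a k) (b k) (44 * m k)} = {}" using ab(4) by blast
      then show ?thesis by simp
    next
      case True
      obtain k0 where k0: "(1 / 2) ^ k0 < 1 - g y"
        using real_arch_pow_inv[OF True, of "1 / 2"] by auto
      have "k \<le> k0" if k: "y \<in> fejer_support \<Gamma> (a k) (b k) (44 * m k)" for k
      proof (rule ccontr)
        assume "\<not> k \<le> k0"
        have "0 < card (S k)" using k Sfin[of k] unfolding S_def by (auto simp: card_gt_0_iff)
        then have "1 / (2 ^ k * real (card (S k))) \<le> 1 / (2 ^ k * 1)"
          by (intro divide_left_mono mult_left_mono) auto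
        then have "1 - g y \<le> (1 / 2) ^ k" using small[of y k] k unfolding S_def by (simp add: power_divide)
        also have "\<dots> \<le> (1 / 2) ^ k0" using \<open>\<not> k \<le> k0\<close> by (intro power_decreasing) auto
        finally show False using k0 by simp
      qed
      then have "{k. y \<in> fejer_support \<Gamma> (a k) (b k) (44 * m k)} \<subseteq> {..k0}" by blast
      then show ?thesis by (rule finite_subset) simp
    qed
  qed (use ab HG m in auto)
  ultimately show ?thesis by blast
qed

end
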